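(* Let $\mathcal{A}\in Sp(2d,\mathbb{R})$, $\varphi_1,\varphi_2\in\mathcal{S}(\mathbb{R}^d)$ and $a\in\mathcal{S}'(\mathbb{R}^{2d})$. Then the Schwartz kernel $k$ of $A_{a,\mathcal{A}}^{\varphi_1,\varphi_2}$ is given by $$k=\hat{\mathcal{A}}^{-1}\big(a*W_{\mathcal{A}}(\varphi_2,\varphi_1)\big).$$
   Context: Brackets $\langle f,g\rangle$ extend the $L^2$ inner product $\int f\overline{g}$ (conjugate-linear in the second entry) to $\mathcal{S}'\times\mathcal{S}$. $T_xf(t)=f(t-x)$, $M_\xi f(t)=e^{2\pi i\xi\cdot t}f(t)$. Metaplectic operators: $Sp(2d,\mathbb{R})$ is the group of real $4d\times4d$ matrices $\mathcal{A}$ with $\mathcal{A}^TJ\mathcal{A}=J$, $J=\begin{pmatrix}0&I_{2d}\\-I_{2d}&0\end{pmatrix}$. For $x,\xi\in\mathbb{R}^{2d}$, $\tau\in\mathbb{R}$ let $\rho(x,\xi;\tau)=e^{2\pi i\tau}e^{-\pi i\xi\cdot x}M_\xi T_x$ on $L^2(\mathbb{R}^{2d})$. $\hat{\mathcal{A}}$ denotes a fixed metaplectic operator with projection $\mathcal{A}$: a unitary operator on $L^2(\mathbb{R}^{2d})$ with $\hat{\mathcal{A}}\rho(w;\tau)\hat{\mathcal{A}}^{-1}=\rho(\mathcal{A}w;\tau)$ for all $w\in\mathbb{R}^{4d}$, $\tau\in\mathbb{R}$. It is unique up to a unimodular constant, restricts to an automorphism of $\mathcal{S}(\mathbb{R}^{2d})$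 and extends to one of $\mathcal{S}'(\mathbb{R}^{2d})$ via $\langle\hat{\mathcal{A}}F,\hat{\mathcal{A}}\psi\rangle=\langle F,\psi\rangle$. The same choice of $\hat{\mathcal{A}}$ is used throughout. $W_{\mathcal{A}}(f,g)=\hat{\mathcal{A}}(f\otimes\overline{g})$, $(f\otimes\overline g)(x,y)=f(x)\overline{g(y)}$. For $\sigma\in\mathcal{S}'(\mathbb{R}^{2d})$, $\operatorname{Op}_{\mathcal{A}}(\sigma):\mathcal{S}(\mathbb{R}^d)\to\mathcal{S}'(\mathbb{R}^d)$ is defined by $\langle\operatorname{Op}_{\mathcal{A}}(\sigma)f,g\rangle=\langle\sigma,W_{\mathcal{A}}(g,f)\rangle$. The $\mathcal{A}$-localization operator is $A_{a,\mathcal{A}}^{\varphi_1,\varphi_2}=\operatorname{Op}_{\mathcal{A}}(a*W_{\mathcal{A}}(\varphi_2,\varphi_1))$. Its Schwartz kernel is the $k\in\mathcal{S}'(\mathbb{R}^{2d})$ with $\langle A_{a,\mathcal{A}}^{\varphi_1,\varphi_2}f,g\rangle=\langle k,g\otimes\overline{f}\rangle$ for all $f,g\in\mathcal{S}(\mathbb{R}^d)$. *)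

theory Defs
  imports "HOL-Analysis.Analysis"
begin

text \<open>
  The index type \<open>'d + 'd\<close> has twice the cardinality of \<open>'d\<close>, so \<open>real^('d + 'd)\<close> is
  \<open>2d\<close>-dimensional and \<open>real^(('d + 'd) + ('d + 'd))\<close> is \<open>4d\<close>-dimensional, where \<open>d\<close> is
  the cardinality of \<open>'d\<close>. A vector is split into its two halves as follows.
\<close>

definition upper :: "real^('n::finite + 'n) \<Rightarrow> real^'n" where
  "upper z = (\<chi> i. z $ Inl i)"

definition lower :: "real^('n::finite + 'n) \<Rightarrow> real^'n" where
  "lower z = (\<chi> i. z $ Inr i)"

definition symp_J :: "real^('n::finite + 'n)^('n + 'n)" where
  "symp_J = (\<chi> i j. case (i, j) of
       (Inl a, Inr b) \<Rightarrow> if a = b then 1 else 0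
     | (Inr a, Inl b) \<Rightarrow> if a = b then - 1 else 0
     | _ \<Rightarrow> 0)"

definition Sp :: "(real^('n::finite + 'n)^('n + 'n)) set" where
  "Sp = {A. transpose A ** symp_J ** A = symp_J}"


subsection \<open>Schwartz functions and tempered distributions\<close>

primrec iter_pd :: "'a::euclidean_space list \<Rightarrow> ('a \<Rightarrow> complex) \<Rightarrow> 'a \<Rightarrow> complex" where
  "iter_pd [] f = f"
| "iter_pd (b # bs) f = (\<lambda>x. frechet_derivative (iter_pd bs f) (at x) b)"

text \<open>
  Requiring every iterated partial derivative (along basis vectors) to be differentiable
  everywhere is smoothness.
\<close>

definition schwartz :: "('a::euclidean_space \<Rightarrow> complex) set" where
  "schwartz = {f. \<forall>bs. set bs \<subseteq> Basis \<longrightarrow>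
      (\<forall>x. iter_pd bs f differentiable (at x)) \<and>
      (\<forall>k::nat. bdd_above (range (\<lambda>x. (1 + norm x) ^ k * norm (iter_pd bs f x))))}"

text \<open>An increasing family of norms defining the topology of the Schwartz space.\<close>

definition schwartz_norm :: "nat \<Rightarrow> ('a::euclidean_space \<Rightarrow> complex) \<Rightarrow> real" where
  "schwartz_norm N f = (\<Sum>bs | set bs \<subseteq> Basis \<and> length bs \<le> N.
      (SUP x. (1 + norm x) ^ N * norm (iter_pd bs f x)))"

text \<open>
  Tempered distributions are the continuous \<^emph>\<open>linear\<close> functionals on the Schwartz space;
  being extensional, they are equal iff they agree on Schwartz functions.
\<close>

definition tempered :: "(('a::euclidean_space \<Rightarrow> complex) \<Rightarrow> complex) set" where
  "tempered = {u. u \<in> extensional schwartz \<and>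
      (\<forall>f\<in>schwartz. \<forall>g\<in>schwartz. u (\<lambda>x. f x + g x) = u f + u g) \<and>
      (\<forall>f\<in>schwartz. \<forall>c. u (\<lambda>x. c * f x) = c * u f) \<and>
      (\<exists>N C. \<forall>f\<in>schwartz. norm (u f) \<le> C * schwartz_norm N f)}"

text \<open>
  The sesquilinear bracket extending the \<open>L\<^sup>2\<close> inner product: a function \<open>F\<close> corresponds to
  the functional sending \<open>\<psi>\<close> to the integral of \<open>F \<psi>\<close>, hence the conjugation.
\<close>

definition bracket :: "(('a::euclidean_space \<Rightarrow> complex) \<Rightarrow> complex) \<Rightarrow> ('a \<Rightarrow> complex) \<Rightarrow> complex" where
  "bracket u \<psi> = u (\<lambda>x. cnj (\<psi> x))"

text \<open>
  The convolution of a tempered distribution \<open>a\<close> with a Schwartz function \<open>\<Phi>\<close> is the function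
  sending \<open>x\<close> to \<open>a\<close> applied to \<open>\<Phi> (x - \<cdot>)\<close>. It is smooth and of polynomial growth, and it is
  regarded as a tempered distribution through integration.
\<close>

definition conv :: "(('a::euclidean_space \<Rightarrow> complex) \<Rightarrow> complex) \<Rightarrow> ('a \<Rightarrow> complex)
    \<Rightarrow> ('a \<Rightarrow> complex) \<Rightarrow> complex" where
  "conv a \<Phi> = (\<lambda>\<psi>\<in>schwartz. LINT x|lborel. a (\<lambda>y. \<Phi> (x - y)) * \<psi> x)"


subsection \<open>Metaplectic operators\<close>

definition L2 :: "('a::euclidean_space \<Rightarrow> complex) set" where
  "L2 = {f \<in> borel_measurable lborel. integrable lborel (\<lambda>x. (norm (f x))\<^sup>2)}"

definition L2_inner :: "('a::euclidean_space \<Rightarrow> complex) \<Rightarrow> ('a \<Rightarrow> complex) \<Rightarrow> complex" where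
  "L2_inner f g = (LINT x|lborel. f x * cnj (g x))"

text \<open>
  Operators on \<open>L\<^sup>2\<close> act on representatives; every identity between values is meant almost
  everywhere, and the second clause says that the operator is well defined on classes.
\<close>

definition unitary_L2 :: "(('a::euclidean_space \<Rightarrow> complex) \<Rightarrow> 'a \<Rightarrow> complex) \<Rightarrow> bool" where
  "unitary_L2 U \<longleftrightarrow>
     (\<forall>f\<in>L2. U f \<in> L2) \<and>
     (\<forall>f\<in>L2. \<forall>g\<in>L2. (AE x in lborel. f x = g x) \<longrightarrow> (AE x in lborel. U f x = U g x)) \<and>
     (\<forall>f\<in>L2. \<forall>g\<in>L2. AE x in lborel. U (\<lambda>y. f y + g y) x = U f x + U g x) \<and>
     (\<forall>f\<in>L2. \<forall>c. AE x in lborel. U (\<lambda>y. c * f y) x = c * U f x) \<and>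
     (\<forall>f\<in>L2. \<forall>g\<in>L2. L2_inner (U f) (U g) = L2_inner f g) \<and>
     (\<forall>g\<in>L2. \<exists>f\<in>L2. AE x in lborel. U f x = g x)"

definition translate :: "'a::euclidean_space \<Rightarrow> ('a \<Rightarrow> complex) \<Rightarrow> 'a \<Rightarrow> complex" where
  "translate x f = (\<lambda>t. f (t - x))"

definition modulate :: "'a::euclidean_space \<Rightarrow> ('a \<Rightarrow> complex) \<Rightarrow> 'a \<Rightarrow> complex" where
  "modulate \<xi> f = (\<lambda>t. cis (2 * pi * (\<xi> \<bullet> t)) * f t)"

definition rho :: "real^('n::finite + 'n) \<Rightarrow> real \<Rightarrow> (real^'n \<Rightarrow> complex) \<Rightarrow> real^'n \<Rightarrow> complex" where
  "rho w \<tau> f = (\<lambda>t. cis (2 * pi * \<tau>) * cis (- pi * (lower w \<bullet> upper w)) *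
      modulate (lower w) (translate (upper w) f) t)"

definition metaplectic ::
  "real^('n::finite + 'n)^('n + 'n) \<Rightarrow> ((real^'n \<Rightarrow> complex) \<Rightarrow> real^'n \<Rightarrow> complex) \<Rightarrow> bool" where
  "metaplectic A U \<longleftrightarrow> unitary_L2 U \<and>
     (\<forall>w \<tau>. \<forall>f\<in>L2. AE t in lborel. U (rho w \<tau> f) t = rho (A *v w) \<tau> (U f) t)"

text \<open>
  The restriction of a metaplectic operator to the Schwartz space: the value is the (unique)
  Schwartz representative of the \<open>L\<^sup>2\<close> class of \<open>U f\<close>.
\<close>

definition met_schwartz ::
  "(('a::euclidean_space \<Rightarrow> complex) \<Rightarrow> 'a \<Rightarrow> complex) \<Rightarrow> ('a \<Rightarrow> complex) \<Rightarrow> 'a \<Rightarrow> complex" where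
  "met_schwartz U f = (THE g. g \<in> schwartz \<and> (AE x in lborel. U f x = g x))"

text \<open>
  The extension to tempered distributions, determined by
  \<open>bracket (met_dist U u) (met_schwartz U \<psi>) = bracket u \<psi>\<close>; the conjugation compensates
  the one in \<^const>\<open>bracket\<close>.
\<close>

definition met_dist :: "(('a::euclidean_space \<Rightarrow> complex) \<Rightarrow> 'a \<Rightarrow> complex)
    \<Rightarrow> (('a \<Rightarrow> complex) \<Rightarrow> complex) \<Rightarrow> ('a \<Rightarrow> complex) \<Rightarrow> complex" where
  "met_dist U u =
     (\<lambda>\<psi>\<in>schwartz. bracket u (inv_into schwartz (met_schwartz U) (\<lambda>x. cnj (\<psi> x))))"

definition met_dist_inv :: "(('a::euclidean_space \<Rightarrow> complex) \<Rightarrow> 'a \<Rightarrow> complex)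
    \<Rightarrow> (('a \<Rightarrow> complex) \<Rightarrow> complex) \<Rightarrow> ('a \<Rightarrow> complex) \<Rightarrow> complex" where
  "met_dist_inv U = inv_into tempered (met_dist U)"


subsection \<open>Metaplectic Wigner distributions and localization operators\<close>

definition tensor :: "(real^'d::finite \<Rightarrow> complex) \<Rightarrow> (real^'d \<Rightarrow> complex)
    \<Rightarrow> real^('d + 'd) \<Rightarrow> complex" where
  "tensor f g = (\<lambda>z. f (upper z) * g (lower z))"

definition wigner :: "((real^('d::finite + 'd) \<Rightarrow> complex) \<Rightarrow> real^('d + 'd) \<Rightarrow> complex)
    \<Rightarrow> (real^'d \<Rightarrow> complex) \<Rightarrow> (real^'d \<Rightarrow> complex) \<Rightarrow> real^('d + 'd) \<Rightarrow> complex" where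
  "wigner U f g = met_schwartz U (tensor f (\<lambda>y. cnj (g y)))"

definition Op :: "((real^('d::finite + 'd) \<Rightarrow> complex) \<Rightarrow> real^('d + 'd) \<Rightarrow> complex)
    \<Rightarrow> ((real^('d + 'd) \<Rightarrow> complex) \<Rightarrow> complex)
    \<Rightarrow> (real^'d \<Rightarrow> complex) \<Rightarrow> (real^'d \<Rightarrow> complex) \<Rightarrow> complex" where
  "Op U \<sigma> f = (\<lambda>h\<in>schwartz. bracket \<sigma> (wigner U (\<lambda>x. cnj (h x)) f))"

definition loc_op :: "((real^('d::finite + 'd) \<Rightarrow> complex) \<Rightarrow> real^('d + 'd) \<Rightarrow> complex)
    \<Rightarrow> ((real^('d + 'd) \<Rightarrow> complex) \<Rightarrow> complex)
    \<Rightarrow> (real^'d \<Rightarrow> complex) \<Rightarrow> (real^'d \<Rightarrow> complex)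
    \<Rightarrow> (real^'d \<Rightarrow> complex) \<Rightarrow> (real^'d \<Rightarrow> complex) \<Rightarrow> complex" where
  "loc_op U a \<phi>1 \<phi>2 = Op U (conv a (wigner U \<phi>2 \<phi>1))"

definition is_schwartz_kernel ::
  "((real^'d::finite \<Rightarrow> complex) \<Rightarrow> (real^'d \<Rightarrow> complex) \<Rightarrow> complex)
    \<Rightarrow> ((real^('d + 'd) \<Rightarrow> complex) \<Rightarrow> complex) \<Rightarrow> bool" where
  "is_schwartz_kernel T k \<longleftrightarrow> k \<in> tempered \<and>
     (\<forall>f\<in>schwartz. \<forall>g\<in>schwartz.
        bracket (T f) g = bracket k (tensor g (\<lambda>y. cnj (f y))))"


text \<open>The defining identity of \<^const>\<open>Op\<close> in terms of the bracket.\<close>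

lemma iter_pd_cnj:
  assumes "f \<in> schwartz" "set bs \<subseteq> Basis"
  shows "iter_pd bs (\<lambda>x. cnj (f x)) = (\<lambda>x. cnj (iter_pd bs f x))"
  using assms(2)
proof (induction bs)
  case Nil
  show ?case by simp
next
  case (Cons b bs)
  then have "(iter_pd bs f) differentiable (at x)" for x
    using assms(1) by (auto simp: schwartz_def)
  then have "(iter_pd bs f has_derivative frechet_derivative (iter_pd bs f) (at x)) (at x)" for x
    by (simp add: frechet_derivative_works)
  then have "((\<lambda>x. cnj (iter_pd bs f x)) has_derivative
      (\<lambda>h. cnj (frechet_derivative (iter_pd bs f) (at x) h))) (at x)" for x
    by (rule bounded_linear.has_derivative[OF bounded_linear_cnj])
  then have "frechet_derivative (\<lambda>x. cnj (iter_pd bs f x)) (at x) =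
      (\<lambda>h. cnj (frechet_derivative (iter_pd bs f) (at x) h))" for x
    using frechet_derivative_at by metis
  then show ?case
    using Cons by simp
qed

lemma schwartz_cnj:
  assumes "f \<in> schwartz"
  shows "(\<lambda>x. cnj (f x)) \<in> schwartz"
proof -
  have "(\<lambda>x. cnj (g x)) differentiable (at x)" if "g differentiable (at x)"
    for g :: "'a \<Rightarrow> complex" and x
    using that bounded_linear.has_derivative[OF bounded_linear_cnj]
    unfolding differentiable_def by blast
  then show ?thesis
    using assms iter_pd_cnj[OF assms] by (auto simp: schwartz_def)
qed

lemma bracket_Op:
  assumes "g \<in> schwartz"
  shows "bracket (Op U \<sigma> f) g = bracket \<sigma> (wigner U g f)"
proof -
  have "bracket (Op U \<sigma> f) g = Op U \<sigma> f (\<lambda>x. cnj (g x))"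
    by (rule bracket_def)
  then show ?thesis
    using schwartz_cnj[OF assms] by (simp add: Op_def)
qed

end

theory Submission
  imports Defs "HOL-Probability.Characteristic_Functions" "HOL-Probability.Sinc_Integral"
begin

text \<open>
  Unfolding the definitions, \<open>k\<close> is a kernel iff
  \<open>\<langle>\<sigma>, met_schwartz U (g \<otimes> cnj f)\<rangle> = \<langle>k, g \<otimes> cnj f\<rangle>\<close> with \<open>\<sigma> = a * W(\<phi>2, \<phi>1)\<close>, and the adjoint of
  \<open>met_schwartz U\<close> applied to \<open>\<sigma>\<close> is \<open>met_dist_inv U \<sigma>\<close>. Two analytic facts carry this.

  First, \<open>U\<close> restricts to a topological automorphism of the Schwartz space. Differentiating
  \<open>U (rho (s w) f) = rho (s A w) (U f)\<close> at \<open>s = 0\<close> shows that multiplying \<open>U f\<close> by a coordinate or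
  differentiating it weakly gives \<open>U f'\<close> with \<open>f'\<close> again Schwartz, hence stays square integrable;
  by Fourier inversion \<open>U f\<close> has a Schwartz representative, with seminorm bounds. The inverse of
  \<open>U\<close> is metaplectic for the inverse matrix, so the same applies to it.

  Second, a tempered distribution \<open>u\<close> that vanishes on all tensors is zero: translated Gaussians
  are tensors, so \<open>u\<close> kills \<open>\<phi> * \<gamma>\<close> for every Gaussian \<open>\<gamma>\<close>; but this equals
  \<open>\<integral> \<gamma>(y) u(\<phi>(\<cdot> - y)) dy\<close>, which after normalisation tends to \<open>u(\<phi>)\<close> as \<open>\<gamma>\<close> concentrates at \<open>0\<close>.
\<close>

subsection \<open>The Schwartz space\<close>

text \<open>The equivalence contains existence and uniqueness of the kernel: that the formula yields
  a kernel is pure duality, while equality with every kernel needs tensors to determine a tempered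
  distribution. The metaplectic operator is known only through its intertwining relation, so there
  is no factorisation into Fourier transforms, dilations and chirps to work with. Instead, with B
  inverse to A, the vectors B (0, b) and B (-b, 0) turn the generator of \<open>rho\<close> acting
  on f into multiplication of U f by a coordinate and into a partial derivative of U f. The obstacle
  is that U f is at that point just a representative of an L2 class. Modulation quotients of U f
  converge pointwise, so multiplication is recovered almost everywhere; translation quotients need
  not, so the derivative is recovered only weakly, against Schwartz functions. Fourier inversion for
  integrable functions with integrable transform bridges this gap. Seminorm bounds are carried along
  because distributions are transported by adjoints, which must stay continuous.\<close>

definition pd :: "'a::euclidean_space \<Rightarrow> ('a \<Rightarrow> complex) \<Rightarrow> 'a \<Rightarrow> complex" where
  "pd b f = (\<lambda>x. frechet_derivative f (at x) b)"

lemma iter_pd_Cons: "iter_pd (b # bs) f = pd b (iter_pd bs f)"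
  by (simp add: pd_def)

lemma iter_pd_append: "iter_pd (bs @ cs) f = iter_pd bs (iter_pd cs f)"
  by (induction bs) auto

lemma iter_pd_snoc: "iter_pd (bs @ [b]) f = iter_pd bs (pd b f)"
  by (simp add: iter_pd_append pd_def)

lemma pd_eqI:
  assumes "\<And>x. (f has_derivative D x) (at x)"
  shows "pd b f = (\<lambda>x. D x b)"
  using frechet_derivative_at[OF assms] by (simp add: pd_def)

text \<open>Induction on the list of directions keeps every iterated derivative inside
  \<open>F\<close>, so closed formulas for iterated derivatives are avoided. Each use chooses
  \<open>F\<close> large enough to absorb what the product or chain rule produces.\<close>

lemma schwartz_coinduct [consumes 1, case_names differentiable pd decay]:
  fixes F :: "('a::euclidean_space \<Rightarrow> complex) set"
  assumes "f \<in> F"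
    and diff: "\<And>f x. f \<in> F \<Longrightarrow> f differentiable (at x)"
    and pd: "\<And>f b. f \<in> F \<Longrightarrow> b \<in> Basis \<Longrightarrow> pd b f \<in> F"
    and decay: "\<And>f k. f \<in> F \<Longrightarrow> \<exists>C. \<forall>x. (1 + norm x) ^ k * norm (f x) \<le> C"
  shows "f \<in> schwartz"
proof -
  have "iter_pd bs f \<in> F" if "set bs \<subseteq> Basis" for bs
    using that
  proof (induction bs)
    case (Cons b bs)
    then show ?case using pd[of "iter_pd bs f" b] by (simp add: pd_def)
  qed (use assms in auto)
  then show ?thesis
    using diff decay unfolding schwartz_def bdd_above_def by blast
qed

lemma schwartz_iter_pd:
  assumes "f \<in> schwartz" "set bs \<subseteq> Basis"
  shows "iter_pd bs f \<in> schwartz"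
proof -
  have "iter_pd cs (iter_pd bs f) = iter_pd (cs @ bs) f" for cs
    by (simp add: iter_pd_append)
  then show ?thesis
    using assms by (auto simp: schwartz_def)
qed

lemma schwartz_pd: "f \<in> schwartz \<Longrightarrow> b \<in> Basis \<Longrightarrow> pd b f \<in> schwartz"
  using schwartz_iter_pd[of f "[b]"] by (simp add: pd_def)

lemma schwartz_differentiable: "f \<in> schwartz \<Longrightarrow> f differentiable (at x)"
  unfolding schwartz_def by (auto dest!: spec[of _ "[]"])

lemma schwartz_decay:
  assumes "f \<in> schwartz"
  obtains C where "C > 0" "\<And>x. (1 + norm x) ^ k * norm (f x) \<le> C"
proof -
  have "bdd_above (range (\<lambda>x. (1 + norm x) ^ k * norm (iter_pd [] f x)))"
    using assms unfolding schwartz_def by (auto dest!: spec[of _ "[]"] simp del: iter_pd.simps)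
  then obtain C where "\<And>x. (1 + norm x) ^ k * norm (f x) \<le> C"
    by (auto simp: bdd_above_def)
  then show ?thesis
    using that[of "max C 1"] by (simp add: le_max_iff_disj)
qed

lemma schwartz_has_derivative:
  fixes f :: "'a::euclidean_space \<Rightarrow> complex"
  assumes "f \<in> schwartz"
  shows "(f has_derivative (\<lambda>h. \<Sum>b\<in>Basis. (h \<bullet> b) *\<^sub>R pd b f x)) (at x)"
proof -
  have D: "(f has_derivative frechet_derivative f (at x)) (at x)"
    using schwartz_differentiable[OF assms] frechet_derivative_works by blast
  then interpret linear "frechet_derivative f (at x)"
    by (rule has_derivative_linear)
  have "frechet_derivative f (at x) h = (\<Sum>b\<in>Basis. (h \<bullet> b) *\<^sub>R pd b f x)" for h
  proof -
    have "frechet_derivative f (at x) (\<Sum>b\<in>Basis. (h \<bullet> b) *\<^sub>R b) = (\<Sum>b\<in>Basis. (h \<bullet> b) *\<^sub>R pd b f x)"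
      by (simp only: sum scale pd_def)
    then show ?thesis by (simp only: euclidean_representation)
  qed
  then have "frechet_derivative f (at x) = (\<lambda>h. \<Sum>b\<in>Basis. (h \<bullet> b) *\<^sub>R pd b f x)" ..
  then show ?thesis using D by simp
qed

lemma schwartz_continuous: "f \<in> schwartz \<Longrightarrow> continuous_on A f"
  by (meson continuous_at_imp_continuous_on differentiable_imp_continuous_within schwartz_differentiable)

lemma schwartz_measurable [measurable_dest]: "f \<in> schwartz \<Longrightarrow> f \<in> borel_measurable borel"
  by (intro borel_measurable_continuous_onI schwartz_continuous)

lemma pd_add:
  assumes "f \<in> schwartz" "g \<in> schwartz"
  shows "pd b (\<lambda>x. f x + g x) = (\<lambda>x. pd b f x + pd b g x)"
  using pd_eqI[OF has_derivative_add[OF assms[THEN schwartz_differentiable, unfolded frechet_derivative_works]]]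
  by (simp add: pd_def)

lemma iter_pd_add:
  assumes "f \<in> schwartz" "g \<in> schwartz" "set bs \<subseteq> Basis"
  shows "iter_pd bs (\<lambda>x. f x + g x) = (\<lambda>x. iter_pd bs f x + iter_pd bs g x)"
  using assms(3)
proof (induction bs)
  case (Cons b bs)
  then have "iter_pd bs f \<in> schwartz" "iter_pd bs g \<in> schwartz"
    using assms schwartz_iter_pd by auto
  then show ?case
    using Cons pd_add by (auto simp: iter_pd_Cons simp del: iter_pd.simps(2))
qed simp

lemma iter_pd_cmult:
  assumes "f \<in> schwartz" "set bs \<subseteq> Basis"
  shows "iter_pd bs (\<lambda>x. c * f x) = (\<lambda>x. c * iter_pd bs f x)"
  using assms(2)
proof (induction bs)
  case (Cons b bs)
  then have *: "iter_pd bs f \<in> schwartz"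
    using assms schwartz_iter_pd by auto
  have "((\<lambda>x. c * iter_pd bs f x) has_derivative (\<lambda>h. c * frechet_derivative (iter_pd bs f) (at x) h)) (at x)" for x
    using schwartz_differentiable[OF *, of x, unfolded frechet_derivative_works]
    by (rule has_derivative_mult_right)
  from pd_eqI[OF this] show ?case
    using Cons by (simp add: pd_def)
qed simp

lemma schwartz_add:
  assumes "f \<in> schwartz" "g \<in> schwartz"
  shows "(\<lambda>x. f x + g x) \<in> schwartz"
proof -
  let ?F = "{\<lambda>x. f x + g x | f g. f \<in> schwartz \<and> g \<in> (schwartz :: ('a \<Rightarrow> complex) set)}"
  have "(\<lambda>x. f x + g x) \<in> ?F" using assms by blast
  then show ?thesis
  proof (induction rule: schwartz_coinduct)
    case (differentiable f x)
    then show ?case using differentiable_add schwartz_differentiable by blast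
  next
    case (pd f b)
    then obtain g h where f: "f = (\<lambda>x. g x + h x)" "g \<in> schwartz" "h \<in> schwartz" by blast
    then have "pd b f = (\<lambda>x. pd b g x + pd b h x)"
      by (simp add: pd_add)
    then show ?case using f pd schwartz_pd by blast
  next
    case (decay f k)
    then obtain g h where f: "f = (\<lambda>x. g x + h x)" "g \<in> schwartz" "h \<in> schwartz" by blast
    obtain C where C: "\<And>x. (1 + norm x) ^ k * norm (g x) \<le> C" using schwartz_decay[OF f(2)] by metis
    obtain D where D: "\<And>x. (1 + norm x) ^ k * norm (h x) \<le> D" using schwartz_decay[OF f(3)] by metis
    have "(1 + norm x) ^ k * norm (f x) \<le> C + D" for x
    proof -
      have "(1 + norm x) ^ k * norm (f x) \<le> (1 + norm x) ^ k * (norm (g x) + norm (h x))"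
        unfolding f by (intro mult_left_mono norm_triangle_ineq) auto
      then show ?thesis using C[of x] D[of x] by (simp add: algebra_simps)
    qed
    then show ?case by blast
  qed
qed

lemma schwartz_cmult:
  assumes "f \<in> schwartz"
  shows "(\<lambda>x. c * f x) \<in> schwartz"
proof -
  let ?F = "{\<lambda>x. c * f x | f. f \<in> (schwartz :: ('a \<Rightarrow> complex) set)}"
  have "(\<lambda>x. c * f x) \<in> ?F" using assms by blast
  then show ?thesis
  proof (induction rule: schwartz_coinduct)
    case (differentiable f x)
    then show ?case
      using differentiable_mult[OF differentiable_const schwartz_differentiable] by blast
  next
    case (pd f b)
    then obtain g where f: "f = (\<lambda>x. c * g x)" "g \<in> schwartz" by blast
    then have "pd b f = (\<lambda>x. c * pd b g x)"
      using iter_pd_cmult[of g "[b]"] pd by (auto simp: pd_def)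
    then show ?case using f pd schwartz_pd by blast
  next
    case (decay f k)
    then obtain g where f: "f = (\<lambda>x. c * g x)" "g \<in> schwartz" by blast
    obtain C where C: "\<And>x. (1 + norm x) ^ k * norm (g x) \<le> C" using schwartz_decay[OF f(2)] by metis
    have "(1 + norm x) ^ k * norm (f x) \<le> norm c * C" for x
      using mult_left_mono[OF C[of x], of "norm c"] by (simp add: f norm_mult algebra_simps)
    then show ?case by blast
  qed
qed

lemma schwartz_zero: "(\<lambda>x. 0) \<in> schwartz"
proof -
  have "(\<lambda>x::'a. 0::complex) \<in> {\<lambda>x. 0}" by simp
  then show ?thesis
  proof (induction rule: schwartz_coinduct)
    case (pd f b)
    then show ?case using pd_eqI[of "\<lambda>x. 0" "\<lambda>x h. 0" b] by simp
  qed auto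
qed

lemma schwartz_diff:
  assumes "f \<in> schwartz" "g \<in> schwartz"
  shows "(\<lambda>x. f x - g x) \<in> schwartz"
  using schwartz_add[OF assms(1) schwartz_cmult[OF assms(2), of "-1"]] by simp

lemma iter_pd_diff:
  assumes "f \<in> schwartz" "g \<in> schwartz" "set bs \<subseteq> Basis"
  shows "iter_pd bs (\<lambda>x. f x - g x) = (\<lambda>x. iter_pd bs f x - iter_pd bs g x)"
  using iter_pd_add[OF assms(1) schwartz_cmult[OF assms(2), of "-1"] assms(3)]
    iter_pd_cmult[OF assms(2,3), of "-1"] by simp

lemma schwartz_sum:
  assumes "\<And>i. i \<in> I \<Longrightarrow> f i \<in> schwartz"
  shows "(\<lambda>x. \<Sum>i\<in>I. f i x) \<in> schwartz"
  using assms by (induction I rule: infinite_finite_induct) (auto intro!: schwartz_add schwartz_zero)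

lemma iter_pd_sum:
  assumes "finite I" "\<And>i. i \<in> I \<Longrightarrow> f i \<in> schwartz" "set bs \<subseteq> Basis"
  shows "iter_pd bs (\<lambda>x. \<Sum>i\<in>I. f i x) = (\<lambda>x. \<Sum>i\<in>I. iter_pd bs (f i) x)"
  using assms
proof (induction I rule: finite_induct)
  case empty
  show ?case using iter_pd_cmult[OF schwartz_zero empty(2), of 0] by simp
next
  case (insert i I)
  then show ?case
    using iter_pd_add[of "f i" "\<lambda>x. \<Sum>i\<in>I. f i x" bs] by (simp add: schwartz_sum)
qed

lemma schwartz_coord_mult:
  assumes "f \<in> schwartz"
  shows "(\<lambda>x. of_real (x \<bullet> c) * f x) \<in> schwartz"
proof -
  \<comment> \<open>The summand \<open>g\<close> closes the family: differentiating the coordinate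
    factor leaves a multiple of \<open>f\<close> without that factor.\<close>
  let ?F = "{\<lambda>x. of_real (x \<bullet> c) * f x + g x | f g. f \<in> (schwartz :: ('a \<Rightarrow> complex) set) \<and> g \<in> schwartz}"
  have "(\<lambda>x. of_real (x \<bullet> c) * f x + 0) \<in> ?F"
    using assms schwartz_zero by (intro CollectI exI[of _ f] exI[of _ "\<lambda>x. 0"]) simp
  then have "(\<lambda>x. of_real (x \<bullet> c) * f x + 0) \<in> schwartz"
  proof (induction rule: schwartz_coinduct)
    case (differentiable f x)
    then obtain g h where f: "f = (\<lambda>x. of_real (x \<bullet> c) * g x + h x)" "g \<in> schwartz" "h \<in> schwartz" by blast
    have "(\<lambda>x. complex_of_real (x \<bullet> c)) differentiable (at x)"
      unfolding differentiable_def
      by (rule exI, rule has_derivative_of_real, rule has_derivative_inner_left, rule has_derivative_ident)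
    then show ?case
      unfolding f(1) using f by (intro differentiable_add differentiable_mult) (auto intro: schwartz_differentiable)
  next
    case (pd f b)
    then obtain g h where f: "f = (\<lambda>x. of_real (x \<bullet> c) * g x + h x)" "g \<in> schwartz" "h \<in> schwartz" by blast
    have g: "(g has_derivative frechet_derivative g (at x)) (at x)" for x
      using schwartz_differentiable[OF f(2)] frechet_derivative_works by blast
    have h: "(h has_derivative frechet_derivative h (at x)) (at x)" for x
      using schwartz_differentiable[OF f(3)] frechet_derivative_works by blast
    have "(f has_derivative (\<lambda>v. of_real (x \<bullet> c) * frechet_derivative g (at x) v + of_real (v \<bullet> c) * g x
        + frechet_derivative h (at x) v)) (at x)" for x
      unfolding f by (auto intro!: derivative_eq_intros g h)
    from pd_eqI[OF this, of b]
    have "pd b f = (\<lambda>x. of_real (x \<bullet> c) * pd b g x + (of_real (b \<bullet> c) * g x + pd b h x))"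
      by (simp add: pd_def algebra_simps)
    moreover have "(\<lambda>x. of_real (b \<bullet> c) * g x + pd b h x) \<in> schwartz"
      using f pd by (intro schwartz_add schwartz_cmult schwartz_pd) auto
    ultimately show ?case
      using schwartz_pd[OF f(2) pd(2)] by (intro CollectI exI conjI)
  next
    case (decay f k)
    then obtain g h where f: "f = (\<lambda>x. of_real (x \<bullet> c) * g x + h x)" "g \<in> schwartz" "h \<in> schwartz" by blast
    \<comment> \<open>One power more than \<open>k\<close> pays for the growth of the
      coordinate.\<close>
    obtain C where C: "\<And>x. (1 + norm x) ^ Suc k * norm (g x) \<le> C" using schwartz_decay[OF f(2)] by metis
    obtain D where D: "\<And>x. (1 + norm x) ^ k * norm (h x) \<le> D" using schwartz_decay[OF f(3)] by metis
    have "(1 + norm x) ^ k * norm (f x) \<le> norm c * C + D" for x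
    proof -
      have "norm (of_real (x \<bullet> c) * g x) \<le> (norm c * (1 + norm x)) * norm (g x)"
        unfolding norm_mult using Cauchy_Schwarz_ineq2[of x c]
        by (intro mult_right_mono) (auto simp: algebra_simps intro: order_trans add_increasing)
      then have "norm (f x) \<le> norm c * (1 + norm x) * norm (g x) + norm (h x)"
        unfolding f using norm_triangle_ineq order_trans by (metis add_right_mono)
      then have "(1 + norm x) ^ k * norm (f x) \<le> (1 + norm x) ^ k * (norm c * (1 + norm x) * norm (g x) + norm (h x))"
        by (intro mult_left_mono) auto
      also have "\<dots> = norm c * ((1 + norm x) ^ Suc k * norm (g x)) + (1 + norm x) ^ k * norm (h x)"
        by (simp add: algebra_simps)
      also have "\<dots> \<le> norm c * C + D"
        by (intro add_mono mult_left_mono C D) auto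
      finally show ?thesis .
    qed
    then show ?case by blast
  qed
  then show ?thesis by simp
qed

lemma schwartz_affine:
  fixes y :: "'a::euclidean_space"
  assumes "f \<in> schwartz" "s \<noteq> 0"
  shows "(\<lambda>x. f (y + s *\<^sub>R x)) \<in> schwartz"
proof -
  let ?F = "{\<lambda>x. f (y + s *\<^sub>R x) | f. f \<in> (schwartz :: ('a \<Rightarrow> complex) set)}"
  have "(\<lambda>x. f (y + s *\<^sub>R x)) \<in> ?F" using assms by blast
  then show ?thesis
  proof (induction rule: schwartz_coinduct)
    case (differentiable f x)
    then obtain g where f: "f = (\<lambda>x. g (y + s *\<^sub>R x))" "g \<in> schwartz" by blast
    show ?case unfolding f
      by (rule differentiable_compose) (auto intro!: schwartz_differentiable f(2) derivative_intros)
  next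
    case (pd f b)
    then obtain g where f: "f = (\<lambda>x. g (y + s *\<^sub>R x))" "g \<in> schwartz" by blast
    have "(f has_derivative (\<lambda>h. \<Sum>b\<in>Basis. ((s *\<^sub>R h) \<bullet> b) *\<^sub>R pd b g (y + s *\<^sub>R x))) (at x)" for x
      unfolding f
      by (rule has_derivative_compose[OF _ schwartz_has_derivative[OF f(2)]]) (auto intro!: derivative_eq_intros)
    from pd_eqI[OF this, of b] pd(2)
    have "pd b f = (\<lambda>x. of_real s * pd b g (y + s *\<^sub>R x))"
      by (simp add: inner_Basis if_distrib if_distribR sum.delta scaleR_conv_of_real cong: if_cong)
    moreover have "(\<lambda>x. of_real s * pd b g x) \<in> schwartz"
      using f pd by (intro schwartz_cmult schwartz_pd)
    ultimately show ?case by (intro CollectI exI[of _ "\<lambda>x. of_real s * pd b g x"]) simp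
  next
    case (decay f k)
    then obtain g where f: "f = (\<lambda>x. g (y + s *\<^sub>R x))" "g \<in> schwartz" by blast
    obtain C where C: "\<And>x. (1 + norm x) ^ k * norm (g x) \<le> C" using schwartz_decay[OF f(2)] by metis
    \<comment> \<open>Solving z = y + s x for x gives 1 + |x| <= 1 + (|z| + |y|) / |s|; the factor
      \<open>?K\<close> turns this into a multiple of 1 + |z|.\<close>
    let ?K = "(1 + 1 / \<bar>s\<bar>) * (1 + norm y)"
    have "(1 + norm x) ^ k * norm (f x) \<le> ?K ^ k * C" for x
    proof -
      let ?z = "y + s *\<^sub>R x"
      have "norm x = norm (?z - y) / \<bar>s\<bar>" using assms(2) by simp
      also have "\<dots> \<le> (norm ?z + norm y) / \<bar>s\<bar>"
        by (intro divide_right_mono norm_triangle_ineq4) auto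
      finally have "1 + norm x \<le> 1 + (norm ?z + norm y) / \<bar>s\<bar>" by simp
      also have "\<dots> \<le> ?K * (1 + norm ?z)"
        using assms(2) by (simp add: field_simps)
      finally have "(1 + norm x) ^ k \<le> (?K * (1 + norm ?z)) ^ k"
        by (intro power_mono) auto
      then have "(1 + norm x) ^ k * norm (f x) \<le> (?K * (1 + norm ?z)) ^ k * norm (f x)"
        by (intro mult_right_mono) auto
      also have "\<dots> = ?K ^ k * ((1 + norm ?z) ^ k * norm (g ?z))"
        by (simp only: f power_mult_distrib mult.assoc)
      also have "\<dots> \<le> ?K ^ k * C"
        by (intro mult_left_mono C) auto
      finally show ?thesis .
    qed
    then show ?case by blast
  qed
qed

lemma iter_pd_translate:
  fixes y :: "'a::euclidean_space"
  assumes "f \<in> schwartz" "set bs \<subseteq> Basis"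
  shows "iter_pd bs (\<lambda>x. f (x - y)) = (\<lambda>x. iter_pd bs f (x - y))"
  using assms(2)
proof (induction bs)
  case (Cons b bs)
  then have *: "iter_pd bs f \<in> schwartz"
    using assms schwartz_iter_pd by auto
  have "((\<lambda>x. iter_pd bs f (x - y)) has_derivative (\<lambda>h. frechet_derivative (iter_pd bs f) (at (x - y)) h)) (at x)" for x
    by (rule has_derivative_compose[OF _ schwartz_differentiable[OF *, unfolded frechet_derivative_works]])
      (auto intro!: derivative_eq_intros)
  from pd_eqI[OF this] show ?case
    using Cons by (simp add: pd_def)
qed simp

lemma schwartz_translate:
  assumes "f \<in> schwartz"
  shows "(\<lambda>x. f (x - y)) \<in> schwartz"
  using schwartz_affine[OF assms, of 1 "-y"] by (simp add: algebra_simps)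

lemma schwartz_cis_mult:
  assumes "f \<in> schwartz"
  shows "(\<lambda>x. cis (\<xi> \<bullet> x) * f x) \<in> schwartz"
proof -
  let ?F = "{\<lambda>x. cis (\<xi> \<bullet> x) * f x | f. f \<in> (schwartz :: ('a \<Rightarrow> complex) set)}"
  have D: "((\<lambda>x. cis (\<xi> \<bullet> x) * g x) has_derivative (\<lambda>h. cis (\<xi> \<bullet> x) * (\<i> * of_real (\<xi> \<bullet> h) * g x + frechet_derivative g (at x) h))) (at x)"
    if "g \<in> schwartz" for g and x :: 'a
  proof -
    have c: "((\<lambda>x. cis (\<xi> \<bullet> x)) has_derivative (\<lambda>h. cis (\<xi> \<bullet> x) * (\<i> * of_real (\<xi> \<bullet> h)))) (at x)"
      unfolding cis_conv_exp
      by (rule has_derivative_compose[OF _ DERIV_exp[unfolded has_field_derivative_def]])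
        (auto intro!: derivative_eq_intros)
    have g: "(g has_derivative frechet_derivative g (at x)) (at x)"
      using schwartz_differentiable[OF that] frechet_derivative_works by blast
    show ?thesis
      using has_derivative_mult[OF c g] by (rule has_derivative_eq_rhs) (simp add: fun_eq_iff algebra_simps)
  qed
  have "(\<lambda>x. cis (\<xi> \<bullet> x) * f x) \<in> ?F" using assms by blast
  then show ?thesis
  proof (induction rule: schwartz_coinduct)
    case (differentiable f x)
    then show ?case using D unfolding differentiable_def by blast
  next
    case (pd f b)
    then obtain g where f: "f = (\<lambda>x. cis (\<xi> \<bullet> x) * g x)" "g \<in> schwartz" by blast
    have "pd b f = (\<lambda>x. cis (\<xi> \<bullet> x) * (\<i> * of_real (\<xi> \<bullet> b) * g x + pd b g x))"
      using pd_eqI[OF D[OF f(2)], of b] by (simp add: f pd_def)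
    moreover have "(\<lambda>x. \<i> * of_real (\<xi> \<bullet> b) * g x + pd b g x) \<in> schwartz"
      using f pd by (intro schwartz_cmult schwartz_pd schwartz_add)
    ultimately show ?case by (intro CollectI exI conjI)
  next
    case (decay f k)
    then obtain g where f: "f = (\<lambda>x. cis (\<xi> \<bullet> x) * g x)" "g \<in> schwartz" by blast
    show ?case using schwartz_decay[OF f(2), of k] unfolding f norm_mult norm_cis by (metis mult_1)
  qed
qed

text \<open>The polynomial functions, as the factors that differentiation puts in front of a
  Gaussian. Closure properties and polynomial growth are all that is asked of them, hence the
  inductive form without degrees or coefficients.\<close>

inductive_set coord_poly :: "('a::euclidean_space \<Rightarrow> complex) set" where
  const: "(\<lambda>x. c) \<in> coord_poly"
| coord: "(\<lambda>x. of_real (x \<bullet> b)) \<in> coord_poly"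
| add: "p \<in> coord_poly \<Longrightarrow> q \<in> coord_poly \<Longrightarrow> (\<lambda>x. p x + q x) \<in> coord_poly"
| mult: "p \<in> coord_poly \<Longrightarrow> q \<in> coord_poly \<Longrightarrow> (\<lambda>x. p x * q x) \<in> coord_poly"

lemma coord_poly_growth:
  assumes "p \<in> coord_poly"
  shows "\<exists>C k. 0 \<le> C \<and> (\<forall>x. norm (p x) \<le> C * (1 + norm x) ^ k)"
  using assms
proof induction
  case (const c)
  show ?case by (rule exI[of _ "norm c"], rule exI[of _ 0]) auto
next
  case (coord b)
  have "norm (of_real (x \<bullet> b) :: complex) \<le> norm b * (1 + norm x) ^ 1" for x
    using Cauchy_Schwarz_ineq2[of x b] by (auto simp: algebra_simps intro: order_trans add_increasing)
  then show ?case by (metis norm_ge_zero)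
next
  case (add p q)
  then obtain C k D l where C: "0 \<le> C" "\<And>x. norm (p x) \<le> C * (1 + norm x) ^ k"
    and D: "0 \<le> D" "\<And>x. norm (q x) \<le> D * (1 + norm x) ^ l" by blast
  have "norm (p x + q x) \<le> (C + D) * (1 + norm x) ^ (k + l)" for x
  proof -
    have "norm (p x + q x) \<le> C * (1 + norm x) ^ k + D * (1 + norm x) ^ l"
      using norm_triangle_le C(2) D(2) add_mono by metis
    also have "\<dots> \<le> C * (1 + norm x) ^ (k + l) + D * (1 + norm x) ^ (k + l)"
      by (intro add_mono mult_left_mono power_increasing C D) auto
    finally show ?thesis by (simp add: algebra_simps)
  qed
  then show ?case using C(1) D(1) by (metis add_nonneg_nonneg)
next
  case (mult p q)
  then obtain C k D l where C: "0 \<le> C" "\<And>x. norm (p x) \<le> C * (1 + norm x) ^ k"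
    and D: "0 \<le> D" "\<And>x. norm (q x) \<le> D * (1 + norm x) ^ l" by blast
  have "norm (p x * q x) \<le> (C * D) * (1 + norm x) ^ (k + l)" for x
  proof -
    have "norm (p x * q x) \<le> (C * (1 + norm x) ^ k) * (D * (1 + norm x) ^ l)"
      unfolding norm_mult using C D by (intro mult_mono) auto
    then show ?thesis by (simp add: algebra_simps power_add)
  qed
  then show ?case using C(1) D(1) by (metis mult_nonneg_nonneg)
qed

lemma coord_poly_has_derivative:
  assumes "p \<in> coord_poly"
  shows "\<exists>D. (\<forall>x. (p has_derivative D x) (at x)) \<and> (\<forall>b. (\<lambda>x. D x b) \<in> coord_poly)"
  using assms
proof induction
  case (const c)
  show ?case by (rule exI[of _ "\<lambda>x h. 0"]) (auto intro: coord_poly.const)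
next
  case (coord b)
  show ?case
    by (rule exI[of _ "\<lambda>x h. of_real (h \<bullet> b)"]) (auto intro!: coord_poly.const derivative_eq_intros)
next
  case (add p q)
  then obtain D E where D: "\<And>x. (p has_derivative D x) (at x)" "\<And>b. (\<lambda>x. D x b) \<in> coord_poly"
    and E: "\<And>x. (q has_derivative E x) (at x)" "\<And>b. (\<lambda>x. E x b) \<in> coord_poly"
    by metis
  show ?case
    by (rule exI[of _ "\<lambda>x h. D x h + E x h"]) (auto intro!: has_derivative_add D E coord_poly.add)
next
  case (mult p q)
  then obtain D E where D: "\<And>x. (p has_derivative D x) (at x)" "\<And>b. (\<lambda>x. D x b) \<in> coord_poly"
    and E: "\<And>x. (q has_derivative E x) (at x)" "\<And>b. (\<lambda>x. E x b) \<in> coord_poly"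
    by metis
  show ?case
    by (rule exI[of _ "\<lambda>x h. p x * E x h + D x h * q x"])
       (auto intro!: has_derivative_mult D E coord_poly.add coord_poly.mult mult.hyps)
qed

text \<open>One term of the exponential series gives (1 + t)^k <= k! exp (1 + t), and completing the
  square gives t - c t^2 <= 1 / c.\<close>

lemma one_plus_power_mult_gauss_bounded:
  fixes c :: real
  assumes "c > 0"
  shows "\<exists>C. \<forall>t\<ge>0. (1 + t) ^ k * exp (- c * t\<^sup>2) \<le> C"
proof -
  have "(1 + t) ^ k * exp (- c * t\<^sup>2) \<le> fact k * exp (1 + 1 / c)" if "t \<ge> 0" for t
  proof -
    have "(1 + t) ^ k / fact k \<le> exp (1 + t)"
    proof -
      have "(1 + t) ^ k / fact k = (1 + t) ^ k /\<^sub>R fact k" by (simp add: divide_inverse)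
      also have "\<dots> \<le> (\<Sum>n. (1 + t) ^ n /\<^sub>R fact n)"
        using sum_le_suminf[of "\<lambda>n. (1 + t) ^ n /\<^sub>R fact n" "{k}"] summable_exp_generic[of "1 + t"] that by simp
      finally show ?thesis by (simp add: exp_def)
    qed
    then have "(1 + t) ^ k * exp (- c * t\<^sup>2) \<le> fact k * exp (1 + t) * exp (- c * t\<^sup>2)"
      by (intro mult_right_mono) (auto simp: field_simps)
    also have "\<dots> = fact k * exp (1 + t - c * t\<^sup>2)"
      by (simp add: exp_add[symmetric])
    also have "\<dots> \<le> fact k * exp (1 + 1 / c)"
    proof -
      have "t - c * t\<^sup>2 \<le> 1 / c"
      proof -
        have "0 \<le> (c * t - 1/2)\<^sup>2 + 3/4" by simp
        also have "\<dots> = c * (1 / c - t + c * t\<^sup>2)"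
          using assms by (simp add: power2_eq_square algebra_simps)
        finally show ?thesis using assms by (simp add: zero_le_mult_iff)
      qed
      then show ?thesis by (intro mult_left_mono) auto
    qed
    finally show ?thesis .
  qed
  then show ?thesis by blast
qed

text \<open>The polynomial multiples of the Gaussian form a family closed under differentiation, and
  the Gaussian absorbs their growth.\<close>

lemma schwartz_gauss:
  assumes "c > 0"
  shows "(\<lambda>x::'a::euclidean_space. of_real (exp (- c * (norm x)\<^sup>2))) \<in> schwartz"
proof -
  let ?F = "{\<lambda>x. p x * of_real (exp (- c * (norm x)\<^sup>2)) | p. p \<in> (coord_poly :: ('a \<Rightarrow> complex) set)}"
  have D: "((\<lambda>x. p x * complex_of_real (exp (- c * (norm x)\<^sup>2))) has_derivative
      (\<lambda>h. (D h + of_real (- 2 * c) * p x * of_real (x \<bullet> h)) * of_real (exp (- c * (norm x)\<^sup>2)))) (at x)"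
    if "(p has_derivative D) (at x)" for p D and x :: 'a
  proof -
    have "((\<lambda>x. of_real (exp (- c * (x \<bullet> x))) :: complex) has_derivative
        (\<lambda>h. of_real (exp (- c * (x \<bullet> x)) * (- c * (x \<bullet> h + h \<bullet> x))))) (at x)"
      by (auto intro!: derivative_eq_intros)
    from has_derivative_mult[OF that this] show ?thesis
      unfolding power2_norm_eq_inner
      by (rule has_derivative_eq_rhs) (simp add: fun_eq_iff algebra_simps inner_commute)
  qed
  have "(\<lambda>x. 1 * of_real (exp (- c * (norm x)\<^sup>2))) \<in> ?F"
    using coord_poly.const[of 1] by (intro CollectI exI[of _ "\<lambda>x. 1"]) simp
  then have "(\<lambda>x::'a. 1 * of_real (exp (- c * (norm x)\<^sup>2))) \<in> schwartz"
  proof (induction rule: schwartz_coinduct)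
    case (differentiable f x)
    then show ?case using D coord_poly_has_derivative unfolding differentiable_def by blast
  next
    case (pd f b)
    then obtain p where f: "f = (\<lambda>x. p x * of_real (exp (- c * (norm x)\<^sup>2)))" "p \<in> coord_poly" by blast
    from coord_poly_has_derivative[OF f(2)] obtain E where E: "\<And>x. (p has_derivative E x) (at x)" "\<And>b. (\<lambda>x. E x b) \<in> coord_poly"
      by blast
    have "pd b f = (\<lambda>x. (E x b + of_real (- 2 * c) * p x * of_real (x \<bullet> b)) * of_real (exp (- c * (norm x)\<^sup>2)))"
      using pd_eqI[OF D[OF E(1)], of b] by (simp add: f)
    moreover have "(\<lambda>x. E x b + of_real (- 2 * c) * p x * of_real (x \<bullet> b)) \<in> coord_poly"
      using f(2) E(2) by (intro coord_poly.intros)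
    ultimately show ?case by (intro CollectI exI conjI)
  next
    case (decay f k)
    then obtain p where f: "f = (\<lambda>x. p x * of_real (exp (- c * (norm x)\<^sup>2)))" "p \<in> coord_poly" by blast
    obtain C l where C: "0 \<le> C" "\<And>x. norm (p x) \<le> C * (1 + norm x) ^ l"
      using coord_poly_growth[OF f(2)] by blast
    obtain D where D: "\<And>t. t \<ge> 0 \<Longrightarrow> (1 + t) ^ (k + l) * exp (- c * t\<^sup>2) \<le> D"
      using one_plus_power_mult_gauss_bounded[OF assms] by blast
    have "(1 + norm x) ^ k * norm (f x) \<le> C * D" for x
    proof -
      have "(1 + norm x) ^ k * norm (f x) \<le> (1 + norm x) ^ k * ((C * (1 + norm x) ^ l) * exp (- c * (norm x)\<^sup>2))"
        unfolding f norm_mult by (intro mult_mono C) (use C(1) in auto)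
      also have "\<dots> = C * ((1 + norm x) ^ (k + l) * exp (- c * (norm x)\<^sup>2))"
        by (simp add: power_add algebra_simps)
      also have "\<dots> \<le> C * D" by (intro mult_left_mono D C) auto
      finally show ?thesis .
    qed
    then show ?case by blast
  qed
  then show ?thesis by simp
qed

lemma schwartz_tensor:
  fixes f g :: "real^'d::finite \<Rightarrow> complex"
  assumes "f \<in> schwartz" "g \<in> schwartz"
  shows "tensor f g \<in> schwartz"
proof -
  let ?F = "{tensor f g | f g. f \<in> (schwartz :: (real^'d \<Rightarrow> complex) set) \<and> g \<in> schwartz}"
  have lin: "bounded_linear (upper :: real^('d + 'd) \<Rightarrow> real^'d)" "bounded_linear (lower :: real^('d + 'd) \<Rightarrow> real^'d)"
    unfolding linear_conv_bounded_linear[symmetric]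
    by (auto intro!: linearI simp: upper_def lower_def vec_eq_iff)
  have D: "(tensor f g has_derivative (\<lambda>h. f (upper z) * frechet_derivative g (at (lower z)) (lower h)
      + frechet_derivative f (at (upper z)) (upper h) * g (lower z))) (at z)"
    if "f \<in> schwartz" "g \<in> schwartz" for f g :: "real^'d \<Rightarrow> complex" and z
    unfolding tensor_def
    by (intro has_derivative_mult has_derivative_compose[OF bounded_linear.has_derivative[OF lin(1) has_derivative_ident]]
       has_derivative_compose[OF bounded_linear.has_derivative[OF lin(2) has_derivative_ident]]
       schwartz_differentiable[unfolded frechet_derivative_works] that)
  have "tensor f g \<in> ?F" using assms by blast
  then show ?thesis
  proof (induction rule: schwartz_coinduct)
    case (differentiable f x)
    then show ?case using D unfolding differentiable_def by blast
  next
    case (pd F b)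
    then obtain f g where f: "F = tensor f g" "f \<in> schwartz" "g \<in> schwartz" by blast
    interpret df: linear "frechet_derivative f (at x)" for x
      by (rule linear_frechet_derivative[OF schwartz_differentiable[OF f(2)]])
    interpret dg: linear "frechet_derivative g (at x)" for x
      by (rule linear_frechet_derivative[OF schwartz_differentiable[OF f(3)]])
    \<comment> \<open>A basis vector lies entirely in one of the two halves, so one term of the
      product rule vanishes and the derivative is again a single tensor.\<close>
    from pd(2) obtain i where b: "b = axis i 1" by (auto simp: Basis_vec_def)
    have eq: "pd b F = (\<lambda>z. f (upper z) * frechet_derivative g (at (lower z)) (lower b)
      + frechet_derivative f (at (upper z)) (upper b) * g (lower z))"
      unfolding f(1) by (rule pd_eqI[OF D[OF f(2,3)]])
    show ?case
    proof (cases i)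
      case (Inl j)
      then have "upper b = axis j 1" "lower b = 0"
        by (auto simp: b upper_def lower_def axis_def vec_eq_iff)
      then have "pd b F = tensor (pd (axis j 1) f) g" using eq by (simp add: tensor_def pd_def dg.zero)
      moreover have "pd (axis j 1) f \<in> schwartz" by (intro schwartz_pd f) auto
      ultimately show ?thesis using f by blast
    next
      case (Inr j)
      then have "lower b = axis j 1" "upper b = 0"
        by (auto simp: b upper_def lower_def axis_def vec_eq_iff)
      then have "pd b F = tensor f (pd (axis j 1) g)" using eq by (simp add: tensor_def pd_def df.zero)
      moreover have "pd (axis j 1) g \<in> schwartz" by (intro schwartz_pd f) auto
      ultimately show ?thesis using f by blast
    qed
  next
    case (decay F k)
    then obtain f g where f: "F = tensor f g" "f \<in> schwartz" "g \<in> schwartz" by blast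
    obtain C where C: "C > 0" "\<And>x. (1 + norm x) ^ k * norm (f x) \<le> C" using schwartz_decay[OF f(2)] by metis
    obtain E where E: "\<And>x. (1 + norm x) ^ k * norm (g x) \<le> E" using schwartz_decay[OF f(3)] by metis
    have "(1 + norm z) ^ k * norm (F z) \<le> C * E" for z
    proof -
      \<comment> \<open>The aim is 1 + |z| <= (1 + |upper z|) (1 + |lower z|), which lets the decay
        of the two factors be used separately.\<close>
      have "(norm z)\<^sup>2 = (norm (upper z))\<^sup>2 + (norm (lower z))\<^sup>2"
        by (simp add: power2_norm_eq_inner inner_vec_def upper_def lower_def UNIV_Plus_UNIV[symmetric] sum.Plus del: UNIV_Plus_UNIV)
      also have "\<dots> \<le> (norm (upper z) + norm (lower z))\<^sup>2"
        by (simp add: power2_eq_square algebra_simps)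
      finally have "norm z \<le> norm (upper z) + norm (lower z)"
        by (rule power2_le_imp_le) auto
      then have "1 + norm z \<le> (1 + norm (upper z)) * (1 + norm (lower z))"
        using mult_nonneg_nonneg[OF norm_ge_zero[of "upper z"] norm_ge_zero[of "lower z"]]
        unfolding distrib_left distrib_right mult_1_left mult_1_right by linarith
      then have "(1 + norm z) ^ k \<le> ((1 + norm (upper z)) * (1 + norm (lower z))) ^ k"
        by (intro power_mono) auto
      then have "(1 + norm z) ^ k * norm (F z) \<le> ((1 + norm (upper z)) * (1 + norm (lower z))) ^ k * norm (F z)"
        by (intro mult_right_mono) auto
      also have "\<dots> = ((1 + norm (upper z)) ^ k * norm (f (upper z))) * ((1 + norm (lower z)) ^ k * norm (g (lower z)))"
        by (simp add: f tensor_def norm_mult power_mult_distrib)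
      also have "\<dots> \<le> C * E"
        by (intro mult_mono C E) (use C(1) in auto)
      finally show ?thesis .
    qed
    then show ?case by blast
  qed
qed

section \<open>Seminorms and continuous operators on the Schwartz space\<close>

lemma finite_basis_lists: "finite {bs. set bs \<subseteq> (Basis :: 'a::euclidean_space set) \<and> length bs \<le> N}"
  by (intro finite_lists_length_le finite_Basis)

lemma schwartz_bdd_above:
  assumes "f \<in> schwartz" "set bs \<subseteq> Basis"
  shows "bdd_above (range (\<lambda>x. (1 + norm x) ^ k * norm (iter_pd bs f x)))"
  using assms unfolding schwartz_def by auto

lemma schwartz_norm_upper:
  fixes f :: "'a::euclidean_space \<Rightarrow> complex"
  assumes f: "f \<in> schwartz" and bs: "set bs \<subseteq> Basis" "length bs \<le> N" and k: "k \<le> N"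
  shows "(1 + norm x) ^ k * norm (iter_pd bs f x) \<le> schwartz_norm N f"
proof -
  let ?s = "\<lambda>bs. SUP x. (1 + norm x) ^ N * norm (iter_pd bs f x)"
  have bdd: "bdd_above (range (\<lambda>x. (1 + norm x) ^ N * norm (iter_pd cs f x)))" if "set cs \<subseteq> Basis" for cs
    by (rule schwartz_bdd_above[OF f that])
  have up: "(1 + norm x) ^ N * norm (iter_pd cs f x) \<le> ?s cs" if "set cs \<subseteq> Basis" for cs x
    by (rule cSUP_upper[OF UNIV_I bdd[OF that]])
  have "(1 + norm x) ^ k * norm (iter_pd bs f x) \<le> (1 + norm x) ^ N * norm (iter_pd bs f x)"
    by (intro mult_right_mono power_increasing k) auto
  also have "\<dots> \<le> ?s bs" by (rule up[OF bs(1)])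
  also have "\<dots> \<le> schwartz_norm N f"
    unfolding schwartz_norm_def
  proof (rule member_le_sum[OF _ _ finite_basis_lists])
    fix cs :: "'a list" assume "cs \<in> {bs. set bs \<subseteq> Basis \<and> length bs \<le> N} - {bs}"
    then show "0 \<le> ?s cs"
      by (intro order_trans[OF _ up[of cs 0]]) auto
  qed (use bs in auto)
  finally show ?thesis .
qed

lemma schwartz_norm_nonneg: "f \<in> schwartz \<Longrightarrow> 0 \<le> schwartz_norm N f"
  using schwartz_norm_upper[of f "[]" N 0 0] by (simp add: order_trans[OF norm_ge_zero])

lemma schwartz_norm_le:
  fixes f :: "'a::euclidean_space \<Rightarrow> complex"
  assumes "\<And>bs x. set bs \<subseteq> Basis \<Longrightarrow> length bs \<le> N \<Longrightarrow> (1 + norm x) ^ N * norm (iter_pd bs f x) \<le> C bs"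
  shows "schwartz_norm N f \<le> (\<Sum>bs | set bs \<subseteq> (Basis :: 'a set) \<and> length bs \<le> N. C bs)"
  unfolding schwartz_norm_def using assms by (intro sum_mono cSUP_least) auto

lemma schwartz_norm_mono:
  assumes "f \<in> schwartz" "M \<le> N"
  shows "schwartz_norm M f \<le> schwartz_norm N f"
proof -
  have "schwartz_norm M f \<le> (\<Sum>bs | set bs \<subseteq> (Basis :: 'a set) \<and> length bs \<le> M. SUP x. (1 + norm x) ^ N * norm (iter_pd bs f x))"
  proof (rule schwartz_norm_le)
    fix bs :: "'a list" and x assume "set bs \<subseteq> Basis"
    then have bdd: "bdd_above (range (\<lambda>x. (1 + norm x) ^ N * norm (iter_pd bs f x)))"
      by (rule schwartz_bdd_above[OF assms(1)])
    have "(1 + norm x) ^ M * norm (iter_pd bs f x) \<le> (1 + norm x) ^ N * norm (iter_pd bs f x)"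
      by (intro mult_right_mono power_increasing assms) auto
    also have "\<dots> \<le> (SUP x. (1 + norm x) ^ N * norm (iter_pd bs f x))"
      by (rule cSUP_upper[OF UNIV_I bdd])
    finally show "(1 + norm x) ^ M * norm (iter_pd bs f x) \<le> (SUP x. (1 + norm x) ^ N * norm (iter_pd bs f x))" .
  qed
  also have "\<dots> \<le> schwartz_norm N f"
    unfolding schwartz_norm_def
  proof (rule sum_mono2[OF finite_basis_lists])
    fix cs :: "'a list" assume "cs \<in> {bs. set bs \<subseteq> Basis \<and> length bs \<le> N} - {bs. set bs \<subseteq> Basis \<and> length bs \<le> M}"
    then have bdd: "bdd_above (range (\<lambda>x. (1 + norm x) ^ N * norm (iter_pd cs f x)))"
      by (intro schwartz_bdd_above[OF assms(1)]) auto
    then show "0 \<le> (SUP x. (1 + norm x) ^ N * norm (iter_pd cs f x))"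
      using cSUP_upper[OF UNIV_I bdd, of 0] by (rule_tac order_trans) auto
  qed (use assms in auto)
  finally show ?thesis .
qed

text \<open>For linear maps this is continuity in the Schwartz topology, in quantitative form. The
  order \<open>M\<close> may exceed \<open>N\<close>, which leaves room for operators that cost
  derivatives or weights.\<close>

definition schwartz_cont_op :: "(('a::euclidean_space \<Rightarrow> complex) \<Rightarrow> 'b::euclidean_space \<Rightarrow> complex) \<Rightarrow> bool" where
  "schwartz_cont_op T \<longleftrightarrow> (\<forall>f\<in>schwartz. T f \<in> schwartz) \<and>
     (\<forall>N. \<exists>M C. C \<ge> 0 \<and> (\<forall>f\<in>schwartz. schwartz_norm N (T f) \<le> C * schwartz_norm M f))"

text \<open>Only finitely many lists enter \<open>schwartz_norm N\<close>, so order and constant may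
  depend on the list: the largest order and the sum of the absolute constants serve for all of
  them.\<close>

lemma schwartz_cont_opI:
  fixes T :: "('a::euclidean_space \<Rightarrow> complex) \<Rightarrow> 'b::euclidean_space \<Rightarrow> complex"
  assumes "\<And>f. f \<in> schwartz \<Longrightarrow> T f \<in> schwartz"
    and bound: "\<And>bs N. set bs \<subseteq> Basis \<Longrightarrow>
      \<exists>M C. \<forall>f\<in>schwartz. \<forall>x. (1 + norm x) ^ N * norm (iter_pd bs (T f) x) \<le> C * schwartz_norm M f"
  shows "schwartz_cont_op T"
  unfolding schwartz_cont_op_def
proof (intro conjI ballI allI)
  fix N
  let ?L = "{bs. set bs \<subseteq> (Basis :: 'b set) \<and> length bs \<le> N}"
  have "\<forall>bs\<in>?L. \<exists>MC. \<forall>f\<in>schwartz. \<forall>x. (1 + norm x) ^ N * norm (iter_pd bs (T f) x) \<le> snd MC * schwartz_norm (fst MC) f"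
  proof
    fix bs assume "bs \<in> ?L"
    then obtain M C where "\<forall>f\<in>schwartz. \<forall>x. (1 + norm x) ^ N * norm (iter_pd bs (T f) x) \<le> C * schwartz_norm M f"
      using bound by blast
    then show "\<exists>MC. \<forall>f\<in>schwartz. \<forall>x. (1 + norm x) ^ N * norm (iter_pd bs (T f) x) \<le> snd MC * schwartz_norm (fst MC) f"
      by (intro exI[of _ "(M, C)"]) simp
  qed
  from bchoice[OF this] obtain h where h: "\<And>bs f x. bs \<in> ?L \<Longrightarrow> f \<in> schwartz \<Longrightarrow>
      (1 + norm x) ^ N * norm (iter_pd bs (T f) x) \<le> snd (h bs) * schwartz_norm (fst (h bs)) f"
    by blast
  define M C where "M = (\<lambda>bs. fst (h bs))" and "C = (\<lambda>bs. snd (h bs))"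
  have MC: "\<And>bs f x. bs \<in> ?L \<Longrightarrow> f \<in> schwartz \<Longrightarrow>
      (1 + norm x) ^ N * norm (iter_pd bs (T f) x) \<le> C bs * schwartz_norm (M bs) f"
    using h by (simp add: M_def C_def)
  define K where "K = Max (M ` ?L)"
  have "schwartz_norm N (T f) \<le> (\<Sum>bs\<in>?L. \<bar>C bs\<bar>) * schwartz_norm K f" if f: "f \<in> schwartz" for f
    unfolding sum_distrib_right
  proof (rule schwartz_norm_le)
    fix bs :: "'b list" and x assume "set bs \<subseteq> Basis" "length bs \<le> N"
    then have bs: "bs \<in> ?L" by simp
    have "(1 + norm x) ^ N * norm (iter_pd bs (T f) x) \<le> C bs * schwartz_norm (M bs) f"
      by (rule MC[OF bs f])
    also have "\<dots> \<le> \<bar>C bs\<bar> * schwartz_norm (M bs) f"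
      by (intro mult_right_mono schwartz_norm_nonneg f) auto
    also have "\<dots> \<le> \<bar>C bs\<bar> * schwartz_norm K f"
      using bs finite_basis_lists unfolding K_def
      by (intro mult_left_mono schwartz_norm_mono f Max_ge) auto
    finally show "(1 + norm x) ^ N * norm (iter_pd bs (T f) x) \<le> \<bar>C bs\<bar> * schwartz_norm K f" .
  qed
  then show "\<exists>M C. C \<ge> 0 \<and> (\<forall>f\<in>schwartz. schwartz_norm N (T f) \<le> C * schwartz_norm M f)"
    by (intro exI[of _ K] exI[of _ "\<Sum>bs\<in>?L. \<bar>C bs\<bar>"]) (auto intro: sum_nonneg)
qed (use assms in auto)

lemma schwartz_cont_op_in: "schwartz_cont_op T \<Longrightarrow> f \<in> schwartz \<Longrightarrow> T f \<in> schwartz"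
  by (simp add: schwartz_cont_op_def)

lemma schwartz_cont_op_bound:
  assumes "schwartz_cont_op T"
  obtains M C where "C \<ge> 0" "\<And>f. f \<in> schwartz \<Longrightarrow> schwartz_norm N (T f) \<le> C * schwartz_norm M f"
  using assms unfolding schwartz_cont_op_def by metis

lemma schwartz_cont_op_id: "schwartz_cont_op (\<lambda>f. f)"
  unfolding schwartz_cont_op_def by (metis mult_1 order_refl zero_le_one)

lemma schwartz_cont_op_comp:
  assumes "schwartz_cont_op S" "schwartz_cont_op T"
  shows "schwartz_cont_op (\<lambda>f. S (T f))"
  unfolding schwartz_cont_op_def
proof (intro conjI ballI allI)
  fix N
  obtain M C where M: "C \<ge> 0" "\<And>f. f \<in> schwartz \<Longrightarrow> schwartz_norm N (S f) \<le> C * schwartz_norm M f"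
    using schwartz_cont_op_bound[OF assms(1)] by metis
  obtain L D where L: "D \<ge> 0" "\<And>f. f \<in> schwartz \<Longrightarrow> schwartz_norm M (T f) \<le> D * schwartz_norm L f"
    using schwartz_cont_op_bound[OF assms(2)] by metis
  have "schwartz_norm N (S (T f)) \<le> (C * D) * schwartz_norm L f" if "f \<in> schwartz" for f
    using M(2)[OF schwartz_cont_op_in[OF assms(2) that]] mult_left_mono[OF L(2)[OF that] M(1)]
    by (simp add: mult.assoc)
  then show "\<exists>M C. C \<ge> 0 \<and> (\<forall>f\<in>schwartz. schwartz_norm N (S (T f)) \<le> C * schwartz_norm M f)"
    using M(1) L(1) by (metis mult_nonneg_nonneg)
qed (auto intro: assms[THEN schwartz_cont_op_in])

lemma schwartz_cont_op_pointwise: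
  fixes T :: "('a::euclidean_space \<Rightarrow> complex) \<Rightarrow> 'b::euclidean_space \<Rightarrow> complex"
  assumes "schwartz_cont_op T" "set bs \<subseteq> Basis"
  obtains M C where "C \<ge> 0" 
     "\<And>f x. f \<in> schwartz \<Longrightarrow> (1 + norm x) ^ N * norm (iter_pd bs (T f) x) \<le> C * schwartz_norm M f"
proof -
  obtain M C where M: "C \<ge> 0" "\<And>f. f \<in> schwartz \<Longrightarrow> schwartz_norm (max N (length bs)) (T f) \<le> C * schwartz_norm M f"
    using schwartz_cont_op_bound[OF assms(1)] by metis
  show ?thesis
  proof (rule that[OF M(1)])
    fix f :: "'a \<Rightarrow> complex" and x :: 'b assume f: "f \<in> schwartz"
    show "(1 + norm x) ^ N * norm (iter_pd bs (T f) x) \<le> C * schwartz_norm M f"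
      using schwartz_norm_upper[OF schwartz_cont_op_in[OF assms(1) f] assms(2), of "max N (length bs)" N x] M(2)[OF f]
      by simp
  qed
qed

lemma schwartz_cont_op_add:
  assumes "schwartz_cont_op S" "schwartz_cont_op T"
  shows "schwartz_cont_op (\<lambda>f x. S f x + T f x)"
proof (rule schwartz_cont_opI)
  fix bs :: "'b list" and N assume bs: "set bs \<subseteq> Basis"
  obtain M C where M: "C \<ge> 0" "\<And>f x. f \<in> schwartz \<Longrightarrow> (1 + norm x) ^ N * norm (iter_pd bs (S f) x) \<le> C * schwartz_norm M f"
    using schwartz_cont_op_pointwise[OF assms(1) bs] by metis
  obtain L D where L: "D \<ge> 0" "\<And>f x. f \<in> schwartz \<Longrightarrow> (1 + norm x) ^ N * norm (iter_pd bs (T f) x) \<le> D * schwartz_norm L f"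
    using schwartz_cont_op_pointwise[OF assms(2) bs] by metis
  have "(1 + norm x) ^ N * norm (iter_pd bs (\<lambda>x. S f x + T f x) x) \<le> (C + D) * schwartz_norm (max M L) f"
    if f: "f \<in> schwartz" for f x
  proof -
    have "(1 + norm x) ^ N * norm (iter_pd bs (\<lambda>x. S f x + T f x) x)
       \<le> (1 + norm x) ^ N * (norm (iter_pd bs (S f) x) + norm (iter_pd bs (T f) x))"
      using assms f schwartz_cont_op_in bs
      by (subst iter_pd_add) (auto intro!: mult_left_mono norm_triangle_ineq)
    also have "\<dots> \<le> C * schwartz_norm M f + D * schwartz_norm L f"
      using M(2)[OF f] L(2)[OF f] unfolding distrib_left by (rule add_mono)
    also have "\<dots> \<le> C * schwartz_norm (max M L) f + D * schwartz_norm (max M L) f"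
      by (intro add_mono mult_left_mono schwartz_norm_mono f M L) auto
    finally show ?thesis by (simp add: algebra_simps)
  qed
  then show "\<exists>M C. \<forall>f\<in>schwartz. \<forall>x. (1 + norm x) ^ N * norm (iter_pd bs (\<lambda>x. S f x + T f x) x) \<le> C * schwartz_norm M f"
    by blast
qed (use assms schwartz_cont_op_in schwartz_add in blast)

lemma schwartz_cont_op_cmult: "schwartz_cont_op (\<lambda>f x. c * f x)"
proof (rule schwartz_cont_opI)
  fix bs :: "'a list" and N assume bs: "set bs \<subseteq> Basis"
  have "(1 + norm x) ^ N * norm (iter_pd bs (\<lambda>x. c * f x) x) \<le> norm c * schwartz_norm (max N (length bs)) f"
    if f: "f \<in> schwartz" for f x
    using mult_left_mono[OF schwartz_norm_upper[OF f bs, of "max N (length bs)" N x], of "norm c"]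
    by (simp add: iter_pd_cmult[OF f bs] norm_mult mult.left_commute)
  then show "\<exists>M C. \<forall>f\<in>schwartz. \<forall>x. (1 + norm x) ^ N * norm (iter_pd bs (\<lambda>x. c * f x) x) \<le> C * schwartz_norm M f"
    by blast
qed (use schwartz_cmult in blast)

lemma schwartz_cont_op_sum:
  assumes "finite I" "\<And>i. i \<in> I \<Longrightarrow> schwartz_cont_op (T i)"
  shows "schwartz_cont_op (\<lambda>f x. \<Sum>i\<in>I. T i f x)"
  using assms
proof (induction I rule: finite_induct)
  case empty
  show ?case 
    using schwartz_cont_op_comp[OF schwartz_cont_op_cmult[of 0], of "\<lambda>f x. 0"] 
    by (auto simp: schwartz_cont_op_def schwartz_zero schwartz_norm_def iter_pd_sum[of "{}", simplified] intro!: exI[of _ 0])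
qed (auto intro!: schwartz_cont_op_add)

text \<open>A companion of \<open>one_plus_norm_power_le\<close>: there a weight becomes 1 plus a
  sum over coordinates, each summand is later produced by a power of an operator, and the resulting
  seminorms have to be merged into one.\<close>

lemma schwartz_norm_add_sum_le:
  assumes "finite I" "\<And>i. i \<in> I \<Longrightarrow> schwartz_cont_op (T i)"
  shows "\<exists>K C. C \<ge> 0 \<and> (\<forall>f\<in>schwartz. schwartz_norm N f + (\<Sum>i\<in>I. schwartz_norm N (T i f)) \<le> C * schwartz_norm K f)"
  using assms
proof (induction I rule: finite_induct)
  case empty
  show ?case by (rule exI[of _ N], rule exI[of _ 1]) simp
next
  case (insert i I)
  then obtain K C where K: "C \<ge> 0"
    "\<And>f. f \<in> schwartz \<Longrightarrow> schwartz_norm N f + (\<Sum>i\<in>I. schwartz_norm N (T i f)) \<le> C * schwartz_norm K f" by auto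
  obtain M D where M: "D \<ge> 0" "\<And>f. f \<in> schwartz \<Longrightarrow> schwartz_norm N (T i f) \<le> D * schwartz_norm M f"
    using schwartz_cont_op_bound[OF insert.prems[of i]] by (metis insertI1)
  have "schwartz_norm N f + (\<Sum>i\<in>insert i I. schwartz_norm N (T i f)) \<le> (C + D) * schwartz_norm (max K M) f"
    if f: "f \<in> schwartz" for f
  proof -
    have "schwartz_norm N f + (\<Sum>i\<in>insert i I. schwartz_norm N (T i f)) \<le> C * schwartz_norm K f + D * schwartz_norm M f"
      using insert.hyps K(2)[OF f] M(2)[OF f] by simp
    also have "\<dots> \<le> C * schwartz_norm (max K M) f + D * schwartz_norm (max K M) f"
      by (intro add_mono mult_left_mono schwartz_norm_mono f K M) auto
    finally show ?thesis by (simp add: distrib_right)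
  qed
  moreover have "0 \<le> C + D" using K(1) M(1) by simp
  ultimately show ?case by blast
qed

lemma schwartz_cont_op_pd:
  assumes "b \<in> Basis"
  shows "schwartz_cont_op (pd b)"
proof (rule schwartz_cont_opI)
  fix bs :: "'a list" and N assume bs: "set bs \<subseteq> Basis"
  have "(1 + norm x) ^ N * norm (iter_pd bs (pd b f) x) \<le> 1 * schwartz_norm (N + Suc (length bs)) f"
    if f: "f \<in> schwartz" for f x
    using schwartz_norm_upper[OF f, of "bs @ [b]" "N + Suc (length bs)" N x] bs assms
    by (simp add: iter_pd_snoc)
  then show "\<exists>M C. \<forall>f\<in>schwartz. \<forall>x. (1 + norm x) ^ N * norm (iter_pd bs (pd b f) x) \<le> C * schwartz_norm M f"
    by blast
qed (use schwartz_pd assms in blast)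

lemma pd_coord_mult:
  assumes "f \<in> schwartz"
  shows "pd b (\<lambda>x. of_real (x \<bullet> c) * f x) = (\<lambda>x. of_real (x \<bullet> c) * pd b f x + of_real (b \<bullet> c) * f x)"
proof -
  have f: "(f has_derivative frechet_derivative f (at x)) (at x)" for x
    using schwartz_differentiable[OF assms] frechet_derivative_works by blast
  have "((\<lambda>x. of_real (x \<bullet> c) * f x) has_derivative
      (\<lambda>v. of_real (x \<bullet> c) * frechet_derivative f (at x) v + of_real (v \<bullet> c) * f x)) (at x)" for x
    by (auto intro!: derivative_eq_intros f)
  from pd_eqI[OF this] show ?thesis by (simp add: pd_def)
qed

text \<open>The induction runs from the right because the last entry of the list is the derivative
  applied first. Moving it past the coordinate leaves the shorter list applied to the coordinate
  times \<open>pd b f\<close>, plus a multiple of a derivative of \<open>f\<close> itself.\<close>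

lemma schwartz_cont_op_coord_mult: "schwartz_cont_op (\<lambda>f x. of_real (x \<bullet> c) * f x)"
proof (rule schwartz_cont_opI)
  fix bs :: "'a list" and N assume "set bs \<subseteq> Basis"
  then show "\<exists>M C. \<forall>f\<in>schwartz. \<forall>x. (1 + norm x) ^ N * norm (iter_pd bs (\<lambda>x. of_real (x \<bullet> c) * f x) x) \<le> C * schwartz_norm M f"
  proof (induction bs rule: rev_induct)
    case Nil
    have "(1 + norm x) ^ N * norm (of_real (x \<bullet> c) * f x) \<le> norm c * schwartz_norm (Suc N) f"
      if f: "f \<in> schwartz" for f x
    proof -
      have "norm (of_real (x \<bullet> c) * f x) \<le> (norm c * (1 + norm x)) * norm (f x)"
        unfolding norm_mult using Cauchy_Schwarz_ineq2[of x c]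
        by (intro mult_right_mono) (auto simp: algebra_simps intro: order_trans add_increasing)
      then have "(1 + norm x) ^ N * norm (of_real (x \<bullet> c) * f x) \<le> (1 + norm x) ^ N * ((norm c * (1 + norm x)) * norm (f x))"
        by (intro mult_left_mono) auto
      also have "\<dots> = norm c * ((1 + norm x) ^ Suc N * norm (iter_pd [] f x))"
        by (simp add: algebra_simps)
      also have "\<dots> \<le> norm c * schwartz_norm (Suc N) f"
        by (intro mult_left_mono schwartz_norm_upper f) auto
      finally show ?thesis .
    qed
    then show ?case by (simp; blast)
  next
    case (snoc b bs)
    then obtain M C where MC: "\<And>f x. f \<in> schwartz \<Longrightarrow>
        (1 + norm x) ^ N * norm (iter_pd bs (\<lambda>x. of_real (x \<bullet> c) * f x) x) \<le> C * schwartz_norm M f"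
      by auto
    have b: "b \<in> Basis" "set bs \<subseteq> Basis" using snoc by auto
    obtain L D where LD: "D \<ge> 0" "\<And>f. f \<in> schwartz \<Longrightarrow> schwartz_norm M (pd b f) \<le> D * schwartz_norm L f"
      using schwartz_cont_op_bound[OF schwartz_cont_op_pd[OF b(1)]] by metis
    define K where "K = max L (max N (length bs))"
    have "(1 + norm x) ^ N * norm (iter_pd (bs @ [b]) (\<lambda>x. of_real (x \<bullet> c) * f x) x)
        \<le> (\<bar>C\<bar> * D + \<bar>b \<bullet> c\<bar>) * schwartz_norm K f" if f: "f \<in> schwartz" for f x
    proof -
      have f': "pd b f \<in> schwartz" by (intro schwartz_pd f b)
      have "iter_pd (bs @ [b]) (\<lambda>x. of_real (x \<bullet> c) * f x) x
          = iter_pd bs (\<lambda>x. of_real (x \<bullet> c) * pd b f x) x + of_real (b \<bullet> c) * iter_pd bs f x"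
        using f f' b by (simp add: iter_pd_snoc pd_coord_mult iter_pd_add iter_pd_cmult schwartz_coord_mult schwartz_cmult)
      then have "(1 + norm x) ^ N * norm (iter_pd (bs @ [b]) (\<lambda>x. of_real (x \<bullet> c) * f x) x)
        \<le> (1 + norm x) ^ N * (norm (iter_pd bs (\<lambda>x. of_real (x \<bullet> c) * pd b f x) x) + \<bar>b \<bullet> c\<bar> * norm (iter_pd bs f x))"
        by (auto intro!: mult_left_mono order_trans[OF norm_triangle_ineq] simp: norm_mult)
      also have "\<dots> = (1 + norm x) ^ N * norm (iter_pd bs (\<lambda>x. of_real (x \<bullet> c) * pd b f x) x)
          + \<bar>b \<bullet> c\<bar> * ((1 + norm x) ^ N * norm (iter_pd bs f x))" by (simp add: algebra_simps)
      also have "\<dots> \<le> \<bar>C\<bar> * (D * schwartz_norm K f) + \<bar>b \<bullet> c\<bar> * schwartz_norm K f"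
      proof (intro add_mono mult_left_mono)
        have "(1 + norm x) ^ N * norm (iter_pd bs (\<lambda>x. of_real (x \<bullet> c) * pd b f x) x) \<le> C * schwartz_norm M (pd b f)"
          by (rule MC[OF f'])
        also have "\<dots> \<le> \<bar>C\<bar> * schwartz_norm M (pd b f)"
          by (intro mult_right_mono schwartz_norm_nonneg f') auto
        also have "\<dots> \<le> \<bar>C\<bar> * (D * schwartz_norm L f)"
          by (intro mult_left_mono LD f) auto
        also have "\<dots> \<le> \<bar>C\<bar> * (D * schwartz_norm K f)"
          by (intro mult_left_mono LD f schwartz_norm_mono) (auto simp: K_def)
        finally show "(1 + norm x) ^ N * norm (iter_pd bs (\<lambda>x. of_real (x \<bullet> c) * pd b f x) x) \<le> \<bar>C\<bar> * (D * schwartz_norm K f)" .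
        show "(1 + norm x) ^ N * norm (iter_pd bs f x) \<le> schwartz_norm K f"
          by (intro schwartz_norm_upper f b) (auto simp: K_def)
      qed auto
      finally show ?thesis by (simp add: algebra_simps)
    qed
    then show ?case by blast
  qed
qed (rule schwartz_coord_mult)

text \<open>With m the largest of 1 and the |x \<bullet> b|, the norm is at most the dimension times
  m, and m^N is one of the summands. This trades a radial weight for powers of single coordinates,
  on which operators act algebraically.\<close>

lemma one_plus_norm_power_le:
  fixes x :: "'a::euclidean_space"
  shows "(1 + norm x) ^ N \<le> (1 + real DIM('a)) ^ N * (1 + (\<Sum>b\<in>Basis. \<bar>x \<bullet> b\<bar> ^ N))"
proof -
  define m where "m = Max (insert 1 ((\<lambda>b. \<bar>x \<bullet> b\<bar>) ` Basis))"
  have m: "1 \<le> m" "\<And>b. b \<in> Basis \<Longrightarrow> \<bar>x \<bullet> b\<bar> \<le> m"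
    unfolding m_def by (auto intro!: Max_ge simp del: Max_insert)
  have "norm x \<le> (\<Sum>b\<in>Basis. \<bar>x \<bullet> b\<bar>)" by (rule norm_le_l1)
  also have "\<dots> \<le> real DIM('a) * m" using sum_bounded_above[of Basis "\<lambda>b. \<bar>x \<bullet> b\<bar>" m] m by simp
  finally have "1 + norm x \<le> (1 + real DIM('a)) * m" using m(1) by (simp add: algebra_simps)
  then have "(1 + norm x) ^ N \<le> ((1 + real DIM('a)) * m) ^ N"
    by (intro power_mono) auto
  also have "\<dots> = (1 + real DIM('a)) ^ N * m ^ N" by (simp add: power_mult_distrib)
  also have "m ^ N \<le> 1 + (\<Sum>b\<in>Basis. \<bar>x \<bullet> b\<bar> ^ N)"
  proof -
    have "m \<in> insert 1 ((\<lambda>b. \<bar>x \<bullet> b\<bar>) ` Basis)" unfolding m_def by (rule Max_in) auto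
    then consider "m = 1" | b where "b \<in> Basis" "m = \<bar>x \<bullet> b\<bar>" by auto
    then show ?thesis
    proof cases
      case 2
      then have "m ^ N \<le> (\<Sum>b\<in>Basis. \<bar>x \<bullet> b\<bar> ^ N)"
        using member_le_sum[of b Basis "\<lambda>b. \<bar>x \<bullet> b\<bar> ^ N"] by auto
      then show ?thesis by simp
    qed (simp add: sum_nonneg)
  qed
  finally show ?thesis by (simp add: mult_left_mono)
qed

subsection \<open>Integration and Fourier inversion\<close>

text \<open>Lebesgue measure is the image of the product of one-dimensional Lebesgue measures under
  the map from coordinates to vectors, so both claims are inherited from finite products.\<close>

lemma
  fixes f :: "'a::euclidean_space \<Rightarrow> real \<Rightarrow> 'b::{real_normed_field,banach,second_countable_topology}"
  assumes "\<And>b. b \<in> Basis \<Longrightarrow> integrable lborel (f b)"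
  shows integrable_lborel_prod_Basis: "integrable lborel (\<lambda>x. \<Prod>b\<in>Basis. f b (x \<bullet> b))"
    and integral_lborel_prod_Basis: "(LINT x|lborel. (\<Prod>b\<in>Basis. f b (x \<bullet> b))) = (\<Prod>b\<in>Basis. LINT t|lborel. f b t)"
proof -
  interpret product_sigma_finite "\<lambda>b::'a. lborel :: real measure" ..
  have fm: "f b \<in> borel_measurable borel" if "b \<in> Basis" for b
    using borel_measurable_integrable[OF assms[OF that]] by simp
  have m: "(\<lambda>x. \<Prod>b\<in>Basis. f b (x \<bullet> b)) \<in> borel_measurable borel"
  proof (rule borel_measurable_prod)
    fix b :: 'a assume b: "b \<in> Basis"
    have "(\<lambda>x. x \<bullet> b) \<in> borel_measurable borel" by simp
    from measurable_compose[OF this fm[OF b]] show "(\<lambda>x. f b (x \<bullet> b)) \<in> borel_measurable borel" .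
  qed
  have eq: "(\<Prod>b\<in>Basis. f b ((\<Sum>c\<in>Basis. g c *\<^sub>R c) \<bullet> b)) = (\<Prod>b\<in>Basis. f b (g b))" for g :: "'a \<Rightarrow> real"
    by (intro prod.cong refl) (simp add: inner_sum_left inner_Basis if_distrib sum.delta cong: if_cong)
  have i: "integrable (\<Pi>\<^sub>M b\<in>Basis. lborel) (\<lambda>g. \<Prod>b\<in>Basis. f b (g b))"
    by (intro product_integrable_prod assms) auto
  have d: "(\<lambda>g. \<Sum>b\<in>Basis. g b *\<^sub>R b) \<in> measurable (\<Pi>\<^sub>M b\<in>(Basis::'a set). (lborel::real measure)) borel"
    by measurable
  show "integrable lborel (\<lambda>x. \<Prod>b\<in>Basis. f b (x \<bullet> b))"
    unfolding lborel_eq[where 'a='a] by (subst integrable_distr_eq[OF d m]) (simp only: eq i)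
  have "(LINT x|lborel. (\<Prod>b\<in>Basis. f b (x \<bullet> b))) = (LINT g|(\<Pi>\<^sub>M b\<in>Basis. lborel). (\<Prod>b\<in>Basis. f b (g b)))"
    unfolding lborel_eq[where 'a='a] by (subst integral_distr[OF d m]) (simp only: eq)
  also have "\<dots> = (\<Prod>b\<in>Basis. LINT t|lborel. f b t)"
    by (intro product_integral_prod assms) auto
  finally show "(LINT x|lborel. (\<Prod>b\<in>Basis. f b (x \<bullet> b))) = (\<Prod>b\<in>Basis. LINT t|lborel. f b t)" .
qed

lemma
  fixes f :: "'a::euclidean_space \<Rightarrow> 'b::{banach,second_countable_topology}"
  assumes c: "c \<noteq> 0"
  shows lborel_integral_affine: "(LINT x|lborel. f x) = \<bar>c\<bar> ^ DIM('a) *\<^sub>R (LINT x|lborel. f (t + c *\<^sub>R x))"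
    and lborel_integrable_affine_iff: "integrable lborel (\<lambda>x. f (t + c *\<^sub>R x)) \<longleftrightarrow> integrable lborel f"
proof -
  have one: "integrable lborel (\<lambda>x. f (t + c *\<^sub>R x))" if f: "integrable lborel f" and c: "c \<noteq> 0"
    for f :: "'a \<Rightarrow> 'b" and c t
  proof -
    have [measurable]: "f \<in> borel_measurable borel" using f by auto
    have "integrable (density (distr lborel borel (\<lambda>x. t + c *\<^sub>R x)) (\<lambda>_. \<bar>c\<bar>^DIM('a))) f"
      using f lborel_affine[OF c, of t] by simp
    then have "integrable (distr lborel borel (\<lambda>x. t + c *\<^sub>R x)) (\<lambda>x. \<bar>c\<bar>^DIM('a) *\<^sub>R f x)"
      by (subst (asm) integrable_density) auto
    then have "integrable lborel (\<lambda>x. \<bar>c\<bar>^DIM('a) *\<^sub>R f (t + c *\<^sub>R x))"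
      by (subst (asm) integrable_distr_eq) auto
    from integrable_scaleR_right[OF this, of "inverse (\<bar>c\<bar>^DIM('a))"] show ?thesis using c by simp
  qed
  \<comment> \<open>The converse of \<open>one\<close> is \<open>one\<close> itself for the inverse
    affine map.\<close>
  have "(\<lambda>x. f (t + c *\<^sub>R (- (1 / c) *\<^sub>R t + (1 / c) *\<^sub>R x))) = f"
    using c by (simp add: algebra_simps)
  then show iff: "integrable lborel (\<lambda>x. f (t + c *\<^sub>R x)) \<longleftrightarrow> integrable lborel f"
    using one[of f c t] c one[of "\<lambda>x. f (t + c *\<^sub>R x)" "1 / c" "- (1 / c) *\<^sub>R t"] by auto
  show "(LINT x|lborel. f x) = \<bar>c\<bar> ^ DIM('a) *\<^sub>R (LINT x|lborel. f (t + c *\<^sub>R x))"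
  proof (cases "integrable lborel f")
    case True
    then have [measurable]: "f \<in> borel_measurable borel" by auto
    show ?thesis
      by (subst lborel_affine[OF c, of t]) (simp add: integral_density integral_distr)
  next
    \<comment> \<open>Neither integrand is integrable, so both integrals have the default value
      0.\<close>
    case False
    then show ?thesis using iff by (simp add: not_integrable_integral_eq)
  qed
qed

lemma
  fixes f :: "'a::euclidean_space \<Rightarrow> 'b::{banach,second_countable_topology}"
  shows lborel_integral_translate: "(LINT x|lborel. f (x + t)) = (LINT x|lborel. f x)"
    and lborel_integrable_translate: "integrable lborel (\<lambda>x. f (x + t)) \<longleftrightarrow> integrable lborel f"
  using lborel_integral_affine[of 1 f t] lborel_integrable_affine_iff[of 1 f t] by (simp_all add: add.commute)

lemma lborel_integral_reflect:
  fixes f :: "'a::euclidean_space \<Rightarrow> 'b::{banach,second_countable_topology}"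
  shows "(LINT x|lborel. f (t - x)) = (LINT x|lborel. f x)"
  using lborel_integral_affine[of "-1" f t] by simp

text \<open>Each 1 + (x \<bullet> b)^2 is at most (1 + |x|)^2, so a product of the functions 1 / (1
  + t^2), integrable on the line, is a majorant. The exponents \<open>2 * DIM('a)\<close> in later
  estimates come from here.\<close>

lemma integrable_inverse_one_plus_norm_power:
  assumes "k \<ge> 2 * DIM('a)"
  shows "integrable lborel (\<lambda>x::'a::euclidean_space. inverse ((1 + norm x) ^ k))"
proof (rule Bochner_Integration.integrable_bound)
  have "integrable lborel (\<lambda>x::real. inverse (1 + x\<^sup>2))"
    using integrable_inverse_1_plus_square by (simp add: set_integrable_def)
  then show "integrable lborel (\<lambda>x::'a. \<Prod>b\<in>Basis. inverse (1 + (x \<bullet> b)\<^sup>2))"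
    by (rule integrable_lborel_prod_Basis)
  have "inverse ((1 + norm x) ^ k) \<le> (\<Prod>b\<in>Basis. inverse (1 + (x \<bullet> b)\<^sup>2))" for x :: 'a
  proof -
    have "(\<Prod>b\<in>Basis. 1 + (x \<bullet> b)\<^sup>2) \<le> (\<Prod>b\<in>(Basis::'a set). (1 + norm x)\<^sup>2)"
    proof (rule prod_mono, safe)
      fix b :: 'a assume "b \<in> Basis"
      then have "(x \<bullet> b)\<^sup>2 \<le> (norm x)\<^sup>2" using Basis_le_norm[of b x] by (simp add: abs_le_square_iff[symmetric])
      then show "1 + (x \<bullet> b)\<^sup>2 \<le> (1 + norm x)\<^sup>2"
        using norm_ge_zero[of x] unfolding power2_sum by (simp only: one_power2 mult_1_right)
    qed auto
    also have "\<dots> = (1 + norm x) ^ (2 * DIM('a))" by (simp add: power_mult)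
    also have "\<dots> \<le> (1 + norm x) ^ k" by (intro power_increasing assms) auto
    finally have *: "(\<Prod>b\<in>Basis. 1 + (x \<bullet> b)\<^sup>2) \<le> (1 + norm x) ^ k" .
    have "0 < (\<Prod>b\<in>Basis. 1 + (x \<bullet> b)\<^sup>2)" by (intro prod_pos) (simp add: add_pos_nonneg)
    with * have "inverse ((1 + norm x) ^ k) \<le> inverse (\<Prod>b\<in>Basis. 1 + (x \<bullet> b)\<^sup>2)"
      by (rule le_imp_inverse_le)
    then show ?thesis using prod_inversef[of "\<lambda>b. 1 + (x \<bullet> b)\<^sup>2" Basis] by (simp add: o_def)
  qed
  then show "AE x::'a in lborel. norm (inverse ((1 + norm x) ^ k)) \<le> norm (\<Prod>b\<in>Basis. inverse (1 + (x \<bullet> b)\<^sup>2))"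
    by (auto intro!: AE_I2 order_trans[OF _ abs_ge_self])
qed simp

lemma norm_le_of_weighted:
  fixes x :: "'a::real_normed_vector"
  assumes "(1 + norm x) ^ (k + l) * r \<le> C"
  shows "(1 + norm x) ^ k * r \<le> C * inverse ((1 + norm x) ^ l)"
proof -
  have "0 < (1 + norm x) ^ l" by (simp add: add_pos_nonneg)
  with assms show ?thesis by (simp add: field_simps power_add)
qed

lemma integrable_weighted_bound:
  fixes f :: "'a::euclidean_space \<Rightarrow> 'b::{banach,second_countable_topology}"
  assumes [measurable]: "f \<in> borel_measurable borel"
    and bound: "\<And>x. (1 + norm x) ^ (k + 2 * DIM('a)) * norm (f x) \<le> C"
  shows "integrable lborel (\<lambda>x. (1 + norm x) ^ k *\<^sub>R f x)"
proof (rule Bochner_Integration.integrable_bound)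
  show "integrable lborel (\<lambda>x::'a. C * inverse ((1 + norm x) ^ (2 * DIM('a))))"
    by (intro integrable_mult_right integrable_inverse_one_plus_norm_power) auto
  show "AE x in lborel. norm ((1 + norm x) ^ k *\<^sub>R f x) \<le> norm (C * inverse ((1 + norm x) ^ (2 * DIM('a))))"
    using norm_le_of_weighted[OF bound] by (auto intro!: AE_I2 order_trans[OF _ abs_ge_self])
qed simp

lemma integrable_schwartz_weighted:
  assumes "f \<in> schwartz"
  shows "integrable lborel (\<lambda>x. (1 + norm x) ^ k * norm (f x))"
proof -
  obtain C where "\<And>x. (1 + norm x) ^ (k + 2 * DIM('a)) * norm (f x) \<le> C"
    using schwartz_decay[OF assms] by metis
  then show ?thesis
    using integrable_weighted_bound[of "\<lambda>x. norm (f x)" k C] schwartz_measurable[OF assms] by simp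
qed

lemma integrable_schwartz:
  assumes "f \<in> schwartz"
  shows "integrable lborel f"
  using integrable_schwartz_weighted[OF assms, of 0] schwartz_measurable[OF assms]
  by (simp add: integrable_norm_iff)

lemma schwartz_bounded:
  assumes "f \<in> schwartz"
  obtains C where "C > 0" "\<And>x. norm (f x) \<le> C"
proof (rule schwartz_decay[OF assms, of 0])
  fix C :: real assume "C > 0" "\<And>x. (1 + norm x) ^ 0 * norm (f x) \<le> C"
  then show ?thesis using that by simp
qed

lemma schwartz_L2: "f \<in> schwartz \<Longrightarrow> f \<in> L2"
proof -
  assume f: "f \<in> schwartz"
  have [measurable]: "f \<in> borel_measurable borel" by (rule schwartz_measurable[OF f])
  obtain C where C: "C > 0" "\<And>x. norm (f x) \<le> C" using schwartz_bounded[OF f] by blast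
  have "integrable lborel (\<lambda>x. (norm (f x))\<^sup>2)"
  proof (rule Bochner_Integration.integrable_bound)
    show "integrable lborel (\<lambda>x. C * norm (f x))" using integrable_schwartz[OF f] by simp
    show "AE x in lborel. norm ((norm (f x))\<^sup>2) \<le> norm (C * norm (f x))"
      using C by (auto intro!: AE_I2 mult_right_mono simp: power2_eq_square abs_mult)
  qed simp
  then show ?thesis by (simp add: L2_def)
qed

section \<open>Gaussians, the Fourier transform and its inversion\<close>

lemma integrable_std_gauss_real: "integrable lborel (\<lambda>x::real. exp (- x\<^sup>2 / 2))"
proof -
  have "integrable lborel (\<lambda>x::real. sqrt (2 * pi) * (std_normal_density x * x ^ 0))"
    by (intro integrable_mult_right integrable_std_normal_moment)
  then show ?thesis by (simp add: std_normal_density_def)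
qed

text \<open>Read off from the characteristic function of the standard normal distribution; sqrt (2
  pi) undoes the normalisation of its density.\<close>

lemma fourier_std_gauss_real:
  "(LINT x|lborel. complex_of_real (exp (- x\<^sup>2 / 2)) * cis (t * x)) = of_real (sqrt (2 * pi) * exp (- t\<^sup>2 / 2))"
proof -
  have "complex_of_real (exp (- (t^2) / 2)) = char std_normal_distribution t"
    by (simp add: char_std_normal_distribution)
  also have "\<dots> = (LINT x|lborel. std_normal_density x *\<^sub>R cis (t * x))"
    unfolding char_def by (subst integral_density) (auto simp: normal_density_nonneg cis_conv_exp)
  also have "\<dots> = (LINT x|lborel. of_real (1 / sqrt (2 * pi)) * (complex_of_real (exp (- x\<^sup>2 / 2)) * cis (t * x)))"
    by (simp add: std_normal_density_def scaleR_conv_of_real mult.assoc)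
  also have "\<dots> = of_real (1 / sqrt (2 * pi)) * (LINT x|lborel. complex_of_real (exp (- x\<^sup>2 / 2)) * cis (t * x))"
    by (rule integral_mult_right_zero)
  finally show ?thesis by (simp add: field_simps)
qed

lemma gauss_prod:
  fixes x :: "'a::euclidean_space"
  shows "exp (- (norm x)\<^sup>2 / 2) = (\<Prod>b\<in>Basis. exp (- (x \<bullet> b)\<^sup>2 / 2))"
proof -
  have "- (norm x)\<^sup>2 / 2 = (\<Sum>b\<in>Basis. - (x \<bullet> b)\<^sup>2 / 2)"
    by (subst norm_le_square[THEN iffD1, OF _] | simp add: power2_norm_eq_inner)+
      (subst euclidean_inner, simp add: power2_eq_square sum_divide_distrib sum_negf)
  then show ?thesis by (simp add: exp_sum)
qed

lemma cis_prod:
  fixes x y :: "'a::euclidean_space"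
  shows "cis (x \<bullet> y) = (\<Prod>b\<in>Basis. cis ((x \<bullet> b) * (y \<bullet> b)))"
  by (subst euclidean_inner) (simp add: cis_conv_exp exp_sum sum_distrib_left)

lemma integrable_std_gauss: "integrable lborel (\<lambda>x::'a::euclidean_space. exp (- (norm x)\<^sup>2 / 2))"
  unfolding gauss_prod by (rule integrable_lborel_prod_Basis) (rule integrable_std_gauss_real)

lemma fourier_std_gauss:
  fixes \<xi> :: "'a::euclidean_space"
  shows "(LINT x|lborel. complex_of_real (exp (- (norm x)\<^sup>2 / 2)) * cis (\<xi> \<bullet> x))
    = of_real (sqrt (2 * pi) ^ DIM('a) * exp (- (norm \<xi>)\<^sup>2 / 2))"
proof -
  have "integrable lborel (\<lambda>x. complex_of_real (exp (- x\<^sup>2 / 2)) * cis (t * x))" for t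
    by (rule Bochner_Integration.integrable_bound[OF integrable_std_gauss_real])
      (auto simp: norm_mult cis_conv_exp)
  from integral_lborel_prod_Basis[of "\<lambda>b x. complex_of_real (exp (- x\<^sup>2 / 2)) * cis ((\<xi> \<bullet> b) * x)", OF this]
  have "(LINT x|lborel. (\<Prod>b\<in>Basis. complex_of_real (exp (- (x \<bullet> b)\<^sup>2 / 2)) * cis ((\<xi> \<bullet> b) * (x \<bullet> b))))
     = (\<Prod>b\<in>(Basis::'a set). of_real (sqrt (2 * pi) * exp (- (\<xi> \<bullet> b)\<^sup>2 / 2)))"
    unfolding fourier_std_gauss_real .
  then show ?thesis
    unfolding gauss_prod cis_prod of_real_prod of_real_mult prod.distrib[symmetric] prod_constant of_real_power by (simp add: prod.distrib)
qed

text \<open>The convention without 2 pi in the exponent: derivatives become multiplication by i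
  times a coordinate, and the inversion formula carries the constant (2 pi)^d.\<close>

definition fourier :: "('a::euclidean_space \<Rightarrow> complex) \<Rightarrow> 'a \<Rightarrow> complex" where
  "fourier u \<xi> = (LINT t|lborel. u t * cis (- (\<xi> \<bullet> t)))"

lemma measurable_cis [measurable]: "cis \<in> borel_measurable borel"
  by (intro borel_measurable_continuous_onI continuous_intros)

text \<open>The indicator of an open set is a limit of continuous functions bounded by 1, so
  \<open>f\<close> integrates to 0 over open sets. These are stable under intersection and generate
  the Borel sets, so the same holds over every Borel set.\<close>

lemma AE_zero_if_orthogonal_to_continuous:
  fixes f :: "'a::euclidean_space \<Rightarrow> complex"
  assumes f: "integrable lborel f"
    and orth: "\<And>\<psi>::'a \<Rightarrow> real. continuous_on UNIV \<psi> \<Longrightarrow> (\<And>x. \<bar>\<psi> x\<bar> \<le> 1) \<Longrightarrow> (LINT x|lborel. of_real (\<psi> x) * f x) = 0"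
  shows "AE x in lborel. f x = 0"
proof (rule sigma_finite_measure.density_zero[OF lborel.sigma_finite_measure_axioms f])
  have [measurable]: "f \<in> borel_measurable borel" using f by auto
  fix A :: "'a set" assume "A \<in> sets lborel"
  then have A: "A \<in> sigma_sets UNIV {S. open S}" by (simp add: borel_def)
  have si: "set_integrable lborel B f" if "B \<in> sets borel" for B
    using f that by (auto intro: set_integrable_subset simp: set_integrable_def integrable_mult_indicator)
  have "Int_stable {S::'a set. open S}" "{S::'a set. open S} \<subseteq> Pow UNIV" by (auto simp: Int_stable_def)
  from this A show "set_lebesgue_integral lborel A f = 0"
  proof (induction rule: sigma_sets_induct_disjoint)
    case (basic S)
    then have S: "open S" by simp
    show ?case
    \<comment> \<open>The whole space is treated apart because \<open>infdist\<close> to the empty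
      set is 0 by default, which would make every \<open>\<psi> n\<close> vanish.\<close>
    proof (cases "S = UNIV")
      case True
      then show ?thesis using orth[of "\<lambda>_. 1"] by (simp add: set_lebesgue_integral_def)
    next
      case False
      then have ne: "- S \<noteq> {}" by auto
      define \<psi> where "\<psi> n x = min 1 (real n * infdist x (- S))" for n x
      have "(LINT x|lborel. of_real (\<psi> n x) * f x) = 0" for n
        unfolding \<psi>_def by (rule orth) (auto intro!: continuous_intros simp: infdist_nonneg)
      moreover have "(\<lambda>n. LINT x|lborel. of_real (\<psi> n x) * f x) \<longlonglongrightarrow> (LINT x|lborel. indicator S x *\<^sub>R f x)"
      proof (rule integral_dominated_convergence[where w="\<lambda>x. norm (f x)"])
        show "(\<lambda>x. of_real (\<psi> n x) * f x) \<in> borel_measurable lborel" for n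
        proof -
          have [measurable]: "\<psi> n \<in> borel_measurable borel"
            unfolding \<psi>_def by (intro borel_measurable_continuous_onI continuous_intros)
          show ?thesis by measurable
        qed
        show "(\<lambda>x. indicator S x *\<^sub>R f x) \<in> borel_measurable lborel"
          using S by simp
        show "integrable lborel (\<lambda>x. norm (f x))" using f by simp
        have "(\<lambda>n. \<psi> n x) \<longlonglongrightarrow> indicator S x" for x
        proof (cases "x \<in> S")
          case True
          then have pos: "infdist x (- S) > 0"
            using S ne by (intro infdist_pos_not_in_closed) auto
          obtain N where N: "1 / infdist x (- S) < real N" using reals_Archimedean2 by blast
          have "\<psi> n x = 1" if "n \<ge> N" for n
          proof -
            have "1 / infdist x (- S) \<le> real n" using N that by linarith
            then show ?thesis using pos by (simp add: \<psi>_def field_simps)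
          qed
          then show ?thesis using True by (intro tendsto_eventually) (auto simp: eventually_sequentially)
        qed (simp add: \<psi>_def)
        then show "AE x in lborel. (\<lambda>n. of_real (\<psi> n x) * f x) \<longlonglongrightarrow> indicator S x *\<^sub>R f x"
          by (auto intro!: AE_I2 tendsto_mult tendsto_of_real simp: scaleR_conv_of_real)
        show "AE x in lborel. norm (of_real (\<psi> n x) * f x) \<le> norm (f x)" for n
          by (auto intro!: AE_I2 mult_left_le_one_le simp: norm_mult \<psi>_def infdist_nonneg)
      qed
      ultimately show ?thesis by (simp add: set_lebesgue_integral_def LIMSEQ_const_iff)
    qed
  next
    case (compl A)
    then have [measurable]: "A \<in> sets borel" by (simp add: borel_def)
    have "(LINT x|lborel. f x) = 0" using orth[of "\<lambda>_. 1"] by simp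
    moreover have "(LINT x|lborel. indicator (UNIV - A) x *\<^sub>R f x) = (LINT x|lborel. f x - indicator A x *\<^sub>R f x)"
      by (intro Bochner_Integration.integral_cong) (auto simp: indicator_def)
    moreover have "\<dots> = (LINT x|lborel. f x) - (LINT x|lborel. indicator A x *\<^sub>R f x)"
      using si[of A] by (intro Bochner_Integration.integral_diff f) (auto simp: set_integrable_def)
    ultimately show ?case using compl by (simp add: set_lebesgue_integral_def)
  next
    case (union A)
    then have A: "A i \<in> sets borel" for i by (auto simp: borel_def)
    have "set_lebesgue_integral lborel (\<Union>i. A i) f = (\<Sum>i. set_lebesgue_integral lborel (A i) f)"
      using union(1) A by (intro lebesgue_integral_countable_add si) (auto simp: disjoint_family_on_def)
    then show ?case using union by simp
  qed (simp add: set_lebesgue_integral_def)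
qed

lemma fourier_bounded:
  assumes "integrable lborel u"
  shows "norm (fourier u \<xi>) \<le> (LINT t|lborel. norm (u t))"
  unfolding fourier_def
  by (rule order_trans[OF integral_norm_bound]) (simp add: norm_mult)

lemma integrable_cis_mult:
  assumes "integrable lborel u" "g \<in> borel_measurable borel"
  shows "integrable lborel (\<lambda>t. u t * cis (g t))"
proof -
  have [measurable]: "u \<in> borel_measurable borel" using assms(1) by auto
  note assms(2)[measurable]
  show ?thesis by (rule Bochner_Integration.integrable_bound[OF assms(1)]) (auto simp: norm_mult)
qed

text \<open>The Gaussian factor makes the double integral absolutely convergent, so Fubini applies;
  the inner integral is then the transform of a dilated Gaussian, a bump around \<open>t\<close> of
  width \<epsilon>.\<close>

lemma gauss_regularised_inversion:
  fixes u :: "'a::euclidean_space \<Rightarrow> complex"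
  assumes u: "integrable lborel u" and \<epsilon>: "\<epsilon> > 0"
  shows "(LINT \<xi>|lborel. fourier u \<xi> * cis (\<xi> \<bullet> t) * of_real (exp (- (norm (\<epsilon> *\<^sub>R \<xi>))\<^sup>2 / 2)))
    = (LINT s|lborel. u s * of_real (sqrt (2 * pi) ^ DIM('a) * (1 / \<epsilon>) ^ DIM('a) * exp (- (norm ((1 / \<epsilon>) *\<^sub>R (t - s)))\<^sup>2 / 2)))"
proof -
  have [measurable]: "u \<in> borel_measurable borel" using u by auto
  let ?G = "\<lambda>\<xi>::'a. exp (- (norm (\<epsilon> *\<^sub>R \<xi>))\<^sup>2 / 2)"
  let ?F = "\<lambda>\<xi> s. u s * cis (- (\<xi> \<bullet> s)) * cis (\<xi> \<bullet> t) * of_real (?G \<xi>)"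
  have G: "integrable lborel ?G"
    using integrable_std_gauss lborel_integrable_affine_iff[of \<epsilon> "\<lambda>x::'a. exp (- (norm x)\<^sup>2 / 2)" 0] \<epsilon> by simp
  have int: "integrable (lborel \<Otimes>\<^sub>M lborel) (\<lambda>(\<xi>, s). ?F \<xi> s)"
  proof (rule lborel_pair.Fubini_integrable)
    have "integrable lborel (\<lambda>\<xi>. ?G \<xi> * (LINT s|lborel. norm (u s)))"
      by (intro integrable_mult_left G)
    then show "integrable lborel (\<lambda>\<xi>. LINT s|lborel. norm (case (\<xi>, s) of (\<xi>, s) \<Rightarrow> ?F \<xi> s))"
      by (simp add: norm_mult mult.commute)
    show "AE \<xi> in lborel. integrable lborel (\<lambda>s. case (\<xi>, s) of (\<xi>, s) \<Rightarrow> ?F \<xi> s)"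
      unfolding prod.case by (intro AE_I2 integrable_mult_left integrable_cis_mult u) auto
  qed measurable
  have "(LINT \<xi>|lborel. fourier u \<xi> * cis (\<xi> \<bullet> t) * of_real (?G \<xi>)) = (LINT \<xi>|lborel. (LINT s|lborel. ?F \<xi> s))"
    by (simp add: fourier_def)
  also have "\<dots> = (LINT s|lborel. (LINT \<xi>|lborel. ?F \<xi> s))"
    by (rule lborel_pair.Fubini_integral[OF int, symmetric])
  also have "\<dots> = (LINT s|lborel. u s * of_real (sqrt (2 * pi) ^ DIM('a) * (1 / \<epsilon>) ^ DIM('a) * exp (- (norm ((1 / \<epsilon>) *\<^sub>R (t - s)))\<^sup>2 / 2)))"
  proof (intro Bochner_Integration.integral_cong refl)
    fix s
    have "(LINT \<xi>|lborel. ?F \<xi> s) = u s * (LINT \<xi>|lborel. of_real (?G \<xi>) * cis ((t - s) \<bullet> \<xi>))"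
    proof -
      have "cis (- (\<xi> \<bullet> s)) * cis (\<xi> \<bullet> t) = cis ((t - s) \<bullet> \<xi>)" for \<xi>
        by (simp add: cis_mult inner_diff_left inner_diff_right inner_commute)
      then have "?F \<xi> s = u s * (of_real (?G \<xi>) * cis ((t - s) \<bullet> \<xi>))" for \<xi>
        by (simp only: mult.assoc) (simp only: mult_ac)
      then show ?thesis by (simp only: integral_mult_right_zero)
    qed
    also have "(LINT \<xi>|lborel. of_real (?G \<xi>) * cis ((t - s) \<bullet> \<xi>))
       = (1 / \<epsilon>) ^ DIM('a) *\<^sub>R (LINT x|lborel. complex_of_real (exp (- (norm x)\<^sup>2 / 2)) * cis (((1 / \<epsilon>) *\<^sub>R (t - s)) \<bullet> x))"
      using \<epsilon> by (subst lborel_integral_affine[of "1 / \<epsilon>" _ 0]) simp_all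
    finally show "(LINT \<xi>|lborel. ?F \<xi> s) = u s * of_real (sqrt (2 * pi) ^ DIM('a) * (1 / \<epsilon>) ^ DIM('a) * exp (- (norm ((1 / \<epsilon>) *\<^sub>R (t - s)))\<^sup>2 / 2))"
      unfolding fourier_std_gauss by (simp add: scaleR_conv_of_real mult_ac)
  qed
  finally show ?thesis .
qed

text \<open>Fubini and the substitution t = s + \<epsilon> x move the mollification from
  \<open>u\<close> to \<psi>. In the limit \<epsilon> -> 0 it is then the continuity of \<psi>,
  rather than any regularity of \<open>u\<close>, that does the work.\<close>

lemma gauss_mollified_pairing:
  fixes u \<psi> :: "'a::euclidean_space \<Rightarrow> complex"
  assumes u: "integrable lborel u" and \<epsilon>: "\<epsilon> > 0"
    and \<psi>: "\<psi> \<in> borel_measurable borel" "\<And>x. norm (\<psi> x) \<le> K"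
  shows "(LINT t|lborel. \<psi> t * (LINT s|lborel. u s * of_real ((1 / \<epsilon>) ^ DIM('a) * exp (- (norm ((1 / \<epsilon>) *\<^sub>R (t - s)))\<^sup>2 / 2))))
    = (LINT s|lborel. u s * (LINT x|lborel. \<psi> (s + \<epsilon> *\<^sub>R x) * of_real (exp (- (norm x)\<^sup>2 / 2))))"
proof -
  have [measurable]: "u \<in> borel_measurable borel" using u by auto
  note \<psi>(1)[measurable]
  define H where "H r = (1 / \<epsilon>) ^ DIM('a) * exp (- (norm ((1 / \<epsilon>) *\<^sub>R r))\<^sup>2 / 2)" for r :: 'a
  have [measurable]: "H \<in> borel_measurable borel" unfolding H_def by measurable
  have H0: "H r \<ge> 0" for r using \<epsilon> by (simp add: H_def)
  have H: "integrable lborel H"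
    using integrable_std_gauss lborel_integrable_affine_iff[of "1 / \<epsilon>" "\<lambda>x::'a. exp (- (norm x)\<^sup>2 / 2)" 0] \<epsilon>
    by (simp add: H_def[abs_def])
  have H': "integrable lborel (\<lambda>t. H (t - s))" for s
    using H lborel_integrable_translate[of H "- s"] by simp
  have H'': "(LINT t|lborel. H (t - s)) = integral\<^sup>L lborel H" for s
    using lborel_integral_translate[of H "- s"] by simp
  let ?F = "\<lambda>s t. \<psi> t * (u s * of_real (H (t - s)))"
  have b: "norm (?F s t) \<le> K * norm (u s) * H (t - s)" for s t
    using mult_right_mono[OF \<psi>(2)[of t], of "norm (u s) * H (t - s)"] H0 by (simp add: norm_mult mult.assoc)
  have i: "integrable lborel (\<lambda>t. ?F s t)" for s
    by (rule Bochner_Integration.integrable_bound[OF integrable_mult_right[OF H', of "K * norm (u s)" s]])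
      (use b in \<open>auto intro!: AE_I2 order_trans[OF b abs_ge_self] simp del: norm_mult abs_mult\<close>)
  have int: "integrable (lborel \<Otimes>\<^sub>M lborel) (\<lambda>(s, t). ?F s t)"
  proof (rule lborel_pair.Fubini_integrable)
    show "integrable lborel (\<lambda>s. LINT t|lborel. norm (case (s, t) of (s, t) \<Rightarrow> ?F s t))"
    proof (rule Bochner_Integration.integrable_bound)
      show "integrable lborel (\<lambda>s. K * norm (u s) * integral\<^sup>L lborel H)" using u by simp
      have "(LINT t|lborel. norm (?F s t)) \<le> (LINT t|lborel. K * norm (u s) * H (t - s))" for s
        by (intro integral_mono integrable_norm i b integrable_mult_right H')
      then have "(LINT t|lborel. norm (?F s t)) \<le> K * norm (u s) * integral\<^sup>L lborel H" for s
        by (simp add: H'')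
      then show "AE s in lborel. norm (LINT t|lborel. norm (case (s, t) of (s, t) \<Rightarrow> ?F s t)) \<le> norm (K * norm (u s) * integral\<^sup>L lborel H)"
        unfolding prod.case by (intro AE_I2) (auto intro: order_trans[OF _ abs_ge_self])
    qed measurable
    show "AE s in lborel. integrable lborel (\<lambda>t. case (s, t) of (s, t) \<Rightarrow> ?F s t)"
      unfolding prod.case by (intro AE_I2 i)
  qed measurable
  have "(LINT t|lborel. \<psi> t * (LINT s|lborel. u s * of_real (H (t - s)))) = (LINT t|lborel. (LINT s|lborel. ?F s t))"
    by simp
  also have "\<dots> = (LINT s|lborel. (LINT t|lborel. ?F s t))"
    by (rule lborel_pair.Fubini_integral[OF int])
  also have "\<dots> = (LINT s|lborel. u s * (LINT x|lborel. \<psi> (s + \<epsilon> *\<^sub>R x) * of_real (exp (- (norm x)\<^sup>2 / 2))))"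
  proof (intro Bochner_Integration.integral_cong refl)
    fix s
    have "(LINT t|lborel. ?F s t) = \<bar>\<epsilon>\<bar> ^ DIM('a) *\<^sub>R (LINT x|lborel. ?F s (s + \<epsilon> *\<^sub>R x))"
      using \<epsilon> by (intro lborel_integral_affine) auto
    also have "\<dots> = (LINT x|lborel. u s * (\<psi> (s + \<epsilon> *\<^sub>R x) * of_real (exp (- (norm x)\<^sup>2 / 2))))"
      unfolding integral_scaleR_right[symmetric]
      using \<epsilon> by (intro Bochner_Integration.integral_cong refl) (simp add: H_def scaleR_conv_of_real field_simps)
    finally show "(LINT t|lborel. ?F s t) = u s * (LINT x|lborel. \<psi> (s + \<epsilon> *\<^sub>R x) * of_real (exp (- (norm x)\<^sup>2 / 2)))"
      by simp
  qed
  finally show ?thesis unfolding H_def .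
qed

text \<open>A function that is not integrable has integral 0, so integrability has to be checked for
  the majorant alone.\<close>

lemma norm_integral_le:
  fixes f :: "'m \<Rightarrow> 'b::{banach,second_countable_topology}"
  assumes "integrable M g" "\<And>x. norm (f x) \<le> g x"
  shows "norm (integral\<^sup>L M f) \<le> integral\<^sup>L M g"
  by (rule order_trans[OF integral_norm_bound integral_mono'[OF assms(1)]])
    (use assms(2) order_trans[OF norm_ge_zero assms(2)] in auto)

text \<open>Multiplication by a Gaussian makes \<open>w\<close> integrable, and a bounded continuous
  function times the Gaussian is an admissible test function, so the previous criterion applies; the
  Gaussian has no zeros. This covers functions not known to be integrable, such as an inverse
  Fourier integral.\<close>

lemma AE_zero_if_orthogonal_to_bounded_integrable:
  fixes w :: "'a::euclidean_space \<Rightarrow> complex"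
  assumes int: "\<And>\<psi>::'a \<Rightarrow> complex. continuous_on UNIV \<psi> \<Longrightarrow> integrable lborel \<psi> \<Longrightarrow> bounded (range \<psi>) \<Longrightarrow>
      integrable lborel (\<lambda>x. \<psi> x * w x) \<and> (LINT x|lborel. \<psi> x * w x) = 0"
  shows "AE x in lborel. w x = 0"
proof -
  define G where "G x = complex_of_real (exp (- (norm x)\<^sup>2 / 2))" for x :: 'a
  have G: "continuous_on UNIV G" "integrable lborel G" "\<And>x. norm (G x) \<le> 1"
    using integrable_std_gauss unfolding G_def by (auto intro!: continuous_intros)
  have bG: "bounded (range G)" using G(3) by (auto simp: bounded_iff)
  have "AE x in lborel. G x * w x = 0"
  proof (rule AE_zero_if_orthogonal_to_continuous)
    show "integrable lborel (\<lambda>x. G x * w x)" using int[OF G(1,2) bG] by simp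
    fix \<psi> :: "'a \<Rightarrow> real" assume \<psi>: "continuous_on UNIV \<psi>" "\<And>x. \<bar>\<psi> x\<bar> \<le> 1"
    let ?h = "\<lambda>x. of_real (\<psi> x) * G x"
    have c: "continuous_on UNIV ?h" by (intro continuous_intros \<psi> G)
    have le: "norm (?h x) \<le> norm (G x)" for x
      using \<psi>(2)[of x] by (simp add: norm_mult mult_left_le_one_le)
    have "integrable lborel ?h"
      by (rule Bochner_Integration.integrable_bound[OF G(2)])
        (use le borel_measurable_continuous_onI[OF c] in auto)
    moreover have "bounded (range ?h)"
      using order_trans[OF le G(3)] by (auto simp: bounded_iff)
    ultimately have "(LINT x|lborel. ?h x * w x) = 0" using int[OF c] by simp
    then show "(LINT x|lborel. of_real (\<psi> x) * (G x * w x)) = 0" by (simp add: mult.assoc)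
  qed
  then show ?thesis by eventually_elim (simp add: G_def)
qed

text \<open>The damped inversion integral, paired with a test function, is evaluated in two ways.
  Removing the damping gives the inversion integral because \<open>fourier u\<close> is integrable;
  concentrating the mollifier gives a multiple of \<open>u\<close>.\<close>

theorem fourier_inversion:
  fixes u :: "'a::euclidean_space \<Rightarrow> complex"
  assumes u: "integrable lborel u" and fu: "integrable lborel (fourier u)"
  shows "AE t in lborel. of_real ((2 * pi) ^ DIM('a)) * u t = (LINT \<xi>|lborel. fourier u \<xi> * cis (\<xi> \<bullet> t))"
proof -
  have [measurable]: "u \<in> borel_measurable borel" "fourier u \<in> borel_measurable borel"
    using u fu by auto
  let ?v = "\<lambda>t. LINT \<xi>|lborel. fourier u \<xi> * cis (\<xi> \<bullet> t)"
  let ?c = "of_real (sqrt (2 * pi) ^ DIM('a)) :: complex"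
  let ?e = "\<lambda>n. 1 / real (Suc n)"
  have v_bound: "norm (?v t) \<le> (LINT \<xi>|lborel. norm (fourier u \<xi>))" for t
    by (rule order_trans[OF integral_norm_bound]) (simp add: norm_mult)
  have [measurable]: "?v \<in> borel_measurable borel" by measurable
  have e0: "?e \<longlonglongrightarrow> 0" by (rule LIMSEQ_Suc[OF lim_1_over_n])
  have "AE t in lborel. of_real ((2 * pi) ^ DIM('a)) * u t - ?v t = 0"
  proof (rule AE_zero_if_orthogonal_to_bounded_integrable)
    fix \<psi> :: "'a \<Rightarrow> complex"
    assume c: "continuous_on UNIV \<psi>" and i: "integrable lborel \<psi>" and "bounded (range \<psi>)"
    then obtain K where K: "\<And>x. norm (\<psi> x) \<le> K" by (auto simp: bounded_iff)
    have [measurable]: "\<psi> \<in> borel_measurable borel" using i by auto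
    have iu: "integrable lborel (\<lambda>x. \<psi> x * u x)"
    proof (rule Bochner_Integration.integrable_bound)
      show "integrable lborel (\<lambda>x. K * norm (u x))" using u by simp
      show "AE x in lborel. norm (\<psi> x * u x) \<le> norm (K * norm (u x))"
        unfolding norm_mult using K by (auto intro!: AE_I2 mult_right_mono order_trans[OF K abs_ge_self])
    qed simp
    have iv: "integrable lborel (\<lambda>x. \<psi> x * ?v x)"
    proof (rule Bochner_Integration.integrable_bound)
      show "integrable lborel (\<lambda>x. (LINT \<xi>|lborel. norm (fourier u \<xi>)) * norm (\<psi> x))" using i by simp
      show "AE x in lborel. norm (\<psi> x * ?v x) \<le> norm ((LINT \<xi>|lborel. norm (fourier u \<xi>)) * norm (\<psi> x))"
      proof (rule AE_I2)
        fix x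
        have "norm (\<psi> x * ?v x) \<le> norm (\<psi> x) * (LINT \<xi>|lborel. norm (fourier u \<xi>))"
          unfolding norm_mult by (intro mult_left_mono v_bound) auto
        also have "\<dots> \<le> norm ((LINT \<xi>|lborel. norm (fourier u \<xi>)) * norm (\<psi> x))"
          by (simp add: mult.commute)
        finally show "norm (\<psi> x * ?v x) \<le> norm ((LINT \<xi>|lborel. norm (fourier u \<xi>)) * norm (\<psi> x))" .
      qed
    qed measurable
    \<comment> \<open>\<open>L\<close> pairs the damped inversion integral with \<psi>, while
      \<open>R\<close> pairs \<open>u\<close> with Gaussian averages of \<psi>. They differ by the
      factor \<open>?c\<close>, and both have a limit as the damping vanishes.\<close>
    define L where "L n = (LINT t|lborel. \<psi> t * (LINT \<xi>|lborel. fourier u \<xi> * cis (\<xi> \<bullet> t) * of_real (exp (- (norm (?e n *\<^sub>R \<xi>))\<^sup>2 / 2))))" for n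
    define R where "R n = (LINT s|lborel. u s * (LINT x|lborel. \<psi> (s + ?e n *\<^sub>R x) * of_real (exp (- (norm x)\<^sup>2 / 2))))" for n
    have LR: "L n = ?c * R n" for n
    proof -
      have "?c * R n = ?c * (LINT t|lborel. \<psi> t * (LINT s|lborel. u s * of_real ((1 / ?e n) ^ DIM('a) * exp (- (norm ((1 / ?e n) *\<^sub>R (t - s)))\<^sup>2 / 2))))"
        unfolding R_def using gauss_mollified_pairing[OF u _ _ K, of "?e n"] by simp
      also have "\<dots> = (LINT t|lborel. \<psi> t * (LINT s|lborel. u s * of_real (sqrt (2 * pi) ^ DIM('a) * (1 / ?e n) ^ DIM('a) * exp (- (norm ((1 / ?e n) *\<^sub>R (t - s)))\<^sup>2 / 2))))"
        unfolding integral_mult_right_zero[symmetric]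
        by (intro Bochner_Integration.integral_cong refl) (simp only: of_real_mult mult.left_commute integral_mult_right_zero[symmetric] mult.assoc)
      also have "\<dots> = L n"
        unfolding L_def using gauss_regularised_inversion[OF u, of "?e n"] by simp
      finally show ?thesis by simp
    qed
    have Lv: "L \<longlonglongrightarrow> (LINT t|lborel. \<psi> t * ?v t)"
      unfolding L_def
    proof (rule integral_dominated_convergence[where w="\<lambda>x. norm (\<psi> x) * (LINT \<xi>|lborel. norm (fourier u \<xi>))"])
      show "integrable lborel (\<lambda>x. norm (\<psi> x) * (LINT \<xi>|lborel. norm (fourier u \<xi>)))" using i by simp
      have "(\<lambda>n. LINT \<xi>|lborel. fourier u \<xi> * cis (\<xi> \<bullet> t) * of_real (exp (- (norm (?e n *\<^sub>R \<xi>))\<^sup>2 / 2))) \<longlonglongrightarrow> ?v t" for t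
      proof (rule integral_dominated_convergence[where w="\<lambda>\<xi>. norm (fourier u \<xi>)"])
        show "integrable lborel (\<lambda>\<xi>. norm (fourier u \<xi>))" using fu by simp
        have "(\<lambda>n. fourier u \<xi> * cis (\<xi> \<bullet> t) * of_real (exp (- (norm (?e n *\<^sub>R \<xi>))\<^sup>2 / 2))) \<longlonglongrightarrow>
            fourier u \<xi> * cis (\<xi> \<bullet> t) * of_real (exp (- (norm (0 *\<^sub>R \<xi>))\<^sup>2 / 2))" for \<xi>
          by (intro tendsto_intros e0) auto
        then show "AE \<xi> in lborel. (\<lambda>n. fourier u \<xi> * cis (\<xi> \<bullet> t) * of_real (exp (- (norm (?e n *\<^sub>R \<xi>))\<^sup>2 / 2))) \<longlonglongrightarrow> fourier u \<xi> * cis (\<xi> \<bullet> t)"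
          by simp
        show "AE \<xi> in lborel. norm (fourier u \<xi> * cis (\<xi> \<bullet> t) * of_real (exp (- (norm (?e n *\<^sub>R \<xi>))\<^sup>2 / 2))) \<le> norm (fourier u \<xi>)" for n
          by (auto intro!: AE_I2 mult_left_le simp: norm_mult)
      qed measurable
      then show "AE t in lborel. (\<lambda>n. \<psi> t * (LINT \<xi>|lborel. fourier u \<xi> * cis (\<xi> \<bullet> t) * of_real (exp (- (norm (?e n *\<^sub>R \<xi>))\<^sup>2 / 2)))) \<longlonglongrightarrow> \<psi> t * ?v t"
        by (intro AE_I2 tendsto_mult tendsto_const)
      have "norm (LINT \<xi>|lborel. fourier u \<xi> * cis (\<xi> \<bullet> t) * of_real (exp (- (norm (?e n *\<^sub>R \<xi>))\<^sup>2 / 2))) \<le> (LINT \<xi>|lborel. norm (fourier u \<xi>))" for n t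
        using fu by (intro norm_integral_le) (auto intro!: mult_left_le simp: norm_mult)
      then show "AE t in lborel. norm (\<psi> t * (LINT \<xi>|lborel. fourier u \<xi> * cis (\<xi> \<bullet> t) * of_real (exp (- (norm (?e n *\<^sub>R \<xi>))\<^sup>2 / 2))))
          \<le> norm (\<psi> t) * (LINT \<xi>|lborel. norm (fourier u \<xi>))" for n
        by (intro AE_I2) (simp only: norm_mult mult_left_mono norm_ge_zero)
    qed measurable
    have Ru: "R \<longlonglongrightarrow> (LINT s|lborel. u s * (\<psi> s * ?c))"
      unfolding R_def
    proof (rule integral_dominated_convergence[where w="\<lambda>s. norm (u s) * (LINT x|lborel. K * exp (- (norm (x::'a))\<^sup>2 / 2))"])
      show "integrable lborel (\<lambda>s. norm (u s) * (LINT x|lborel. K * exp (- (norm (x::'a))\<^sup>2 / 2)))" using u by simp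
      have b: "norm (\<psi> (s + ?e n *\<^sub>R x) * of_real (exp (- (norm x)\<^sup>2 / 2))) \<le> K * exp (- (norm x)\<^sup>2 / 2)" for s n x
        using K by (simp add: norm_mult mult_right_mono)
      have iK: "integrable lborel (\<lambda>x::'a. K * exp (- (norm x)\<^sup>2 / 2))" by (intro integrable_mult_right integrable_std_gauss)
      have lim: "(\<lambda>n. \<psi> (s + ?e n *\<^sub>R x)) \<longlonglongrightarrow> \<psi> s" for s x
      proof -
        have "(\<lambda>n. s + ?e n *\<^sub>R x) \<longlonglongrightarrow> s + 0 *\<^sub>R x" by (intro tendsto_intros e0)
        then show ?thesis using c by (auto simp: continuous_on_eq_continuous_at intro: continuous_at_imp_continuous_within isCont_tendsto_compose)
      qed
      have "(\<lambda>n. LINT x|lborel. \<psi> (s + ?e n *\<^sub>R x) * of_real (exp (- (norm x)\<^sup>2 / 2))) \<longlonglongrightarrow>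
          (LINT x|lborel. \<psi> s * complex_of_real (exp (- (norm (x::'a))\<^sup>2 / 2)))" for s
      proof (rule integral_dominated_convergence[OF _ _ iK])
        show "AE x in lborel. (\<lambda>n. \<psi> (s + ?e n *\<^sub>R x) * of_real (exp (- (norm x)\<^sup>2 / 2))) \<longlonglongrightarrow> \<psi> s * of_real (exp (- (norm x)\<^sup>2 / 2))"
          by (intro AE_I2 tendsto_mult lim tendsto_const)
        show "AE x in lborel. norm (\<psi> (s + ?e n *\<^sub>R x) * of_real (exp (- (norm x)\<^sup>2 / 2))) \<le> K * exp (- (norm x)\<^sup>2 / 2)" for n
          by (intro AE_I2 b)
      qed measurable
      moreover have "(LINT x|lborel. \<psi> s * complex_of_real (exp (- (norm (x::'a))\<^sup>2 / 2))) = \<psi> s * ?c" for s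
        using fourier_std_gauss[of "0::'a"] by simp
      ultimately show "AE s in lborel. (\<lambda>n. u s * (LINT x|lborel. \<psi> (s + ?e n *\<^sub>R x) * of_real (exp (- (norm x)\<^sup>2 / 2)))) \<longlonglongrightarrow> u s * (\<psi> s * ?c)"
        by (intro AE_I2 tendsto_mult tendsto_const) (simp only:)
      have "norm (LINT x|lborel. \<psi> (s + ?e n *\<^sub>R x) * of_real (exp (- (norm x)\<^sup>2 / 2))) \<le> (LINT x|lborel. K * exp (- (norm (x::'a))\<^sup>2 / 2))" for n s
        by (rule norm_integral_le[OF iK b])
      then show "AE s in lborel. norm (u s * (LINT x|lborel. \<psi> (s + ?e n *\<^sub>R x) * of_real (exp (- (norm x)\<^sup>2 / 2)))) \<le> norm (u s) * (LINT x|lborel. K * exp (- (norm (x::'a))\<^sup>2 / 2))" for n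
        by (intro AE_I2) (simp only: norm_mult mult_left_mono norm_ge_zero)
    qed measurable
    have "L \<longlonglongrightarrow> ?c * (LINT s|lborel. u s * (\<psi> s * ?c))"
      unfolding LR[THEN ext] by (rule tendsto_mult_left[OF Ru])
    then have "(LINT t|lborel. \<psi> t * ?v t) = ?c * (LINT s|lborel. u s * (\<psi> s * ?c))"
      by (rule LIMSEQ_unique[OF Lv])
    also have "\<dots> = (LINT s|lborel. \<psi> s * (of_real ((2 * pi) ^ DIM('a)) * u s))"
    proof -
      \<comment> \<open>One factor \<open>?c\<close> comes from the transform of the Gaussian, the
        other is the total mass of the Gaussian.\<close>
      have "sqrt (2 * pi) ^ DIM('a) * sqrt (2 * pi) ^ DIM('a) = (2 * pi) ^ DIM('a)"
        by (subst power_mult_distrib[symmetric]) simp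
      then have c2: "?c * ?c = of_real ((2 * pi) ^ DIM('a))"
        by (simp only: of_real_mult[symmetric])
      have "?c * (u s * (\<psi> s * ?c)) = \<psi> s * ((?c * ?c) * u s)" for s
        by (simp only: mult_ac)
      then have "?c * (u s * (\<psi> s * ?c)) = \<psi> s * (of_real ((2 * pi) ^ DIM('a)) * u s)" for s
        by (simp only: c2)
      then show ?thesis by (simp only: integral_mult_right_zero[symmetric])
    qed
    finally have eq: "(LINT t|lborel. \<psi> t * ?v t) = (LINT s|lborel. \<psi> s * (of_real ((2 * pi) ^ DIM('a)) * u s))" .
    have iu': "integrable lborel (\<lambda>s. \<psi> s * (of_real ((2 * pi) ^ DIM('a)) * u s))"
      using integrable_mult_right[OF iu, of "of_real ((2 * pi) ^ DIM('a))"] by (simp only: mult.left_commute)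
    show "integrable lborel (\<lambda>t. \<psi> t * (of_real ((2 * pi) ^ DIM('a)) * u t - ?v t)) \<and>
      (LINT t|lborel. \<psi> t * (of_real ((2 * pi) ^ DIM('a)) * u t - ?v t)) = 0"
      using iu' iv unfolding right_diff_distrib by (simp only: Bochner_Integration.integral_diff Bochner_Integration.integrable_diff eq simp_thms diff_self)
  qed
  then show ?thesis by eventually_elim simp
qed

text \<open>An error that is quadratic in \<open>h\<close> with an integrable majorant can be
  integrated as it stands, leaving a remainder of order |h|^2. Convolutions and inverse Fourier
  integrals are both differentiated this way.\<close>

lemma has_derivative_integral_quadratic:
  fixes f :: "'a::euclidean_space \<Rightarrow> 'm \<Rightarrow> complex"
  assumes f: "\<And>x. integrable M (f x)" and f': "\<And>h. integrable M (f' h)"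
    and lin: "\<And>y. linear (\<lambda>h. f' h y)"
    and G: "integrable M G"
    and err: "\<And>h y. norm (f (x + h) y - f x y - f' h y) \<le> (norm h)\<^sup>2 * G y"
  shows "((\<lambda>x. LINT y|M. f x y) has_derivative (\<lambda>h. LINT y|M. f' h y)) (at x)"
proof (rule has_derivativeI_sandwich[where e=1 and H="\<lambda>y. norm (y - x) * integral\<^sup>L M G"])
  have "linear (\<lambda>h. LINT y|M. f' h y)"
    using f' by (intro linearI) (simp_all add: linear_add[OF lin] linear_scale[OF lin])
  then show "bounded_linear (\<lambda>h. LINT y|M. f' h y)" by (simp add: linear_conv_bounded_linear)
  fix z assume "z \<noteq> x"
  let ?h = "z - x"
  have "norm ((LINT y|M. f z y) - (LINT y|M. f x y) - (LINT y|M. f' ?h y)) = norm (LINT y|M. f z y - f x y - f' ?h y)"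
    using f f' by simp
  also have "\<dots> \<le> (LINT y|M. (norm ?h)\<^sup>2 * G y)"
    using err[of ?h] G by (intro norm_integral_le) auto
  also have "\<dots> = (norm ?h)\<^sup>2 * integral\<^sup>L M G" by simp
  finally show "norm ((LINT y|M. f z y) - (LINT y|M. f x y) - (LINT y|M. f' ?h y)) / norm ?h \<le> norm ?h * integral\<^sup>L M G"
    using \<open>z \<noteq> x\<close> by (simp add: divide_simps power2_eq_square mult_ac)
next
  show "((\<lambda>y. norm (y - x) * integral\<^sup>L M G) \<longlongrightarrow> 0) (at x)"
    by (rule tendsto_eq_intros refl | simp)+
qed simp

subsection \<open>Convolution with tempered distributions\<close>

text \<open>Mean value inequality on the segment from x - y to x - z. A point p on it satisfies |x|
  <= |p| + |y| + |z|, so the weight at x costs a factor (1 + |y| + |z|)^k against the weight at p,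
  which the decay of the derivatives at p controls.\<close>

lemma schwartz_translate_diff_bound:
  fixes f :: "'a::euclidean_space \<Rightarrow> complex"
  assumes f: "f \<in> schwartz"
  shows "\<exists>C\<ge>0. \<forall>x y z. (1 + norm x) ^ k * norm (f (x - y) - f (x - z)) \<le> C * norm (y - z) * (1 + norm y + norm z) ^ k"
proof -
  have "\<forall>b\<in>Basis. \<exists>C. \<forall>x. (1 + norm x) ^ k * norm (pd b f x) \<le> C"
    using schwartz_decay[OF schwartz_pd[OF f]] by metis
  then obtain C where C: "\<And>b x. b \<in> Basis \<Longrightarrow> (1 + norm x) ^ k * norm (pd b f x) \<le> C b" by metis
  define K where "K = (\<Sum>b\<in>Basis. C b)"
  have C0: "0 \<le> C b" if "b \<in> Basis" for b
    by (rule order_trans[OF _ C[OF that, of 0]]) auto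
  have "(1 + norm x) ^ k * norm (f (x - y) - f (x - z)) \<le> K * norm (y - z) * (1 + norm y + norm z) ^ k" for x y z
  proof -
    \<comment> \<open>The bound on the derivative must be uniform along the segment, so the weight
      at \<open>x\<close>, which does not vary with the point, goes into the denominator.\<close>
    define B where "B = (1 + norm y + norm z) ^ k * K / (1 + norm x) ^ k"
    have x0: "0 < (1 + norm x) ^ k" by (simp add: add_pos_nonneg)
    have "norm (f (x - y) - f (x - z)) \<le> B * norm ((x - y) - (x - z))"
    proof (rule differentiable_bound[where S="closed_segment (x - y) (x - z)"])
      fix p assume p: "p \<in> closed_segment (x - y) (x - z)"
      show "(f has_derivative (\<lambda>h. \<Sum>b\<in>Basis. (h \<bullet> b) *\<^sub>R pd b f p)) (at p within closed_segment (x - y) (x - z))"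
        by (rule has_derivative_at_withinI[OF schwartz_has_derivative[OF f]])
      obtain t where t: "0 \<le> t" "t \<le> 1" "p = (1 - t) *\<^sub>R (x - y) + t *\<^sub>R (x - z)"
        using p by (auto simp: in_segment)
      have q: "x - p = (1 - t) *\<^sub>R y + t *\<^sub>R z" by (simp add: t(3) algebra_simps)
      have "norm (x - p) \<le> norm ((1 - t) *\<^sub>R y) + norm (t *\<^sub>R z)" unfolding q by (rule norm_triangle_ineq)
      also have "\<dots> \<le> norm y + norm z" using t by (intro add_mono) (auto intro!: mult_left_le_one_le)
      finally have q': "norm (x - p) \<le> norm y + norm z" .
      have "norm x \<le> norm p + norm (x - p)" by (metis add.commute diff_add_cancel norm_triangle_ineq)
      then have "1 + norm x \<le> (1 + norm p) + (norm y + norm z)" using q' by simp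
      also have "\<dots> \<le> (1 + norm y + norm z) * (1 + norm p)"
        by (simp add: algebra_simps add_increasing2)
      finally have "(1 + norm x) ^ k \<le> ((1 + norm y + norm z) * (1 + norm p)) ^ k" by (intro power_mono) auto
      then have xp: "(1 + norm x) ^ k \<le> (1 + norm y + norm z) ^ k * (1 + norm p) ^ k" by (simp add: power_mult_distrib)
      have "(1 + norm x) ^ k * (\<Sum>b\<in>Basis. norm (pd b f p)) \<le> ((1 + norm y + norm z) ^ k * (1 + norm p) ^ k) * (\<Sum>b\<in>Basis. norm (pd b f p))"
        by (intro mult_right_mono xp sum_nonneg) auto
      also have "\<dots> = (1 + norm y + norm z) ^ k * (\<Sum>b\<in>Basis. (1 + norm p) ^ k * norm (pd b f p))"
        by (simp add: sum_distrib_left mult.assoc)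
      also have "\<dots> \<le> (1 + norm y + norm z) ^ k * K"
        unfolding K_def by (intro mult_left_mono sum_mono C) auto
      finally have b: "(\<Sum>b\<in>Basis. norm (pd b f p)) \<le> B" using x0 by (simp add: B_def field_simps)
      show "onorm (\<lambda>h. \<Sum>b\<in>Basis. (h \<bullet> b) *\<^sub>R pd b f p) \<le> B"
      proof (rule onorm_bound)
        fix h
        have "norm (\<Sum>b\<in>Basis. (h \<bullet> b) *\<^sub>R pd b f p) \<le> (\<Sum>b\<in>Basis. norm h * norm (pd b f p))"
          by (intro sum_norm_le) (auto intro!: mult_right_mono Basis_le_norm)
        also have "\<dots> \<le> B * norm h" using mult_left_mono[OF b, of "norm h"] by (simp add: sum_distrib_left mult.commute)
        finally show "norm (\<Sum>b\<in>Basis. (h \<bullet> b) *\<^sub>R pd b f p) \<le> B * norm h" .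
      qed (rule order_trans[OF sum_nonneg b], simp)
    qed auto
    then have "(1 + norm x) ^ k * norm (f (x - y) - f (x - z)) \<le> (1 + norm x) ^ k * (B * norm (z - y))"
      using x0 by (intro mult_left_mono) auto
    also have "\<dots> = K * norm (y - z) * (1 + norm y + norm z) ^ k"
    proof -
      have "1 + norm x \<noteq> 0" using norm_ge_zero[of x] by linarith
      then show ?thesis by (simp add: B_def norm_minus_commute)
    qed
    finally show ?thesis .
  qed
  moreover have "0 \<le> K" unfolding K_def by (intro sum_nonneg C0)
  ultimately show ?thesis by blast
qed

text \<open>By the previous estimate with k = 0 the partial derivatives are Lipschitz on the whole
  space, so the derivative varies by at most a multiple of |h| on the ball of radius |h|.\<close>

lemma schwartz_quadratic_error:
  fixes f :: "'a::euclidean_space \<Rightarrow> complex"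
  assumes f: "f \<in> schwartz"
  shows "\<exists>K\<ge>0. \<forall>p h. norm (f (p + h) - f p - (\<Sum>b\<in>Basis. (h \<bullet> b) *\<^sub>R pd b f p)) \<le> K * (norm h)\<^sup>2"
proof -
  have "\<forall>b\<in>Basis. \<exists>C\<ge>0. \<forall>x y. norm (pd b f x - pd b f y) \<le> C * norm (x - y)"
  proof
    fix b :: 'a assume "b \<in> Basis"
    then obtain C where C: "C \<ge> 0" "\<And>x y z. norm (pd b f (x - y) - pd b f (x - z)) \<le> C * norm (y - z)"
      using schwartz_translate_diff_bound[OF schwartz_pd[OF f], of b 0] by auto
    have "norm (pd b f x - pd b f y) \<le> C * norm (x - y)" for x y
      using C(2)[of 0 "-x" "-y"] by (simp add: norm_minus_commute)
    with C(1) show "\<exists>C\<ge>0. \<forall>x y. norm (pd b f x - pd b f y) \<le> C * norm (x - y)" by blast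
  qed
  then obtain C where C: "\<And>b. b \<in> Basis \<Longrightarrow> C b \<ge> 0" "\<And>b x y. b \<in> Basis \<Longrightarrow> norm (pd b f x - pd b f y) \<le> C b * norm (x - y)"
    by metis
  define K where "K = (\<Sum>b\<in>Basis. C b)"
  have K: "K \<ge> 0" unfolding K_def by (intro sum_nonneg C)
  have "norm (f (p + h) - f p - (\<Sum>b\<in>Basis. (h \<bullet> b) *\<^sub>R pd b f p)) \<le> K * (norm h)\<^sup>2" for p h
  proof -
    let ?D = "\<lambda>x h. \<Sum>b\<in>Basis. (h \<bullet> b) *\<^sub>R pd b f x"
    have "norm (f (p + h) - f p - ?D p ((p + h) - p)) \<le> norm ((p + h) - p) * (K * norm h)"
    proof (rule differentiable_bound_linearization[where S="cball p (norm h)"])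
      show "p + t *\<^sub>R (p + h - p) \<in> cball p (norm h)" if "t \<in> {0..1}" for t
        using that by (auto simp: dist_norm intro!: mult_left_le_one_le)
      show "(f has_derivative ?D x) (at x within cball p (norm h))" for x
        by (rule has_derivative_at_withinI[OF schwartz_has_derivative[OF f]])
      fix x assume "x \<in> cball p (norm h)"
      then have x: "norm (x - p) \<le> norm h" by (simp add: dist_norm norm_minus_commute)
      show "onorm (?D x - ?D p) \<le> K * norm h"
      proof (rule onorm_bound)
        fix v
        have "(?D x - ?D p) v = (\<Sum>b\<in>Basis. (v \<bullet> b) *\<^sub>R (pd b f x - pd b f p))"
          by (simp add: scaleR_diff_right sum_subtractf)
        also have "norm \<dots> \<le> (\<Sum>b\<in>Basis. norm v * (C b * norm h))"
          using x by (intro sum_norm_le) (auto intro!: mult_mono Basis_le_norm order_trans[OF C(2)] mult_left_mono C(1))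
        also have "\<dots> = K * norm h * norm v" by (simp add: K_def sum_distrib_left sum_distrib_right mult_ac)
        finally show "norm ((?D x - ?D p) v) \<le> K * norm h * norm v" .
      qed (use K in simp)
    qed simp
    then show ?thesis by (simp add: power2_eq_square mult_ac)
  qed
  with K show ?thesis by blast
qed

section \<open>Tempered distributions applied to translates\<close>

lemma tempered_add: "u \<in> tempered \<Longrightarrow> f \<in> schwartz \<Longrightarrow> g \<in> schwartz \<Longrightarrow> u (\<lambda>x. f x + g x) = u f + u g"
  by (simp add: tempered_def)

lemma tempered_cmult: "u \<in> tempered \<Longrightarrow> f \<in> schwartz \<Longrightarrow> u (\<lambda>x. c * f x) = c * u f"
  by (simp add: tempered_def)

lemma tempered_diff: "u \<in> tempered \<Longrightarrow> f \<in> schwartz \<Longrightarrow> g \<in> schwartz \<Longrightarrow> u (\<lambda>x. f x - g x) = u f - u g"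
  using tempered_add[of u f "\<lambda>x. -1 * g x"] tempered_cmult[of u g "-1"] schwartz_cmult[of g "-1"] by simp

lemma tempered_bound:
  assumes "u \<in> tempered"
  obtains N C where "C \<ge> 0" "\<And>f. f \<in> schwartz \<Longrightarrow> norm (u f) \<le> C * schwartz_norm N f"
proof -
  obtain N C where C: "\<And>f. f \<in> schwartz \<Longrightarrow> norm (u f) \<le> C * schwartz_norm N f"
    using assms unfolding tempered_def by blast
  have "norm (u f) \<le> \<bar>C\<bar> * schwartz_norm N f" if "f \<in> schwartz" for f
    by (rule order_trans[OF C[OF that]]) (intro mult_right_mono schwartz_norm_nonneg that abs_ge_self)
  then show ?thesis using that[of "\<bar>C\<bar>" N] by simp
qed

lemma tempered_sum:
  assumes "u \<in> tempered" "finite I" "\<And>i. i \<in> I \<Longrightarrow> f i \<in> schwartz"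
  shows "u (\<lambda>x. \<Sum>i\<in>I. c i * f i x) = (\<Sum>i\<in>I. c i * u (f i))"
  using assms(2,3)
proof (induction I rule: finite_induct)
  case empty
  show ?case using tempered_cmult[OF assms(1) schwartz_zero, of 0] by simp
next
  case (insert i I)
  then show ?case
    by (simp add: tempered_add[OF assms(1)] tempered_cmult[OF assms(1)] schwartz_cmult schwartz_sum)
qed

text \<open>One estimate for two purposes: it gives continuity in the translation parameter and,
  with z = 0, polynomial growth. Together these make the function y -> u (f (\<cdot> - y))
  integrable against Schwartz functions.\<close>

lemma tempered_translate_diff:
  fixes u :: "('a::euclidean_space \<Rightarrow> complex) \<Rightarrow> complex"
  assumes u: "u \<in> tempered" and f: "f \<in> schwartz"
  shows "\<exists>C M. C \<ge> 0 \<and> (\<forall>y z. norm (u (\<lambda>x. f (x - y)) - u (\<lambda>x. f (x - z))) \<le> C * norm (y - z) * (1 + norm y + norm z) ^ M)"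
proof -
  obtain N C where C: "C \<ge> 0" "\<And>f. f \<in> schwartz \<Longrightarrow> norm (u f) \<le> C * schwartz_norm N f"
    using tempered_bound[OF u] by metis
  let ?L = "{bs. set bs \<subseteq> (Basis :: 'a set) \<and> length bs \<le> N}"
  have "\<forall>bs\<in>?L. \<exists>D\<ge>0. \<forall>x y z. (1 + norm x) ^ N * norm (iter_pd bs f (x - y) - iter_pd bs f (x - z)) \<le> D * norm (y - z) * (1 + norm y + norm z) ^ N"
    using schwartz_translate_diff_bound[OF schwartz_iter_pd[OF f]] by auto
  from bchoice[OF this] obtain D where D: "\<And>bs. bs \<in> ?L \<Longrightarrow> D bs \<ge> 0"
    "\<And>bs x y z. bs \<in> ?L \<Longrightarrow> (1 + norm x) ^ N * norm (iter_pd bs f (x - y) - iter_pd bs f (x - z)) \<le> D bs * norm (y - z) * (1 + norm y + norm z) ^ N"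
    by blast
  have "norm (u (\<lambda>x. f (x - y)) - u (\<lambda>x. f (x - z))) \<le> (C * (\<Sum>bs\<in>?L. D bs)) * norm (y - z) * (1 + norm y + norm z) ^ N" for y z
  proof -
    have t: "(\<lambda>x. f (x - y)) \<in> schwartz" for y by (rule schwartz_translate[OF f])
    have "schwartz_norm N (\<lambda>x. f (x - y) - f (x - z)) \<le> (\<Sum>bs\<in>?L. D bs * norm (y - z) * (1 + norm y + norm z) ^ N)"
      by (rule schwartz_norm_le) (use D(2) in \<open>auto simp: iter_pd_diff[OF t t] iter_pd_translate[OF f]\<close>)
    then have "norm (u (\<lambda>x. f (x - y) - f (x - z))) \<le> C * (\<Sum>bs\<in>?L. D bs * norm (y - z) * (1 + norm y + norm z) ^ N)"
      using C(2)[OF schwartz_diff[OF t t]] mult_left_mono[OF _ C(1)] order_trans by blast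
    then show ?thesis by (simp add: tempered_diff[OF u t t] sum_distrib_right mult_ac sum_distrib_left)
  qed
  moreover have "0 \<le> C * (\<Sum>bs\<in>?L. D bs)" using C D by (intro mult_nonneg_nonneg sum_nonneg) auto
  ultimately show ?thesis by blast
qed

lemma tempered_translate_continuous:
  assumes u: "u \<in> tempered" and f: "f \<in> schwartz"
  shows "continuous_on UNIV (\<lambda>y. u (\<lambda>x. f (x - y)))"
proof -
  obtain C M where C: "C \<ge> 0" "\<And>y z. norm (u (\<lambda>x. f (x - y)) - u (\<lambda>x. f (x - z))) \<le> C * norm (y - z) * (1 + norm y + norm z) ^ M"
    using tempered_translate_diff[OF assms] by blast
  have "((\<lambda>y. u (\<lambda>x. f (x - y))) \<longlongrightarrow> u (\<lambda>x. f (x - z))) (at z)" for z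
  proof (rule Lim_transform_bound[THEN LIM_zero_cancel])
    show "\<forall>\<^sub>F y in at z. norm (u (\<lambda>x. f (x - y)) - u (\<lambda>x. f (x - z))) \<le> norm (C * norm (y - z) * (1 + norm y + norm z) ^ M)"
      using C(2) by (intro always_eventually allI order_trans[OF C(2)]) simp
    show "((\<lambda>y. C * norm (y - z) * (1 + norm y + norm z) ^ M) \<longlongrightarrow> 0) (at z)"
      by (rule tendsto_eq_intros refl | simp)+
  qed
  then show ?thesis by (simp add: continuous_on_def)
qed

lemma tempered_translate_growth:
  assumes u: "u \<in> tempered" and f: "f \<in> schwartz"
  shows "\<exists>C M. C \<ge> 0 \<and> (\<forall>y. norm (u (\<lambda>x. f (x - y))) \<le> C * (1 + norm y) ^ M)"
proof -
  obtain C M where C: "C \<ge> 0" "\<And>y z. norm (u (\<lambda>x. f (x - y)) - u (\<lambda>x. f (x - z))) \<le> C * norm (y - z) * (1 + norm y + norm z) ^ M"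
    using tempered_translate_diff[OF assms] by blast
  have "norm (u (\<lambda>x. f (x - y))) \<le> (C + norm (u f)) * (1 + norm y) ^ Suc M" for y
  proof -
    have "norm (u (\<lambda>x. f (x - y))) \<le> norm (u (\<lambda>x. f (x - y)) - u f) + norm (u f)"
      by (metis diff_add_cancel norm_triangle_ineq)
    also have "\<dots> \<le> C * norm y * (1 + norm y) ^ M + norm (u f)" using C(2)[of y 0] by simp
    also have "\<dots> \<le> C * ((1 + norm y) * (1 + norm y) ^ M) + norm (u f) * (1 + norm y) ^ Suc M"
      unfolding mult.assoc using C(1)
      by (intro add_mono mult_left_mono mult_right_mono) (auto simp del: power_Suc simp: mult_le_cancel_left1)
    finally show ?thesis by (simp add: algebra_simps)
  qed
  moreover have "0 \<le> C + norm (u f)" using C(1) by simp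
  ultimately show ?thesis by blast
qed

lemma integrable_growth_mult_schwartz:
  assumes "\<psi> \<in> schwartz" "\<theta> \<in> borel_measurable borel" "\<And>x. norm (\<theta> x) \<le> C * (1 + norm x) ^ M"
  shows "integrable lborel (\<lambda>x. \<theta> x * \<psi> x)"
proof (rule Bochner_Integration.integrable_bound)
  show "integrable lborel (\<lambda>x. C * ((1 + norm x) ^ M * norm (\<psi> x)))"
    by (intro integrable_mult_right integrable_schwartz_weighted assms)
  show "(\<lambda>x. \<theta> x * \<psi> x) \<in> borel_measurable lborel"
    using assms(2) schwartz_measurable[OF assms(1)] by simp
  show "AE x in lborel. norm (\<theta> x * \<psi> x) \<le> norm (C * ((1 + norm x) ^ M * norm (\<psi> x)))"
    unfolding norm_mult[of "\<theta> _"] 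
    by (intro AE_I2 order_trans[OF mult_right_mono[OF assms(3)]]) (auto simp: mult.assoc)
qed

text \<open>In the order \<open>M + 2 * DIM('a)\<close>, the part \<open>M\<close> compensates the
  growth of \<theta> and the rest makes the remaining weight integrable.\<close>

lemma tempered_of_function:
  fixes \<theta> :: "'a::euclidean_space \<Rightarrow> complex"
  assumes m: "\<theta> \<in> borel_measurable borel" and C: "\<And>x. norm (\<theta> x) \<le> C * (1 + norm x) ^ M"
  shows "(\<lambda>\<psi>\<in>schwartz. LINT x|lborel. \<theta> x * \<psi> x) \<in> tempered"
proof -
  note i = integrable_growth_mult_schwartz[OF _ m C]
  have C0: "C \<ge> 0" by (rule order_trans[OF norm_ge_zero]) (use C[of 0] in simp)
  let ?I = "LINT x|lborel. inverse ((1 + norm (x::'a)) ^ (2 * DIM('a)))"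
  have "norm (LINT x|lborel. \<theta> x * \<psi> x) \<le> (C * ?I) * schwartz_norm (M + 2 * DIM('a)) \<psi>" if \<psi>: "\<psi> \<in> schwartz" for \<psi>
  proof -
    have "norm (LINT x|lborel. \<theta> x * \<psi> x) \<le> (LINT x::'a|lborel. (C * schwartz_norm (M + 2 * DIM('a)) \<psi>) * inverse ((1 + norm x) ^ (2 * DIM('a))))"
    proof (rule norm_integral_le)
      show "integrable lborel (\<lambda>x::'a. (C * schwartz_norm (M + 2 * DIM('a)) \<psi>) * inverse ((1 + norm x) ^ (2 * DIM('a))))"
        by (intro integrable_mult_right integrable_inverse_one_plus_norm_power) simp
      fix x
      have "norm (\<theta> x * \<psi> x) \<le> C * ((1 + norm x) ^ M * norm (\<psi> x))"
        unfolding norm_mult mult.assoc[symmetric] by (intro mult_right_mono C) simp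
      also have "\<dots> \<le> C * (schwartz_norm (M + 2 * DIM('a)) \<psi> * inverse ((1 + norm x) ^ (2 * DIM('a))))"
        using schwartz_norm_upper[OF \<psi>, of "[]" "M + 2 * DIM('a)" "M + 2 * DIM('a)" x]
        by (intro mult_left_mono C0 norm_le_of_weighted) simp
      finally show "norm (\<theta> x * \<psi> x) \<le> (C * schwartz_norm (M + 2 * DIM('a)) \<psi>) * inverse ((1 + norm x) ^ (2 * DIM('a)))"
        by (simp add: mult.assoc)
    qed
    then show ?thesis by (simp add: mult_ac)
  qed
  then show ?thesis
    unfolding tempered_def
    by (auto simp: schwartz_add schwartz_cmult distrib_left i mult.left_commute[of "\<theta> _"] simp del: mult.assoc)
qed

lemma conv_tempered:
  assumes "a \<in> tempered" "\<Phi> \<in> schwartz"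
  shows "conv a \<Phi> \<in> tempered"
proof -
  \<comment> \<open>As a function of y, \<Phi> (x - y) is the translate by x of the reflected
    \<Phi>, so the estimates for translates apply.\<close>
  have R: "(\<lambda>y. \<Phi> (- y)) \<in> schwartz" using schwartz_affine[OF assms(2), of "-1" 0] by simp
  have eq: "(\<lambda>x. a (\<lambda>y. \<Phi> (x - y))) = (\<lambda>x. a (\<lambda>y. (\<lambda>y. \<Phi> (- y)) (y - x)))" by simp
  obtain C M where "\<And>x. norm (a (\<lambda>y. \<Phi> (x - y))) \<le> C * (1 + norm x) ^ M"
    using tempered_translate_growth[OF assms(1) R] by auto
  moreover have "(\<lambda>x. a (\<lambda>y. \<Phi> (x - y))) \<in> borel_measurable borel"
    unfolding eq by (rule borel_measurable_continuous_onI[OF tempered_translate_continuous[OF assms(1) R]])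
  ultimately show ?thesis
    unfolding conv_def by (intro tempered_of_function)
qed

section \<open>Convolution of Schwartz functions\<close>

definition sconv :: "('a::euclidean_space \<Rightarrow> complex) \<Rightarrow> ('a \<Rightarrow> complex) \<Rightarrow> 'a \<Rightarrow> complex" where
  "sconv \<eta> \<Phi> x = (LINT y|lborel. \<eta> y * \<Phi> (x - y))"

lemma integrable_schwartz_mult_bounded:
  assumes "\<eta> \<in> schwartz" "g \<in> borel_measurable borel" "\<And>y. norm (g y) \<le> C"
  shows "integrable lborel (\<lambda>y. \<eta> y * g y)"
  using integrable_growth_mult_schwartz[OF assms(1,2), of C 0] assms(3) by (simp add: mult.commute)

lemma integrable_sconv:
  assumes "\<eta> \<in> schwartz" "\<Phi> \<in> schwartz" "s \<in> borel_measurable borel"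
  shows "integrable lborel (\<lambda>y. \<eta> y * \<Phi> (x - s y))"
proof -
  obtain C where "\<And>x. norm (\<Phi> x) \<le> C" using schwartz_bounded[OF assms(2)] by blast
  moreover note schwartz_measurable[OF assms(2), measurable] assms(3)[measurable]
  ultimately show ?thesis by (intro integrable_schwartz_mult_bounded assms(1)) auto
qed

lemma sconv_commute: "sconv \<eta> \<Phi> = sconv \<Phi> \<eta>"
proof
  fix x
  show "sconv \<eta> \<Phi> x = sconv \<Phi> \<eta> x"
    using lborel_integral_reflect[of "\<lambda>y. \<eta> y * \<Phi> (x - y)" x] by (simp add: sconv_def mult.commute)
qed

lemma sconv_has_derivative:
  assumes \<eta>: "\<eta> \<in> schwartz" and \<Phi>: "\<Phi> \<in> schwartz"
  shows "(sconv \<eta> \<Phi> has_derivative (\<lambda>h. \<Sum>b\<in>Basis. (h \<bullet> b) *\<^sub>R sconv \<eta> (pd b \<Phi>) x)) (at x)"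
proof -
  obtain K where K: "K \<ge> 0" "\<And>p h. norm (\<Phi> (p + h) - \<Phi> p - (\<Sum>b\<in>Basis. (h \<bullet> b) *\<^sub>R pd b \<Phi> p)) \<le> K * (norm h)\<^sup>2"
    using schwartz_quadratic_error[OF \<Phi>] by blast
  let ?f' = "\<lambda>h y. \<Sum>b\<in>Basis. (h \<bullet> b) *\<^sub>R (\<eta> y * pd b \<Phi> (x - y))"
  have i: "integrable lborel (\<lambda>y. \<eta> y * pd b \<Phi> (x - y))" if "b \<in> Basis" for b
    by (rule integrable_sconv[OF \<eta> schwartz_pd[OF \<Phi> that]]) simp
  have "((\<lambda>x. LINT y|lborel. \<eta> y * \<Phi> (x - y)) has_derivative (\<lambda>h. LINT y|lborel. ?f' h y)) (at x)"
  proof (rule has_derivative_integral_quadratic)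
    show "integrable lborel (\<lambda>y. \<eta> y * \<Phi> (x - y))" for x
      by (rule integrable_sconv[OF \<eta> \<Phi>]) simp
    show "integrable lborel (?f' h)" for h
      by (intro Bochner_Integration.integrable_sum integrable_scaleR_right i)
    show "linear (\<lambda>h. ?f' h y)" for y
      by (intro linearI) (simp_all add: inner_add_left scaleR_add_left sum.distrib scaleR_sum_right)
    show "integrable lborel (\<lambda>y. K * norm (\<eta> y))" using integrable_schwartz[OF \<eta>] by simp
    fix h y
    have "\<eta> y * \<Phi> (x + h - y) - \<eta> y * \<Phi> (x - y) - ?f' h y
      = \<eta> y * (\<Phi> ((x - y) + h) - \<Phi> (x - y) - (\<Sum>b\<in>Basis. (h \<bullet> b) *\<^sub>R pd b \<Phi> (x - y)))"
      by (simp add: right_diff_distrib sum_distrib_left add_diff_eq diff_add_eq)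
    also have "norm \<dots> \<le> norm (\<eta> y) * (K * (norm h)\<^sup>2)"
      unfolding norm_mult by (intro mult_left_mono K) auto
    finally show "norm (\<eta> y * \<Phi> (x + h - y) - \<eta> y * \<Phi> (x - y) - ?f' h y) \<le> (norm h)\<^sup>2 * (K * norm (\<eta> y))"
      by (simp add: mult_ac)
  qed
  moreover have "(LINT y|lborel. ?f' h y) = (\<Sum>b\<in>Basis. (h \<bullet> b) *\<^sub>R sconv \<eta> (pd b \<Phi>) x)" for h
    unfolding sconv_def using i by (subst Bochner_Integration.integral_sum) auto
  ultimately show ?thesis by (simp add: sconv_def[abs_def])
qed

lemma pd_sconv:
  assumes "\<eta> \<in> schwartz" "\<Phi> \<in> schwartz" "b \<in> Basis"
  shows "pd b (sconv \<eta> \<Phi>) = sconv \<eta> (pd b \<Phi>)"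
  using pd_eqI[OF sconv_has_derivative[OF assms(1,2)], of b] assms(3)
  by (simp add: inner_Basis if_distrib if_distribR sum.delta cong: if_cong)

text \<open>With \<eta> fixed, all derivatives fall on \<Phi>, so the convolutions with \<eta> form
  a closed family. Decay follows from 1 + |x| <= (1 + |x - y|) (1 + |y|), which splits the weight
  between the two factors.\<close>

lemma schwartz_sconv:
  assumes \<eta>: "\<eta> \<in> schwartz" and "\<Phi> \<in> schwartz"
  shows "sconv \<eta> \<Phi> \<in> schwartz"
proof -
  have "sconv \<eta> \<Phi> \<in> {sconv \<eta> \<Phi> | \<Phi>. \<Phi> \<in> schwartz}" using assms by blast
  then show ?thesis
  proof (induction rule: schwartz_coinduct)
    case (differentiable f x)
    then show ?case using sconv_has_derivative[OF \<eta>] unfolding differentiable_def by blast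
  next
    case (pd f b)
    then show ?case using pd_sconv[OF \<eta>] schwartz_pd by blast
  next
    case (decay f k)
    then obtain \<Phi> where f: "f = sconv \<eta> \<Phi>" "\<Phi> \<in> schwartz" by blast
    obtain C where C: "C > 0" "\<And>x. (1 + norm x) ^ k * norm (\<Phi> x) \<le> C" using schwartz_decay[OF f(2)] by metis
    have "(1 + norm x) ^ k * norm (f x) \<le> (LINT y|lborel. C * ((1 + norm y) ^ k * norm (\<eta> y)))" for x
    proof -
      have "(1 + norm x) ^ k * norm (f x) = norm (LINT y|lborel. (1 + norm x) ^ k *\<^sub>R (\<eta> y * \<Phi> (x - y)))"
        by (simp add: f sconv_def)
      also have "\<dots> \<le> (LINT y|lborel. C * ((1 + norm y) ^ k * norm (\<eta> y)))"
      proof (rule norm_integral_le)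
        show "integrable lborel (\<lambda>y. C * ((1 + norm y) ^ k * norm (\<eta> y)))"
          by (intro integrable_mult_right integrable_schwartz_weighted \<eta>)
        fix y
        have "norm x \<le> norm (x - y) + norm y" by (metis diff_add_cancel norm_triangle_ineq)
        then have "1 + norm x \<le> (1 + norm (x - y)) + norm y" by simp
        also have "\<dots> \<le> (1 + norm (x - y)) * (1 + norm y)"
          using mult_nonneg_nonneg[OF norm_ge_zero[of "x - y"] norm_ge_zero[of "y"]]
          unfolding distrib_left distrib_right mult_1_left mult_1_right by linarith
        finally have "(1 + norm x) ^ k \<le> ((1 + norm (x - y)) * (1 + norm y)) ^ k" by (intro power_mono) auto
        then have "(1 + norm x) ^ k * (norm (\<eta> y) * norm (\<Phi> (x - y))) \<le> ((1 + norm (x - y)) * (1 + norm y)) ^ k * (norm (\<eta> y) * norm (\<Phi> (x - y)))"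
          by (intro mult_right_mono) auto
        also have "\<dots> = ((1 + norm (x - y)) ^ k * norm (\<Phi> (x - y))) * ((1 + norm y) ^ k * norm (\<eta> y))"
          by (simp add: power_mult_distrib)
        also have "\<dots> \<le> C * ((1 + norm y) ^ k * norm (\<eta> y))"
          by (intro mult_right_mono C) auto
        finally show "norm ((1 + norm x) ^ k *\<^sub>R (\<eta> y * \<Phi> (x - y))) \<le> C * ((1 + norm y) ^ k * norm (\<eta> y))"
          by (simp add: norm_mult)
      qed
      finally show ?thesis .
    qed
    then show ?case by blast
  qed
qed

lemma iter_pd_sconv:
  assumes "\<eta> \<in> schwartz" "\<Phi> \<in> schwartz" "set bs \<subseteq> Basis"
  shows "iter_pd bs (sconv \<eta> \<Phi>) = sconv \<eta> (iter_pd bs \<Phi>)"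
  using assms(3)
proof (induction bs)
  case (Cons b bs)
  then have "iter_pd bs \<Phi> \<in> schwartz" using assms schwartz_iter_pd by auto
  then show ?case using Cons pd_sconv[OF assms(1), of "iter_pd bs \<Phi>" b] by (simp add: pd_def)
qed simp

text \<open>\<open>g\<close> may be arbitrary because only its values at the finitely many points of
  \<open>range s\<close> enter; the weights are the integrals of \<eta> over the level sets of
  \<open>s\<close>.\<close>

lemma integral_mult_simple_function:
  fixes \<eta> :: "'a::euclidean_space \<Rightarrow> complex"
  assumes s: "simple_function lborel s" and \<eta>: "integrable lborel \<eta>"
  shows "(LINT y|lborel. \<eta> y * g (s y)) = (\<Sum>v\<in>range s. (LINT y|lborel. indicator (s -` {v}) y *\<^sub>R \<eta> y) * g v)"
proof -
  have fin: "finite (range s)" using simple_functionD(1)[OF s] by simp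
  have i: "integrable lborel (\<lambda>y. indicator (s -` {v}) y *\<^sub>R \<eta> y)" for v
    using simple_functionD(2)[OF s, of "{v}"] by (intro integrable_mult_indicator \<eta>) simp
  have "\<eta> y * g (s y) = (\<Sum>v\<in>range s. (indicator (s -` {v}) y *\<^sub>R \<eta> y) * g v)" for y
  proof -
    have "(\<Sum>v\<in>range s. (indicator (s -` {v}) y *\<^sub>R \<eta> y) * g v) = (\<Sum>v\<in>range s. if v = s y then \<eta> y * g v else 0)"
      by (intro sum.cong) (auto simp: indicator_def)
    then show ?thesis using fin by simp
  qed
  then have "(LINT y|lborel. \<eta> y * g (s y)) = (LINT y|lborel. (\<Sum>v\<in>range s. (indicator (s -` {v}) y *\<^sub>R \<eta> y) * g v))"
    by (simp only:)
  also have "\<dots> = (\<Sum>v\<in>range s. LINT y|lborel. (indicator (s -` {v}) y *\<^sub>R \<eta> y) * g v)"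
    by (intro Bochner_Integration.integral_sum integrable_mult_left i)
  finally show ?thesis by (simp only: integral_mult_left_zero)
qed

text \<open>
  Replacing the identity map by simple functions turns the convolution into finite sums of
  translates, which converge in the Schwartz topology; hence a tempered distribution may be
  moved under the integral.
\<close>

lemma tempered_sconv:
  fixes u :: "('a::euclidean_space \<Rightarrow> complex) \<Rightarrow> complex"
  assumes u: "u \<in> tempered" and \<eta>: "\<eta> \<in> schwartz" and \<Phi>: "\<Phi> \<in> schwartz"
  shows "u (sconv \<eta> \<Phi>) = (LINT y|lborel. \<eta> y * u (\<lambda>x. \<Phi> (x - y)))"
proof -
  have "(\<lambda>x::'a. x) \<in> borel_measurable lborel" by simp
  \<comment> \<open>Besides pointwise convergence, the bound |s_i x| <= 2 |x| matters: it supplies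
    the integrable majorants in both limits below.\<close>
  from borel_measurable_implies_sequence_metric[OF this, of 0]
  obtain s :: "nat \<Rightarrow> 'a \<Rightarrow> 'a" where s: "\<And>i. simple_function lborel (s i)" "\<And>x. (\<lambda>i. s i x) \<longlonglongrightarrow> x"
    "\<And>i x. norm (s i x) \<le> 2 * norm x" by auto
  have [measurable]: "s i \<in> borel_measurable borel" for i
    using borel_measurable_simple_function[OF s(1)] by simp
  have [measurable]: "\<eta> \<in> borel_measurable borel" by (rule schwartz_measurable[OF \<eta>])
  define c where "c i v = (LINT y|lborel. indicator (s i -` {v}) y *\<^sub>R \<eta> y)" for i v
  define S where "S i x = (\<Sum>v\<in>range (s i). c i v * \<Phi> (x - v))" for i x
  have fin: "finite (range (s i))" for i using simple_functionD(1)[OF s(1)[of i]] by simp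
  have sum: "(\<Sum>v\<in>range (s i). c i v * g v) = (LINT y|lborel. \<eta> y * g (s i y))" for i g
    unfolding c_def by (rule integral_mult_simple_function[OF s(1) integrable_schwartz[OF \<eta>], symmetric])
  have T: "(\<lambda>x. \<Phi> (x - v)) \<in> schwartz" for v by (rule schwartz_translate[OF \<Phi>])
  have S: "S i \<in> schwartz" for i
    unfolding S_def by (intro schwartz_sum schwartz_cmult T)
  have "(\<lambda>i. u (S i)) \<longlonglongrightarrow> u (sconv \<eta> \<Phi>)"
  proof -
    obtain N C where C: "C \<ge> 0" "\<And>f. f \<in> schwartz \<Longrightarrow> norm (u f) \<le> C * schwartz_norm N f"
      using tempered_bound[OF u] by metis
    let ?L = "{bs. set bs \<subseteq> (Basis :: 'a set) \<and> length bs \<le> N}"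
    have "\<forall>bs\<in>?L. \<exists>D\<ge>0. \<forall>x y z. (1 + norm x) ^ N * norm (iter_pd bs \<Phi> (x - y) - iter_pd bs \<Phi> (x - z)) \<le> D * norm (y - z) * (1 + norm y + norm z) ^ N"
      using schwartz_translate_diff_bound[OF schwartz_iter_pd[OF \<Phi>]] by auto
    from bchoice[OF this] obtain D where D: "\<And>bs. bs \<in> ?L \<Longrightarrow> D bs \<ge> 0"
      "\<And>bs x y z. bs \<in> ?L \<Longrightarrow> (1 + norm x) ^ N * norm (iter_pd bs \<Phi> (x - y) - iter_pd bs \<Phi> (x - z)) \<le> D bs * norm (y - z) * (1 + norm y + norm z) ^ N"
      by blast
    \<comment> \<open>Up to a constant, \<open>e i\<close> is the integrand that bounds the seminorm
      of \<open>S i\<close> minus the convolution: the translation estimate between y and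
      \<open>s i y\<close>, weighted by \<eta>. It tends to 0 pointwise.\<close>
    define e where "e i y = norm (\<eta> y) * (norm (y - s i y) * (1 + norm y + norm (s i y)) ^ N)" for i y
    define E where "E i = (LINT y|lborel. e i y)" for i
    have e_meas [measurable]: "e i \<in> borel_measurable borel" for i unfolding e_def by measurable
    \<comment> \<open>Both |y - s_i y| and 1 + |y| + |s_i y| are at most 3 (1 + |y|), which gives
      \<open>Suc N\<close> such factors.\<close>
    have iW: "integrable lborel (\<lambda>y. 3 ^ Suc N * ((1 + norm y) ^ Suc N * norm (\<eta> y)))"
      by (intro integrable_mult_right integrable_schwartz_weighted \<eta>)
    have e0: "0 \<le> e i y" for i y by (simp add: e_def)
    have eW: "e i y \<le> 3 ^ Suc N * ((1 + norm y) ^ Suc N * norm (\<eta> y))" for i y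
    proof -
      have "norm (y - s i y) \<le> 3 * (1 + norm y)" using norm_triangle_ineq4[of y "s i y"] s(3)[of i y] by simp
      moreover have "(1 + norm y + norm (s i y)) ^ N \<le> (3 * (1 + norm y)) ^ N"
        using s(3)[of i y] by (intro power_mono) auto
      ultimately have "norm (y - s i y) * (1 + norm y + norm (s i y)) ^ N \<le> (3 * (1 + norm y)) * (3 * (1 + norm y)) ^ N"
        by (intro mult_mono) auto
      then have "e i y \<le> norm (\<eta> y) * (3 * (1 + norm y)) ^ Suc N" 
        unfolding e_def by (intro mult_left_mono) auto
      then show ?thesis unfolding power_mult_distrib by (simp only: mult_ac)
    qed
    have ie: "integrable lborel (e i)" for i
      by (rule Bochner_Integration.integrable_bound[OF iW]) (use e0 eW in \<open>auto intro!: AE_I2 order_trans[OF eW abs_ge_self]\<close>)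
    have "(\<lambda>i. LINT y|lborel. e i y) \<longlonglongrightarrow> (LINT y::'a|lborel. (0::real))"
    proof (rule integral_dominated_convergence[OF _ _ iW])
      have "(\<lambda>i. e i y) \<longlonglongrightarrow> norm (\<eta> y) * (norm (y - y) * (1 + norm y + norm y) ^ N)" for y
        unfolding e_def by (intro tendsto_intros s(2))
      then show "AE y in lborel. (\<lambda>i. e i y) \<longlonglongrightarrow> 0" by simp
      show "AE y in lborel. norm (e i y) \<le> 3 ^ Suc N * ((1 + norm y) ^ Suc N * norm (\<eta> y))" for i
        using e0 eW by (auto simp: abs_of_nonneg)
    qed measurable
    then have E: "E \<longlonglongrightarrow> 0" by (simp add: E_def[abs_def])
    have bound: "norm (u (S i) - u (sconv \<eta> \<Phi>)) \<le> (C * (\<Sum>bs\<in>?L. D bs)) * E i" for i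
    proof -
      have "schwartz_norm N (\<lambda>x. S i x - sconv \<eta> \<Phi> x) \<le> (\<Sum>bs\<in>?L. D bs * E i)"
      proof (rule schwartz_norm_le)
        fix bs :: "'a list" and x assume bs: "set bs \<subseteq> Basis" "length bs \<le> N"
        then have bs': "bs \<in> ?L" by simp
        let ?P = "iter_pd bs \<Phi>"
        have P: "?P \<in> schwartz" by (rule schwartz_iter_pd[OF \<Phi> bs(1)])
        have "iter_pd bs (S i) x = (\<Sum>v\<in>range (s i). c i v * ?P (x - v))"
          unfolding S_def using fin bs(1)
          by (subst iter_pd_sum) (auto intro!: schwartz_cmult T simp: iter_pd_cmult[OF T] iter_pd_translate[OF \<Phi>])
        also have "\<dots> = (LINT y|lborel. \<eta> y * ?P (x - s i y))" by (rule sum)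
        finally have "iter_pd bs (\<lambda>x. S i x - sconv \<eta> \<Phi> x) x = (LINT y|lborel. \<eta> y * ?P (x - s i y)) - (LINT y|lborel. \<eta> y * ?P (x - y))"
          by (simp only: iter_pd_diff[OF S schwartz_sconv[OF \<eta> \<Phi>] bs(1)] iter_pd_sconv[OF \<eta> \<Phi> bs(1)]) (simp only: sconv_def)
        also have "\<dots> = (LINT y|lborel. \<eta> y * (?P (x - s i y) - ?P (x - y)))"
          using integrable_sconv[OF \<eta> P, of "s i" x] integrable_sconv[OF \<eta> P, of "\<lambda>y. y" x]
          by (simp add: right_diff_distrib)
        finally have "(1 + norm x) ^ N * norm (iter_pd bs (\<lambda>x. S i x - sconv \<eta> \<Phi> x) x)
          = norm (LINT y|lborel. (1 + norm x) ^ N *\<^sub>R (\<eta> y * (?P (x - s i y) - ?P (x - y))))" by simp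
        also have "\<dots> \<le> (LINT y|lborel. D bs * e i y)"
        proof (rule norm_integral_le)
          show "integrable lborel (\<lambda>y. D bs * e i y)" using ie by simp
          fix y
          have "norm ((1 + norm x) ^ N *\<^sub>R (\<eta> y * (?P (x - s i y) - ?P (x - y))))
             = norm (\<eta> y) * ((1 + norm x) ^ N * norm (?P (x - y) - ?P (x - s i y)))"
            by (simp add: norm_mult norm_minus_commute)
          also have "\<dots> \<le> norm (\<eta> y) * (D bs * norm (y - s i y) * (1 + norm y + norm (s i y)) ^ N)"
            by (intro mult_left_mono D(2)[OF bs']) auto
          finally show "norm ((1 + norm x) ^ N *\<^sub>R (\<eta> y * (?P (x - s i y) - ?P (x - y)))) \<le> D bs * e i y"
            by (simp add: e_def mult_ac)
        qed
        finally show "(1 + norm x) ^ N * norm (iter_pd bs (\<lambda>x. S i x - sconv \<eta> \<Phi> x) x) \<le> D bs * E i"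
          by (simp add: E_def)
      qed
      then have "norm (u (\<lambda>x. S i x - sconv \<eta> \<Phi> x)) \<le> C * (\<Sum>bs\<in>?L. D bs * E i)"
        using C(2)[OF schwartz_diff[OF S schwartz_sconv[OF \<eta> \<Phi>]]] mult_left_mono[OF _ C(1)] order_trans by blast
      then show ?thesis by (simp add: tempered_diff[OF u S schwartz_sconv[OF \<eta> \<Phi>]] sum_distrib_right mult.assoc)
    qed
    show ?thesis
    proof (rule LIM_zero_cancel, rule Lim_null_comparison)
      show "\<forall>\<^sub>F i in sequentially. norm (u (S i) - u (sconv \<eta> \<Phi>)) \<le> (C * (\<Sum>bs\<in>?L. D bs)) * E i"
        using bound by simp
      show "(\<lambda>i. (C * (\<Sum>bs\<in>?L. D bs)) * E i) \<longlonglongrightarrow> 0"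
        using tendsto_mult_right_zero[OF E] by simp
    qed
  qed
  \<comment> \<open>By linearity \<open>u (S i)\<close> is the integral of \<open>\<eta> y\<close>
    times \<open>u\<close> of the translate by \<open>s i y\<close>; continuity in the translation
    parameter yields the limit.\<close>
  moreover have "(\<lambda>i. u (S i)) \<longlonglongrightarrow> (LINT y|lborel. \<eta> y * u (\<lambda>x. \<Phi> (x - y)))"
  proof -
    obtain C M where C: "C \<ge> 0" "\<And>y. norm (u (\<lambda>x. \<Phi> (x - y))) \<le> C * (1 + norm y) ^ M"
      using tempered_translate_growth[OF u \<Phi>] by blast
    have cont: "continuous_on UNIV (\<lambda>y. u (\<lambda>x. \<Phi> (x - y)))" by (rule tempered_translate_continuous[OF u \<Phi>])
    have m[measurable]: "(\<lambda>y. u (\<lambda>x. \<Phi> (x - y))) \<in> borel_measurable borel"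
      by (rule borel_measurable_continuous_onI[OF cont])
    have "u (S i) = (LINT y|lborel. \<eta> y * u (\<lambda>x. \<Phi> (x - s i y)))" for i
    proof -
      have "u (S i) = u (\<lambda>x. \<Sum>v\<in>range (s i). c i v * \<Phi> (x - v))" by (simp only: S_def[abs_def])
      also have "\<dots> = (\<Sum>v\<in>range (s i). c i v * u (\<lambda>x. \<Phi> (x - v)))" by (rule tempered_sum[OF u fin T])
      also have "\<dots> = (LINT y|lborel. \<eta> y * u (\<lambda>x. \<Phi> (x - s i y)))" by (rule sum)
      finally show ?thesis .
    qed
    moreover have "(\<lambda>i. LINT y|lborel. \<eta> y * u (\<lambda>x. \<Phi> (x - s i y))) \<longlonglongrightarrow> (LINT y|lborel. \<eta> y * u (\<lambda>x. \<Phi> (x - y)))"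
    proof (rule integral_dominated_convergence)
      show "integrable lborel (\<lambda>y. (C * 2 ^ M) * ((1 + norm y) ^ M * norm (\<eta> y)))"
        by (intro integrable_mult_right integrable_schwartz_weighted \<eta>)
      show "(\<lambda>y. \<eta> y * u (\<lambda>x. \<Phi> (x - s i y))) \<in> borel_measurable lborel" for i
        using measurable_compose[OF _ m, of "s i" borel] by simp
      have "(\<lambda>i. u (\<lambda>x. \<Phi> (x - s i y))) \<longlonglongrightarrow> u (\<lambda>x. \<Phi> (x - y))" for y
        using cont by (intro isCont_tendsto_compose[OF _ s(2)[of y], of "\<lambda>y. u (\<lambda>x. \<Phi> (x - y))"]) (simp add: continuous_on_eq_continuous_at)
      then show "AE y in lborel. (\<lambda>i. \<eta> y * u (\<lambda>x. \<Phi> (x - s i y))) \<longlonglongrightarrow> \<eta> y * u (\<lambda>x. \<Phi> (x - y))"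
        by (intro AE_I2 tendsto_mult tendsto_const)
      have "norm (\<eta> y * u (\<lambda>x. \<Phi> (x - s i y))) \<le> (C * 2 ^ M) * ((1 + norm y) ^ M * norm (\<eta> y))" for i y
      proof -
        have "norm (u (\<lambda>x. \<Phi> (x - s i y))) \<le> C * (2 * (1 + norm y)) ^ M"
          using s(3)[of i y] C(1) by (intro order_trans[OF C(2)] mult_left_mono power_mono) auto
        then have "norm (\<eta> y * u (\<lambda>x. \<Phi> (x - s i y))) \<le> norm (\<eta> y) * (C * (2 * (1 + norm y)) ^ M)"
          unfolding norm_mult by (intro mult_left_mono) auto
        then show ?thesis unfolding power_mult_distrib by (simp only: mult_ac)
      qed
      then show "AE y in lborel. norm (\<eta> y * u (\<lambda>x. \<Phi> (x - s i y))) \<le> (C * 2 ^ M) * ((1 + norm y) ^ M * norm (\<eta> y))" for i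
        by simp
    qed simp
    ultimately show ?thesis by simp
  qed
  ultimately show ?thesis by (rule LIMSEQ_unique)
qed

section \<open>Distributions that vanish on Gaussians or on tensors\<close>

lemma tempered_zero_if_gauss_zero:
  fixes u :: "('a::euclidean_space \<Rightarrow> complex) \<Rightarrow> complex"
  assumes u: "u \<in> tempered" and \<phi>: "\<phi> \<in> schwartz"
    and zero: "\<And>c y. c > 0 \<Longrightarrow> u (\<lambda>x. of_real (exp (- c * (norm (x - y))\<^sup>2))) = 0"
  shows "u \<phi> = 0"
proof -
  define \<theta> where "\<theta> y = u (\<lambda>x. \<phi> (x - y))" for y
  have cont: "continuous_on UNIV \<theta>" unfolding \<theta>_def by (rule tempered_translate_continuous[OF u \<phi>])
  have [measurable]: "\<theta> \<in> borel_measurable borel" by (rule borel_measurable_continuous_onI[OF cont])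
  obtain C M where C: "C \<ge> 0" "\<And>y. norm (\<theta> y) \<le> C * (1 + norm y) ^ M"
    using tempered_translate_growth[OF u \<phi>] unfolding \<theta>_def by blast
  define G where "G x = complex_of_real (exp (- (norm x)\<^sup>2 / 2))" for x :: 'a
  have G: "G \<in> schwartz" using schwartz_gauss[of "1/2", where 'a='a] by (simp add: G_def[abs_def])
  note schwartz_measurable[OF G, measurable]
  have int0: "(LINT x|lborel. G x * \<theta> ((1 / real (Suc n)) *\<^sub>R x)) = 0" for n
  proof -
    let ?m = "real (Suc n)"
    \<comment> \<open>With this rate, the substitution y = x / m turns every \<open>?g\<close> into
      the one Gaussian \<open>G\<close> and moves the concentration into the argument of
      \<theta>.\<close>
    let ?c = "?m\<^sup>2 / 2"
    let ?g = "\<lambda>x::'a. complex_of_real (exp (- ?c * (norm x)\<^sup>2))"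
    have g: "?g \<in> schwartz" by (rule schwartz_gauss) simp
    have "(LINT y|lborel. ?g y * \<theta> y) = u (sconv ?g \<phi>)"
      unfolding \<theta>_def by (rule tempered_sconv[OF u g \<phi>, symmetric])
    \<comment> \<open>Convolution is commutative, so \<open>u\<close> may be pulled in on either
      factor: before on translates of \<phi>, now on translated Gaussians, where it
      vanishes.\<close>
    also have "\<dots> = (LINT y|lborel. \<phi> y * u (\<lambda>x. ?g (x - y)))"
      unfolding sconv_commute[of ?g] by (rule tempered_sconv[OF u \<phi> g])
    also have "\<dots> = 0" using zero[of ?c] by simp
    finally have "(LINT y|lborel. ?g y * \<theta> y) = 0" .
    moreover have "(LINT y|lborel. ?g y * \<theta> y) = \<bar>1 / ?m\<bar> ^ DIM('a) *\<^sub>R (LINT x|lborel. ?g (0 + (1 / ?m) *\<^sub>R x) * \<theta> (0 + (1 / ?m) *\<^sub>R x))"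
      by (rule lborel_integral_affine) simp
    moreover have "?g (0 + (1 / ?m) *\<^sub>R x) = G x" for x
      by (simp add: G_def power_divide del: of_nat_Suc)
    ultimately show ?thesis by simp
  qed
  have "(\<lambda>n. LINT x|lborel. G x * \<theta> ((1 / real (Suc n)) *\<^sub>R x)) \<longlonglongrightarrow> (LINT x|lborel. G x * \<theta> 0)"
  proof (rule integral_dominated_convergence)
    show "integrable lborel (\<lambda>x. C * ((1 + norm x) ^ M * norm (G x)))"
      by (intro integrable_mult_right integrable_schwartz_weighted G)
    have "(\<lambda>n. \<theta> ((1 / real (Suc n)) *\<^sub>R x)) \<longlonglongrightarrow> \<theta> (0 *\<^sub>R x)" for x
      using cont by (intro isCont_tendsto_compose[of _ \<theta>] tendsto_intros LIMSEQ_Suc[OF lim_1_over_n])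
        (simp add: continuous_on_eq_continuous_at)
    then show "AE x in lborel. (\<lambda>n. G x * \<theta> ((1 / real (Suc n)) *\<^sub>R x)) \<longlonglongrightarrow> G x * \<theta> 0"
      by (intro AE_I2 tendsto_mult tendsto_const) simp
    have "norm (G x * \<theta> ((1 / real (Suc n)) *\<^sub>R x)) \<le> C * ((1 + norm x) ^ M * norm (G x))" for n x
    proof -
      have "norm ((1 / real (Suc n)) *\<^sub>R x) \<le> norm x" by (simp add: field_simps mult_left_le)
      then have "norm (\<theta> ((1 / real (Suc n)) *\<^sub>R x)) \<le> C * (1 + norm x) ^ M"
        using C(1) by (intro order_trans[OF C(2)] mult_left_mono power_mono) auto
      then have "norm (G x * \<theta> ((1 / real (Suc n)) *\<^sub>R x)) \<le> norm (G x) * (C * (1 + norm x) ^ M)"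
        unfolding norm_mult by (intro mult_left_mono) auto
      then show ?thesis by (simp only: mult_ac)
    qed
    then show "AE x in lborel. norm (G x * \<theta> ((1 / real (Suc n)) *\<^sub>R x)) \<le> C * ((1 + norm x) ^ M * norm (G x))" for n
      by simp
  qed measurable
  then have "(LINT x|lborel. G x * \<theta> 0) = 0" unfolding int0 by (simp add: LIMSEQ_const_iff)
  \<comment> \<open>The mass of \<open>G\<close> is not 0, so the limit forces
    \<open>\<theta> 0 = 0\<close>, and \<open>\<theta> 0\<close> is \<open>u \<phi>\<close>.\<close>
  moreover have "(LINT x|lborel. G x) = of_real (sqrt (2 * pi) ^ DIM('a))"
    using fourier_std_gauss[of "0::'a"] by (simp add: G_def)
  ultimately have "\<theta> 0 = 0" by simp
  then show ?thesis by (simp add: \<theta>_def)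
qed

lemma tempered_eq_if_eq_on_tensor:
  fixes u v :: "(real^('d::finite + 'd) \<Rightarrow> complex) \<Rightarrow> complex"
  assumes u: "u \<in> tempered" and v: "v \<in> tempered"
    and eq: "\<And>f g. f \<in> schwartz \<Longrightarrow> g \<in> schwartz \<Longrightarrow> u (tensor f g) = v (tensor f g)"
  shows "u = v"
proof
  fix \<phi>
  \<comment> \<open>The restriction to \<open>schwartz\<close> keeps the difference extensional, as
    \<open>tempered\<close> demands.\<close>
  define w where "w = (\<lambda>f\<in>schwartz. u f - v f)"
  have w: "w \<in> tempered"
  proof -
    obtain N C where C: "C \<ge> 0" "\<And>f. f \<in> schwartz \<Longrightarrow> norm (u f) \<le> C * schwartz_norm N f"
      using tempered_bound[OF u] by metis
    obtain M D where D: "D \<ge> 0" "\<And>f. f \<in> schwartz \<Longrightarrow> norm (v f) \<le> D * schwartz_norm M f"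
      using tempered_bound[OF v] by metis
    have "norm (u f - v f) \<le> (C + D) * schwartz_norm (max M N) f" if f: "f \<in> schwartz" for f
    proof -
      have "norm (u f - v f) \<le> C * schwartz_norm N f + D * schwartz_norm M f"
        using C(2)[OF f] D(2)[OF f] norm_triangle_ineq4[of "u f" "v f"] by linarith
      also have "\<dots> \<le> C * schwartz_norm (max M N) f + D * schwartz_norm (max M N) f"
        by (intro add_mono mult_left_mono schwartz_norm_mono f C D) auto
      finally show ?thesis by (simp add: algebra_simps)
    qed
    then show ?thesis
      unfolding tempered_def w_def
      by (auto simp: schwartz_add schwartz_cmult tempered_add[OF u] tempered_add[OF v] tempered_cmult[OF u] tempered_cmult[OF v] right_diff_distrib)
  qed
  have "w (\<lambda>x. of_real (exp (- c * (norm (x - y))\<^sup>2))) = 0" if c: "c > 0" for c y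
  proof -
    let ?g = "\<lambda>x::real^'d. complex_of_real (exp (- c * (norm x)\<^sup>2))"
    let ?f = "\<lambda>x. ?g (x - upper y)" and ?h = "\<lambda>x. ?g (x - lower y)"
    have s: "?f \<in> schwartz" "?h \<in> schwartz" by (intro schwartz_translate schwartz_gauss c)+
    \<comment> \<open>Additivity of the squared norm over the two halves is what makes the
      exponential factor into a tensor.\<close>
    have n: "(norm z)\<^sup>2 = (norm (upper z))\<^sup>2 + (norm (lower z))\<^sup>2" for z :: "real^('d + 'd)"
      by (simp add: power2_norm_eq_inner inner_vec_def upper_def lower_def UNIV_Plus_UNIV[symmetric] sum.Plus del: UNIV_Plus_UNIV)
    have d: "upper (x - y) = upper x - upper y" "lower (x - y) = lower x - lower y" for x
      by (auto simp: upper_def lower_def vec_eq_iff)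
    have "(\<lambda>x. complex_of_real (exp (- c * (norm (x - y))\<^sup>2))) = tensor ?f ?h"
      by (rule ext) (simp only: tensor_def n d distrib_left exp_add of_real_mult)
    then show ?thesis using eq[OF s] schwartz_tensor[OF s] by (simp add: w_def)
  qed
  then have "w \<phi> = 0" if "\<phi> \<in> schwartz" using tempered_zero_if_gauss_zero[OF w that] by blast
  then show "u \<phi> = v \<phi>"
    using u v by (cases "\<phi> \<in> schwartz") (auto simp: w_def tempered_def extensional_def)
qed

subsection \<open>Square integrable functions and regularity\<close>

text \<open>The set where the functions differ is open and negligible, and a nonempty open set is
  not negligible. This makes the Schwartz representative of an L2 class unique and upgrades
  identities known almost everywhere.\<close>

lemma continuous_AE_eq:
  fixes f g :: "'a::euclidean_space \<Rightarrow> 'b::real_normed_vector"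
  assumes "continuous_on UNIV f" "continuous_on UNIV g" "AE x in lborel. f x = g x"
  shows "f = g"
proof (rule ccontr)
  assume "f \<noteq> g"
  let ?S = "{x. f x \<noteq> g x}"
  have o: "open ?S" by (rule open_Collect_neq[OF assms(1,2)])
  obtain N where N: "{x \<in> space lborel. \<not> f x = g x} \<subseteq> N" "emeasure lborel N = 0" "N \<in> sets lborel"
    by (rule AE_E[OF assms(3)])
  have "emeasure lborel ?S \<le> emeasure lborel N" using N by (intro emeasure_mono) auto
  then have "emeasure lborel ?S = 0" using N by simp
  then have "?S \<in> null_sets lborel" using o by (intro null_setsI) auto
  then have "negligible ?S" using null_sets_completionI negligible_iff_null_sets by blast
  then have "?S = {}" using open_not_negligible[OF o] by auto
  then show False using \<open>f \<noteq> g\<close> by auto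
qed

lemma measurable_cnj [measurable]: "cnj \<in> borel_measurable borel"
  by (intro borel_measurable_continuous_onI continuous_intros)

lemma L2_measurable: "f \<in> L2 \<Longrightarrow> f \<in> borel_measurable borel"
  by (simp add: L2_def)

lemma L2_integrable: "f \<in> L2 \<Longrightarrow> integrable lborel (\<lambda>x. (norm (f x))\<^sup>2)"
  by (simp add: L2_def)

lemma L2_I: "f \<in> borel_measurable borel \<Longrightarrow> integrable lborel (\<lambda>x. (norm (f x))\<^sup>2) \<Longrightarrow> f \<in> L2"
  by (simp add: L2_def)

definition L2_norm :: "('a::euclidean_space \<Rightarrow> complex) \<Rightarrow> real" where
  "L2_norm f = sqrt (LINT x|lborel. (norm (f x))\<^sup>2)"

lemma L2_norm_nonneg: "0 \<le> L2_norm f"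
  by (simp add: L2_norm_def)

lemma integrable_norm_mult_L2:
  assumes "f \<in> L2" "g \<in> L2"
  shows "integrable lborel (\<lambda>x. norm (f x) * norm (g x))"
proof (rule Bochner_Integration.integrable_bound)
  show "integrable lborel (\<lambda>x. (norm (f x))\<^sup>2 + (norm (g x))\<^sup>2)"
    by (intro Bochner_Integration.integrable_add L2_integrable assms)
  show "(\<lambda>x. norm (f x) * norm (g x)) \<in> borel_measurable lborel"
    using L2_measurable[OF assms(1)] L2_measurable[OF assms(2)] by simp
  have "r * s \<le> r\<^sup>2 + s\<^sup>2" if "r \<ge> 0" "s \<ge> 0" for r s :: real
    using sum_squares_bound[of r s] mult_nonneg_nonneg[OF that] by simp
  then show "AE x in lborel. norm (norm (f x) * norm (g x)) \<le> norm ((norm (f x))\<^sup>2 + (norm (g x))\<^sup>2)"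
    by (auto intro!: AE_I2)
qed

lemma integral_norm_mult_L2_le:
  assumes "f \<in> L2" "g \<in> L2"
  shows "(LINT x|lborel. norm (f x) * norm (g x)) \<le> L2_norm f * L2_norm g"
proof -
  have [measurable]: "f \<in> borel_measurable borel" "g \<in> borel_measurable borel"
    using assms by (auto intro: L2_measurable)
  let ?X = "LINT x|lborel. norm (f x) * norm (g x)"
  let ?F = "LINT x|lborel. (norm (f x))\<^sup>2" and ?G = "LINT x|lborel. (norm (g x))\<^sup>2"
  have "(\<integral>\<^sup>+x. ennreal (norm (f x)) * ennreal (norm (g x)) \<partial>lborel)\<^sup>2
     \<le> (\<integral>\<^sup>+x. ennreal (norm (f x)) ^ 2 \<partial>lborel) * (\<integral>\<^sup>+x. ennreal (norm (g x)) ^ 2 \<partial>lborel)"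
    by (rule Cauchy_Schwarz_nn_integral) measurable
  also have "(\<integral>\<^sup>+x. ennreal (norm (f x)) ^ 2 \<partial>lborel) = ennreal ?F"
    using L2_integrable[OF assms(1)] by (simp add: ennreal_power nn_integral_eq_integral)
  also have "(\<integral>\<^sup>+x. ennreal (norm (g x)) ^ 2 \<partial>lborel) = ennreal ?G"
    using L2_integrable[OF assms(2)] by (simp add: ennreal_power nn_integral_eq_integral)
  also have "(\<integral>\<^sup>+x. ennreal (norm (f x)) * ennreal (norm (g x)) \<partial>lborel) = ennreal ?X"
    using integrable_norm_mult_L2[OF assms] by (simp add: ennreal_mult[symmetric] nn_integral_eq_integral)
  finally have "?X\<^sup>2 \<le> ?F * ?G"
    by (simp add: ennreal_power ennreal_mult[symmetric])
  then have "sqrt (?X\<^sup>2) \<le> sqrt (?F * ?G)" by (rule real_sqrt_le_mono)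
  then show ?thesis by (simp add: L2_norm_def real_sqrt_mult)
qed

lemma integrable_mult_cnj_L2:
  assumes "f \<in> L2" "g \<in> L2"
  shows "integrable lborel (\<lambda>x. f x * cnj (g x))"
proof -
  note assms[THEN L2_measurable, measurable]
  show ?thesis
    by (rule Bochner_Integration.integrable_bound[OF integrable_norm_mult_L2[OF assms]]) (auto simp: norm_mult)
qed

lemma norm_L2_inner_le:
  assumes "f \<in> L2" "g \<in> L2"
  shows "norm (L2_inner f g) \<le> L2_norm f * L2_norm g"
  unfolding L2_inner_def
  by (rule order_trans[OF integral_norm_bound])
    (use integral_norm_mult_L2_le[OF assms] in \<open>simp add: norm_mult\<close>)

lemma L2_inner_self: "L2_inner f f = of_real ((L2_norm f)\<^sup>2)"
proof -
  have "f x * cnj (f x) = of_real ((norm (f x))\<^sup>2)" for x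
    by (rule complex_norm_square[symmetric])
  then have "L2_inner f f = of_real (LINT x|lborel. (norm (f x))\<^sup>2)"
    unfolding L2_inner_def by (simp only: integral_complex_of_real)
  then show ?thesis by (simp add: L2_norm_def)
qed

lemma L2_add:
  assumes "f \<in> L2" "g \<in> L2"
  shows "(\<lambda>x. f x + g x) \<in> L2"
proof (rule L2_I)
  have [measurable]: "f \<in> borel_measurable borel" "g \<in> borel_measurable borel"
    using assms by (auto intro: L2_measurable)
  show "(\<lambda>x. f x + g x) \<in> borel_measurable borel" by measurable
  show "integrable lborel (\<lambda>x. (norm (f x + g x))\<^sup>2)"
  proof (rule Bochner_Integration.integrable_bound)
    show "integrable lborel (\<lambda>x. 2 * (norm (f x))\<^sup>2 + 2 * (norm (g x))\<^sup>2)"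
      by (intro Bochner_Integration.integrable_add integrable_mult_right L2_integrable assms)
    have "(norm (f x + g x))\<^sup>2 \<le> 2 * (norm (f x))\<^sup>2 + 2 * (norm (g x))\<^sup>2" for x
    proof -
      have "(norm (f x + g x))\<^sup>2 \<le> (norm (f x) + norm (g x))\<^sup>2" by (intro power_mono norm_triangle_ineq) auto
      also have "\<dots> \<le> 2 * (norm (f x))\<^sup>2 + 2 * (norm (g x))\<^sup>2"
        using sum_squares_bound[of "norm (f x)" "norm (g x)"] by (simp add: power2_sum)
      finally show ?thesis .
    qed
    then show "AE x in lborel. norm ((norm (f x + g x))\<^sup>2) \<le> norm (2 * (norm (f x))\<^sup>2 + 2 * (norm (g x))\<^sup>2)"
      by (auto intro!: AE_I2)
  qed measurable
qed

lemma L2_cmult: "f \<in> L2 \<Longrightarrow> (\<lambda>x. c * f x) \<in> L2"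
  by (auto simp: L2_def norm_mult power_mult_distrib)

lemma L2_diff:
  assumes "f \<in> L2" "g \<in> L2"
  shows "(\<lambda>x. f x - g x) \<in> L2"
  using L2_add[OF assms(1) L2_cmult[OF assms(2), of "-1"]] by simp

lemma L2_inner_diff_left: "f \<in> L2 \<Longrightarrow> g \<in> L2 \<Longrightarrow> h \<in> L2 \<Longrightarrow> L2_inner (\<lambda>x. f x - g x) h = L2_inner f h - L2_inner g h"
  unfolding L2_inner_def left_diff_distrib by (intro Bochner_Integration.integral_diff integrable_mult_cnj_L2)

lemma L2_inner_diff_right: "f \<in> L2 \<Longrightarrow> g \<in> L2 \<Longrightarrow> h \<in> L2 \<Longrightarrow> L2_inner h (\<lambda>x. f x - g x) = L2_inner h f - L2_inner h g"
  unfolding L2_inner_def complex_cnj_diff right_diff_distrib by (intro Bochner_Integration.integral_diff integrable_mult_cnj_L2)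

lemma L2_inner_cmult_left: "L2_inner (\<lambda>x. c * f x) h = c * L2_inner f h"
  by (simp add: L2_inner_def mult.assoc)

lemma L2_inner_cmult_right: "L2_inner h (\<lambda>x. c * f x) = cnj c * L2_inner h f"
  by (simp add: L2_inner_def mult.left_commute)

lemma L2_inner_cong_AE:
  assumes "AE x in lborel. f x = f' x" "AE x in lborel. g x = g' x"
    "f \<in> borel_measurable borel" "f' \<in> borel_measurable borel" "g \<in> borel_measurable borel" "g' \<in> borel_measurable borel"
  shows "L2_inner f g = L2_inner f' g'"
proof -
  note assms(3-6)[measurable]
  show ?thesis
    unfolding L2_inner_def
  proof (rule integral_cong_AE)
    show "AE x in lborel. f x * cnj (g x) = f' x * cnj (g' x)" using assms(1,2) by eventually_elim simp
  qed measurable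
qed

text \<open>The weight is squared inside the integral, so order \<open>DIM('a)\<close> already
  produces the integrable exponent \<open>2 * DIM('a)\<close>.\<close>

lemma L2_norm_schwartz_le:
  "\<exists>C\<ge>0. \<forall>f\<in>(schwartz :: ('a::euclidean_space \<Rightarrow> complex) set). L2_norm f \<le> C * schwartz_norm DIM('a) f"
proof -
  let ?n = "DIM('a)"
  let ?I = "LINT x|lborel. inverse ((1 + norm (x::'a)) ^ (2 * ?n))"
  have "L2_norm f \<le> sqrt ?I * schwartz_norm ?n f" if f: "f \<in> schwartz" for f :: "'a \<Rightarrow> complex"
  proof -
    have p: "0 \<le> schwartz_norm ?n f" by (rule schwartz_norm_nonneg[OF f])
    have "(LINT x|lborel. (norm (f x))\<^sup>2) \<le> (LINT x::'a|lborel. (schwartz_norm ?n f)\<^sup>2 * inverse ((1 + norm x) ^ (2 * ?n)))"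
    proof (rule integral_mono)
      show "integrable lborel (\<lambda>x. (norm (f x))\<^sup>2)" by (rule L2_integrable[OF schwartz_L2[OF f]])
      show "integrable lborel (\<lambda>x::'a. (schwartz_norm ?n f)\<^sup>2 * inverse ((1 + norm x) ^ (2 * ?n)))"
        by (intro integrable_mult_right integrable_inverse_one_plus_norm_power) simp
      fix x
      have "(1 + norm x) ^ (0 + ?n) * norm (f x) \<le> schwartz_norm ?n f"
        using schwartz_norm_upper[OF f, of "[]" ?n ?n x] by simp
      then have "norm (f x) \<le> schwartz_norm ?n f * inverse ((1 + norm x) ^ ?n)"
        using norm_le_of_weighted[of x 0 ?n "norm (f x)"] by simp
      then have "(norm (f x))\<^sup>2 \<le> (schwartz_norm ?n f * inverse ((1 + norm x) ^ ?n))\<^sup>2" by (intro power_mono) auto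
      then show "(norm (f x))\<^sup>2 \<le> (schwartz_norm ?n f)\<^sup>2 * inverse ((1 + norm x) ^ (2 * ?n))"
        by (simp add: power_mult_distrib power_inverse power_mult[symmetric] mult.commute)
    qed
    then have "L2_norm f \<le> sqrt ((schwartz_norm ?n f)\<^sup>2 * ?I)"
      unfolding L2_norm_def by (intro real_sqrt_le_mono) simp
    then show ?thesis using p by (simp add: real_sqrt_mult mult.commute)
  qed
  then show ?thesis by (intro exI[of _ "sqrt ?I"]) (auto intro!: integral_nonneg)
qed

text \<open>
  An abstract Sobolev embedding. The map \<open>H\<close> sends Schwartz functions to square integrable
  ones, and multiplying \<open>H f\<close> by a coordinate or differentiating it weakly again gives values
  of \<open>H\<close>. Multiplications make \<open>H f\<close> integrable and derivatives make its Fourier transform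
  rapidly decreasing, so Fourier inversion yields a representative in the Schwartz space.
\<close>

locale schwartz_regular =
  fixes H :: "('b::euclidean_space \<Rightarrow> complex) \<Rightarrow> 'a::euclidean_space \<Rightarrow> complex"
    and D M :: "'a \<Rightarrow> ('b \<Rightarrow> complex) \<Rightarrow> 'b \<Rightarrow> complex"
  assumes H_L2: "f \<in> schwartz \<Longrightarrow> H f \<in> L2"
    and H_bound: "\<exists>N C. C \<ge> 0 \<and> (\<forall>f\<in>schwartz. L2_norm (H f) \<le> C * schwartz_norm N f)"
    and D_cont: "b \<in> Basis \<Longrightarrow> schwartz_cont_op (D b)"
    and M_cont: "b \<in> Basis \<Longrightarrow> schwartz_cont_op (M b)"
    and H_M: "b \<in> Basis \<Longrightarrow> f \<in> schwartz \<Longrightarrow> AE x in lborel. H (M b f) x = of_real (x \<bullet> b) * H f x"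
    and H_D: "b \<in> Basis \<Longrightarrow> f \<in> schwartz \<Longrightarrow> g \<in> schwartz \<Longrightarrow> L2_inner (H (D b f)) g = - L2_inner (H f) (pd b g)"
begin

lemma M_pow_cont: "b \<in> Basis \<Longrightarrow> schwartz_cont_op ((M b) ^^ n)"
proof (induction n)
  case 0
  show ?case using schwartz_cont_op_id by (simp add: id_def)
next
  case (Suc n)
  then show ?case using schwartz_cont_op_comp[OF M_cont[of b] Suc.IH] by (simp add: o_def)
qed

lemma D_pow_cont: "b \<in> Basis \<Longrightarrow> schwartz_cont_op ((D b) ^^ n)"
proof (induction n)
  case 0
  show ?case using schwartz_cont_op_id by (simp add: id_def)
next
  case (Suc n)
  then show ?case using schwartz_cont_op_comp[OF D_cont[of b] Suc.IH] by (simp add: o_def)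
qed

lemma H_M_pow:
  assumes b: "b \<in> Basis" and f: "f \<in> schwartz"
  shows "AE x in lborel. H (((M b) ^^ n) f) x = of_real ((x \<bullet> b) ^ n) * H f x"
proof (induction n)
  case (Suc n)
  have "((M b) ^^ n) f \<in> schwartz" by (rule schwartz_cont_op_in[OF M_pow_cont[OF b] f])
  from H_M[OF b this] Suc show ?case by eventually_elim simp
qed simp

lemma H_measurable: "f \<in> schwartz \<Longrightarrow> H f \<in> borel_measurable borel"
  by (rule L2_measurable[OF H_L2])

text \<open>Cauchy-Schwarz against \<open>g\<close>, a square integrable negative power of 1 + |x|.
  The compensating weight is replaced by powers of coordinates, and those are realised by powers of
  \<open>M\<close> as further values of \<open>H\<close>.\<close>

lemma H_L1:
  "\<exists>N C. C \<ge> 0 \<and> (\<forall>f\<in>schwartz. integrable lborel (H f) \<and> (LINT x|lborel. norm (H f x)) \<le> C * schwartz_norm N f)"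
proof -
  let ?n = "DIM('a)"
  define g where "g x = complex_of_real (inverse ((1 + norm x) ^ ?n))" for x :: 'a
  have g: "g \<in> L2"
  proof (rule L2_I)
    show "g \<in> borel_measurable borel" unfolding g_def by measurable
    have "(norm (g x))\<^sup>2 = inverse ((1 + norm x) ^ (2 * ?n))" for x
      by (simp add: g_def norm_inverse norm_power power_inverse power_mult[symmetric] mult.commute del: of_real_add)
    then show "integrable lborel (\<lambda>x. (norm (g x))\<^sup>2)"
      using integrable_inverse_one_plus_norm_power[of "2 * ?n", where 'a='a] by simp
  qed
  have ng: "norm (g x) = inverse ((1 + norm x) ^ ?n)" for x
    by (simp add: g_def norm_inverse norm_power del: of_real_add)
  obtain N0 C0 where C0: "C0 \<ge> 0" "\<And>f. f \<in> schwartz \<Longrightarrow> L2_norm (H f) \<le> C0 * schwartz_norm N0 f"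
    using H_bound by blast
  obtain K E where E: "E \<ge> 0"
    "\<And>f. f \<in> schwartz \<Longrightarrow> schwartz_norm N0 f + (\<Sum>b\<in>Basis. schwartz_norm N0 (((M b) ^^ ?n) f)) \<le> E * schwartz_norm K f"
    using schwartz_norm_add_sum_le[OF finite_Basis, where T="\<lambda>b. (M b) ^^ ?n" and N=N0, OF M_pow_cont] by blast
  let ?c = "(1 + real ?n) ^ ?n"
  define B where "B = ?c * (L2_norm g * (C0 * E))"
  have B0: "B \<ge> 0" unfolding B_def using C0(1) E(1)
    by (intro mult_nonneg_nonneg L2_norm_nonneg) auto
  have "integrable lborel (H f) \<and> (LINT x|lborel. norm (H f x)) \<le> B * schwartz_norm K f" if f: "f \<in> schwartz" for f
  proof -
    let ?Mf = "\<lambda>b. ((M b) ^^ ?n) f"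
    have Mf: "?Mf b \<in> schwartz" if "b \<in> Basis" for b by (rule schwartz_cont_op_in[OF M_pow_cont[OF that] f])
    let ?w = "\<lambda>x. ?c * (norm (g x) * norm (H f x) + (\<Sum>b\<in>Basis. norm (g x) * norm (H (?Mf b) x)))"
    have iw: "integrable lborel ?w"
      by (intro integrable_mult_right Bochner_Integration.integrable_add Bochner_Integration.integrable_sum integrable_norm_mult_L2 g H_L2 f Mf)
    have "AE x in lborel. \<forall>b\<in>Basis. H (?Mf b) x = of_real ((x \<bullet> b) ^ ?n) * H f x"
      using H_M_pow[OF _ f] by (intro AE_finite_allI) auto
    then have le: "AE x in lborel. norm (H f x) \<le> ?w x"
    proof eventually_elim
      case (elim x)
      have p: "0 < (1 + norm x) ^ ?n" by (simp add: add_pos_nonneg)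
      have "norm (H f x) = norm (g x) * ((1 + norm x) ^ ?n * norm (H f x))"
        using left_inverse[of "(1 + norm x) ^ ?n"] p by (simp only: ng mult.assoc[symmetric])
      also have "\<dots> \<le> norm (g x) * ((?c * (1 + (\<Sum>b\<in>Basis. \<bar>x \<bullet> b\<bar> ^ ?n))) * norm (H f x))"
        by (intro mult_left_mono mult_right_mono one_plus_norm_power_le) auto
      also have "\<dots> = ?c * (norm (g x) * norm (H f x) + (\<Sum>b\<in>Basis. norm (g x) * (\<bar>x \<bullet> b\<bar> ^ ?n * norm (H f x))))"
        by (simp add: sum_distrib_left sum_distrib_right distrib_left distrib_right mult_ac)
      also have "(\<Sum>b\<in>Basis. norm (g x) * (\<bar>x \<bullet> b\<bar> ^ ?n * norm (H f x))) = (\<Sum>b\<in>Basis. norm (g x) * norm (H (?Mf b) x))"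
        using elim by (intro sum.cong) (auto simp: norm_mult norm_power power_abs)
      finally show ?case .
    qed
    have i: "integrable lborel (H f)"
      by (rule Bochner_Integration.integrable_bound[OF iw])
        (use H_measurable[OF f] le in \<open>auto elim!: eventually_mono intro: order_trans[OF _ abs_ge_self]\<close>)
    have "(LINT x|lborel. norm (H f x)) \<le> (LINT x|lborel. ?w x)"
      using i by (intro integral_mono_AE iw le) simp
    also have "\<dots> = ?c * ((LINT x|lborel. norm (g x) * norm (H f x)) + (\<Sum>b\<in>Basis. LINT x|lborel. norm (g x) * norm (H (?Mf b) x)))"
      by (simp add: Bochner_Integration.integral_add Bochner_Integration.integral_sum Bochner_Integration.integrable_sum integrable_norm_mult_L2 g H_L2 f Mf)
    also have "\<dots> \<le> ?c * (L2_norm g * (C0 * schwartz_norm N0 f) + (\<Sum>b\<in>Basis. L2_norm g * (C0 * schwartz_norm N0 (?Mf b))))"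
    proof (intro mult_left_mono add_mono sum_mono)
      show "(LINT x|lborel. norm (g x) * norm (H f x)) \<le> L2_norm g * (C0 * schwartz_norm N0 f)"
        by (rule order_trans[OF integral_norm_mult_L2_le[OF g H_L2[OF f]] mult_left_mono[OF C0(2)[OF f] L2_norm_nonneg]])
      show "(LINT x|lborel. norm (g x) * norm (H (?Mf b) x)) \<le> L2_norm g * (C0 * schwartz_norm N0 (?Mf b))" if "b \<in> Basis" for b
        by (rule order_trans[OF integral_norm_mult_L2_le[OF g H_L2[OF Mf[OF that]]] mult_left_mono[OF C0(2)[OF Mf[OF that]] L2_norm_nonneg]])
    qed auto
    also have "\<dots> = ?c * (L2_norm g * (C0 * (schwartz_norm N0 f + (\<Sum>b\<in>Basis. schwartz_norm N0 (?Mf b)))))"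
      by (simp only: distrib_left sum_distrib_left)
    also have "\<dots> \<le> ?c * (L2_norm g * (C0 * (E * schwartz_norm K f)))"
      by (intro mult_left_mono E f C0(1) L2_norm_nonneg) auto
    also have "\<dots> = B * schwartz_norm K f"
      by (simp only: B_def mult.assoc)
    finally show ?thesis using i by simp
  qed
  then show ?thesis using B0 by blast
qed

lemma H_integrable: "f \<in> schwartz \<Longrightarrow> integrable lborel (H f)"
  using H_L1 by blast

text \<open>A character is not a Schwartz function, so the weak derivative is tested against its
  product with a Gaussian that flattens as n grows. Differentiating the Gaussian leaves an error of
  2 / (n + 1) times a damped transform of \<open>H (M b f)\<close>; that function is integrable, so
  the error tends to 0.\<close>

lemma fourier_H_D:
  assumes b: "b \<in> Basis" and f: "f \<in> schwartz"
  shows "fourier (H (D b f)) \<xi> = \<i> * of_real (\<xi> \<bullet> b) * fourier (H f) \<xi>"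
proof -
  let ?e = "\<lambda>n. 1 / real (Suc n)"
  have e0: "?e \<longlonglongrightarrow> 0" by (rule LIMSEQ_Suc[OF lim_1_over_n])
  have Df: "D b f \<in> schwartz" and Mf: "M b f \<in> schwartz"
    using schwartz_cont_op_in[OF D_cont[OF b] f] schwartz_cont_op_in[OF M_cont[OF b] f] .
  define J where "J u n = (LINT x|lborel. u x * cis (- (\<xi> \<bullet> x)) * of_real (exp (- ?e n * (norm x)\<^sup>2)))" for u :: "'a \<Rightarrow> complex" and n
  have J: "J u \<longlonglongrightarrow> fourier u \<xi>" if u: "integrable lborel u" for u
    unfolding J_def fourier_def
  proof (rule integral_dominated_convergence)
    have [measurable]: "u \<in> borel_measurable borel" using u by auto
    show "(\<lambda>x. u x * cis (- (\<xi> \<bullet> x))) \<in> borel_measurable lborel" by measurable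
    show "(\<lambda>x. u x * cis (- (\<xi> \<bullet> x)) * of_real (exp (- ?e n * (norm x)\<^sup>2))) \<in> borel_measurable lborel" for n by measurable
    show "integrable lborel (\<lambda>x. norm (u x))" using u by simp
    have "(\<lambda>n. u x * cis (- (\<xi> \<bullet> x)) * of_real (exp (- ?e n * (norm x)\<^sup>2))) \<longlonglongrightarrow> u x * cis (- (\<xi> \<bullet> x)) * of_real (exp (- 0 * (norm x)\<^sup>2))" for x
      by (intro tendsto_intros e0)
    then show "AE x in lborel. (\<lambda>n. u x * cis (- (\<xi> \<bullet> x)) * of_real (exp (- ?e n * (norm x)\<^sup>2))) \<longlonglongrightarrow> u x * cis (- (\<xi> \<bullet> x))"
      by simp
    show "AE x in lborel. norm (u x * cis (- (\<xi> \<bullet> x)) * of_real (exp (- ?e n * (norm x)\<^sup>2))) \<le> norm (u x)" for n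
      by (auto intro!: AE_I2 mult_left_le simp: norm_mult)
  qed
  have iJ: "integrable lborel (\<lambda>x. u x * cis (- (\<xi> \<bullet> x)) * of_real (exp (- ?e n * (norm x)\<^sup>2)))" if u: "integrable lborel u" for u n
  proof -
    have [measurable]: "u \<in> borel_measurable borel" using u by auto
    show ?thesis
      by (rule Bochner_Integration.integrable_bound[OF u]) (auto intro!: AE_I2 mult_left_le simp: norm_mult)
  qed
  have eq: "J (H (D b f)) n = \<i> * of_real (\<xi> \<bullet> b) * J (H f) n + of_real (2 * ?e n) * J (H (M b f)) n" for n
  proof -
    let ?G = "\<lambda>x::'a. complex_of_real (exp (- ?e n * (norm x)\<^sup>2))"
    let ?g = "\<lambda>x. cis (\<xi> \<bullet> x) * ?G x"
    have g: "?g \<in> schwartz" by (intro schwartz_cis_mult schwartz_gauss) simp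
    have "(?g has_derivative (\<lambda>h. cis (\<xi> \<bullet> x) * (\<i> * of_real (\<xi> \<bullet> h)) * ?G x + cis (\<xi> \<bullet> x) * (of_real (- 2 * ?e n * (x \<bullet> h)) * ?G x))) (at x)" for x
    proof -
      have c: "((\<lambda>x. cis (\<xi> \<bullet> x)) has_derivative (\<lambda>h. cis (\<xi> \<bullet> x) * (\<i> * of_real (\<xi> \<bullet> h)))) (at x)"
        unfolding cis_conv_exp
        by (rule has_derivative_compose[OF _ DERIV_exp[unfolded has_field_derivative_def]])
          (auto intro!: derivative_eq_intros)
      have G: "(?G has_derivative (\<lambda>h. of_real (exp (- ?e n * (x \<bullet> x)) * (- ?e n * (x \<bullet> h + h \<bullet> x))))) (at x)"
        unfolding power2_norm_eq_inner by (auto intro!: derivative_eq_intros simp del: of_nat_Suc)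
      show ?thesis
        using has_derivative_mult[OF c G]
        by (rule has_derivative_eq_rhs)
          (simp add: fun_eq_iff inner_commute power2_norm_eq_inner algebra_simps del: of_nat_Suc)
    qed
    from pd_eqI[OF this, of b]
    have pdg: "pd b ?g = (\<lambda>x. (\<i> * of_real (\<xi> \<bullet> b)) * ?g x - of_real (2 * ?e n) * (of_real (x \<bullet> b) * ?g x))"
      by (simp add: algebra_simps del: of_nat_Suc)
    have cg: "u x * cnj (?g x) = u x * cis (- (\<xi> \<bullet> x)) * ?G x" for u :: "'a \<Rightarrow> complex" and x by (simp add: cis_cnj)
    have "J (H (D b f)) n = L2_inner (H (D b f)) ?g"
      unfolding J_def L2_inner_def cg ..
    also have "\<dots> = - L2_inner (H f) (pd b ?g)" by (rule H_D[OF b f g])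
    \<comment> \<open>\<open>L2_inner\<close> is conjugate linear in its second argument: the factor
      i (\<xi> \<bullet> b) of \<open>pd b ?g\<close> comes out with the opposite sign and cancels
      the minus of \<open>H_D\<close>.\<close>
    also have "\<dots> = \<i> * of_real (\<xi> \<bullet> b) * L2_inner (H f) ?g + of_real (2 * ?e n) * L2_inner (H f) (\<lambda>x. of_real (x \<bullet> b) * ?g x)"
    proof -
      have "L2_inner (H f) (pd b ?g) = L2_inner (H f) (\<lambda>x. (\<i> * of_real (\<xi> \<bullet> b)) * ?g x)
          - L2_inner (H f) (\<lambda>x. of_real (2 * ?e n) * (of_real (x \<bullet> b) * ?g x))"
        unfolding pdg by (intro L2_inner_diff_right L2_cmult schwartz_L2 schwartz_coord_mult g H_L2 f)
      then show ?thesis unfolding L2_inner_cmult_right by simp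
    qed
    also have "L2_inner (H f) ?g = J (H f) n" unfolding J_def L2_inner_def cg ..
    also have "L2_inner (H f) (\<lambda>x. of_real (x \<bullet> b) * ?g x) = J (H (M b f)) n"
      unfolding J_def L2_inner_def
    proof (rule integral_cong_AE)
      have [measurable]: "H f \<in> borel_measurable borel" "H (M b f) \<in> borel_measurable borel"
        using H_measurable f Mf by auto
      show "(\<lambda>x. H f x * cnj (of_real (x \<bullet> b) * ?g x)) \<in> borel_measurable lborel" by measurable
      show "(\<lambda>x. H (M b f) x * cis (- (\<xi> \<bullet> x)) * ?G x) \<in> borel_measurable lborel" by measurable
      show "AE x in lborel. H f x * cnj (of_real (x \<bullet> b) * ?g x) = H (M b f) x * cis (- (\<xi> \<bullet> x)) * ?G x"
        using H_M[OF b f] by eventually_elim (simp add: cis_cnj)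
    qed
    finally show ?thesis .
  qed
  have "(\<lambda>n. \<i> * of_real (\<xi> \<bullet> b) * J (H f) n + of_real (2 * ?e n) * J (H (M b f)) n) \<longlonglongrightarrow>
      \<i> * of_real (\<xi> \<bullet> b) * fourier (H f) \<xi> + of_real (2 * 0) * fourier (H (M b f)) \<xi>"
    by (intro tendsto_intros J e0 H_integrable f Mf)
  moreover have "(\<lambda>n. \<i> * of_real (\<xi> \<bullet> b) * J (H f) n + of_real (2 * ?e n) * J (H (M b f)) n) \<longlonglongrightarrow> fourier (H (D b f)) \<xi>"
    using J[OF H_integrable[OF Df]] unfolding eq[THEN ext, symmetric] .
  ultimately show ?thesis using LIMSEQ_unique by fastforce
qed

lemma fourier_H_D_pow:
  assumes b: "b \<in> Basis" and f: "f \<in> schwartz"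
  shows "fourier (H (((D b) ^^ n) f)) \<xi> = (\<i> * of_real (\<xi> \<bullet> b)) ^ n * fourier (H f) \<xi>"
proof (induction n)
  case (Suc n)
  have "((D b) ^^ n) f \<in> schwartz" by (rule schwartz_cont_op_in[OF D_pow_cont[OF b] f])
  from fourier_H_D[OF b this, of \<xi>] Suc show ?case by (simp add: mult.assoc)
qed simp

text \<open>A power of \<open>D b\<close> acts on the transform as a power of i times a coordinate
  of \<xi>, and every transform is bounded by an L1 norm, hence by a seminorm of
  \<open>f\<close>.\<close>

lemma fourier_H_decay:
  "\<exists>K C. C \<ge> 0 \<and> (\<forall>f\<in>schwartz. \<forall>\<xi>. (1 + norm \<xi>) ^ N * norm (fourier (H f) \<xi>) \<le> C * schwartz_norm K f)"
proof -
  obtain N0 C0 where C0: "C0 \<ge> 0" "\<And>f. f \<in> schwartz \<Longrightarrow> (LINT x|lborel. norm (H f x)) \<le> C0 * schwartz_norm N0 f"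
    using H_L1 by blast
  have F0: "norm (fourier (H f) \<xi>) \<le> C0 * schwartz_norm N0 f" if "f \<in> schwartz" for f \<xi>
    by (rule order_trans[OF fourier_bounded[OF H_integrable[OF that]] C0(2)[OF that]])
  obtain K E where E: "E \<ge> 0"
    "\<And>f. f \<in> schwartz \<Longrightarrow> schwartz_norm N0 f + (\<Sum>b\<in>Basis. schwartz_norm N0 (((D b) ^^ N) f)) \<le> E * schwartz_norm K f"
    using schwartz_norm_add_sum_le[OF finite_Basis, where T="\<lambda>b. (D b) ^^ N" and N=N0, OF D_pow_cont] by blast
  let ?c = "(1 + real DIM('a)) ^ N"
  define B where "B = ?c * (C0 * E)"
  have B0: "B \<ge> 0" unfolding B_def using C0(1) E(1) by (intro mult_nonneg_nonneg) auto
  have "(1 + norm \<xi>) ^ N * norm (fourier (H f) \<xi>) \<le> B * schwartz_norm K f" if f: "f \<in> schwartz" for f \<xi>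
  proof -
    have "(1 + norm \<xi>) ^ N * norm (fourier (H f) \<xi>) \<le> (?c * (1 + (\<Sum>b\<in>Basis. \<bar>\<xi> \<bullet> b\<bar> ^ N))) * norm (fourier (H f) \<xi>)"
      by (intro mult_right_mono one_plus_norm_power_le) auto
    also have "\<dots> = ?c * (norm (fourier (H f) \<xi>) + (\<Sum>b\<in>Basis. norm (fourier (H (((D b) ^^ N) f)) \<xi>)))"
      by (simp add: fourier_H_D_pow[OF _ f] norm_mult norm_power sum_distrib_left sum_distrib_right distrib_left distrib_right mult_ac)
    also have "\<dots> \<le> ?c * (C0 * schwartz_norm N0 f + (\<Sum>b\<in>Basis. C0 * schwartz_norm N0 (((D b) ^^ N) f)))"
    proof (intro mult_left_mono add_mono sum_mono)
      show "norm (fourier (H f) \<xi>) \<le> C0 * schwartz_norm N0 f" by (rule F0[OF f])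
      show "norm (fourier (H (((D b) ^^ N) f)) \<xi>) \<le> C0 * schwartz_norm N0 (((D b) ^^ N) f)" if "b \<in> Basis" for b
        by (rule F0[OF schwartz_cont_op_in[OF D_pow_cont[OF that] f]])
    qed auto
    also have "\<dots> = ?c * (C0 * (schwartz_norm N0 f + (\<Sum>b\<in>Basis. schwartz_norm N0 (((D b) ^^ N) f))))"
      by (simp only: distrib_left sum_distrib_left)
    also have "\<dots> \<le> ?c * (C0 * (E * schwartz_norm K f))"
      by (intro mult_left_mono E f C0(1)) auto
    also have "\<dots> = B * schwartz_norm K f"
      by (simp only: B_def mult.assoc)
    finally show ?thesis .
  qed
  then show ?thesis using B0 by blast
qed

lemma fourier_H_measurable: "f \<in> schwartz \<Longrightarrow> fourier (H f) \<in> borel_measurable borel"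
proof -
  assume "f \<in> schwartz"
  note H_measurable[OF this, measurable]
  show ?thesis unfolding fourier_def[abs_def] by measurable
qed

lemma fourier_H_integrable:
  assumes f: "f \<in> schwartz"
  shows "integrable lborel (\<lambda>\<xi>. (1 + norm \<xi>) ^ k *\<^sub>R fourier (H f) \<xi>)"
proof -
  obtain K C where "\<And>\<xi>. (1 + norm \<xi>) ^ (k + 2 * DIM('a)) * norm (fourier (H f) \<xi>) \<le> C * schwartz_norm K f"
    using fourier_H_decay f by blast
  then show ?thesis by (rule integrable_weighted_bound[OF fourier_H_measurable[OF f]])
qed

text \<open>The inverse Fourier transform of \<open>fourier (H f)\<close>. It is given at every
  point and is the candidate for the smooth representative of the class of
  \<open>H f\<close>.\<close>

definition repr :: "('b \<Rightarrow> complex) \<Rightarrow> 'a \<Rightarrow> complex" where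
  "repr f x = inverse (of_real ((2 * pi) ^ DIM('a))) * (LINT \<xi>|lborel. fourier (H f) \<xi> * cis (\<xi> \<bullet> x))"

lemma H_eq_repr:
  assumes f: "f \<in> schwartz"
  shows "AE x in lborel. H f x = repr f x"
proof -
  have "integrable lborel (fourier (H f))" using fourier_H_integrable[OF f, of 0] by simp
  from fourier_inversion[OF H_integrable[OF f] this] show ?thesis
  proof eventually_elim
    case (elim x)
    have c: "complex_of_real ((2 * pi) ^ DIM('a)) \<noteq> 0" by simp
    show ?case unfolding repr_def elim[symmetric] mult.assoc[symmetric] left_inverse[OF c] by simp
  qed
qed

lemma repr_bound:
  "\<exists>K C. C \<ge> 0 \<and> (\<forall>f\<in>schwartz. \<forall>x. norm (repr f x) \<le> C * schwartz_norm K f)"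
proof -
  let ?n = "2 * DIM('a)"
  obtain K C where C: "C \<ge> 0" "\<And>f \<xi>. f \<in> schwartz \<Longrightarrow> (1 + norm \<xi>) ^ (0 + ?n) * norm (fourier (H f) \<xi>) \<le> C * schwartz_norm K f"
    using fourier_H_decay[of "0 + ?n"] by blast
  define I where "I = (LINT x|lborel. inverse ((1 + norm (x::'a)) ^ ?n))"
  let ?c = "norm (inverse (of_real ((2 * pi) ^ DIM('a))) :: complex)"
  have "norm (repr f x) \<le> (?c * (C * I)) * schwartz_norm K f" if f: "f \<in> schwartz" for f x
  proof -
    have "norm (LINT \<xi>|lborel. fourier (H f) \<xi> * cis (\<xi> \<bullet> x)) \<le> (LINT \<xi>::'a|lborel. C * schwartz_norm K f * inverse ((1 + norm \<xi>) ^ ?n))"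
    proof (rule norm_integral_le)
      show "integrable lborel (\<lambda>\<xi>::'a. C * schwartz_norm K f * inverse ((1 + norm \<xi>) ^ ?n))"
        by (intro integrable_mult_right integrable_inverse_one_plus_norm_power) simp
      show "norm (fourier (H f) \<xi> * cis (\<xi> \<bullet> x)) \<le> C * schwartz_norm K f * inverse ((1 + norm \<xi>) ^ ?n)" for \<xi>
        using norm_le_of_weighted[OF C(2)[OF f, of \<xi>]] by (simp add: norm_mult)
    qed
    also have "\<dots> = (C * I) * schwartz_norm K f" by (simp add: I_def mult_ac)
    finally have "?c * norm (LINT \<xi>|lborel. fourier (H f) \<xi> * cis (\<xi> \<bullet> x)) \<le> ?c * ((C * I) * schwartz_norm K f)"
      by (intro mult_left_mono) auto
    then show ?thesis unfolding repr_def norm_mult by (simp only: mult.assoc)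
  qed
  moreover have "0 \<le> ?c * (C * I)" using C(1) unfolding I_def by (intro mult_nonneg_nonneg integral_nonneg) auto
  ultimately show ?thesis by blast
qed

text \<open>The estimate |exp (i t) - 1 - i t| <= t^2 / 2 gives a quadratic error with majorant (1 +
  |\<xi>|)^2 times the transform. The factor i (\<xi> \<bullet> b) is absorbed by
  \<open>fourier_H_D\<close>, so the partial derivatives are again values of
  \<open>repr\<close>.\<close>

lemma repr_has_derivative:
  assumes f: "f \<in> schwartz"
  shows "(repr f has_derivative (\<lambda>h. \<Sum>b\<in>Basis. (h \<bullet> b) *\<^sub>R repr (D b f) x)) (at x)"
proof -
  note m = fourier_H_measurable[OF f, measurable]
  let ?F = "fourier (H f)"
  let ?g = "\<lambda>b \<xi>. fourier (H (D b f)) \<xi> * cis (\<xi> \<bullet> x)"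
  have Df: "D b f \<in> schwartz" if "b \<in> Basis" for b by (rule schwartz_cont_op_in[OF D_cont[OF that] f])
  have i: "integrable lborel (?g b)" if "b \<in> Basis" for b
    using fourier_H_integrable[OF Df[OF that], of 0] by (intro integrable_cis_mult) auto
  let ?f' = "\<lambda>h \<xi>. \<Sum>b\<in>Basis. (h \<bullet> b) *\<^sub>R ?g b \<xi>"
  have "((\<lambda>x. LINT \<xi>|lborel. ?F \<xi> * cis (\<xi> \<bullet> x)) has_derivative (\<lambda>h. LINT \<xi>|lborel. ?f' h \<xi>)) (at x)"
  proof (rule has_derivative_integral_quadratic)
    show "integrable lborel (\<lambda>\<xi>. ?F \<xi> * cis (\<xi> \<bullet> x))" for x
      using fourier_H_integrable[OF f, of 0] by (intro integrable_cis_mult) auto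
    show "integrable lborel (?f' h)" for h
      by (intro Bochner_Integration.integrable_sum integrable_scaleR_right i)
    show "linear (\<lambda>h. ?f' h \<xi>)" for \<xi>
      by (intro linearI) (simp_all add: inner_add_left scaleR_add_left sum.distrib scaleR_sum_right)
    have "integrable lborel (\<lambda>\<xi>. norm ((1 + norm \<xi>) ^ 2 *\<^sub>R ?F \<xi>))"
      by (intro integrable_norm fourier_H_integrable f)
    then show "integrable lborel (\<lambda>\<xi>. (1 + norm \<xi>) ^ 2 * norm (?F \<xi>))" by simp
    fix h \<xi>
    have f': "?f' h \<xi> = ?F \<xi> * cis (\<xi> \<bullet> x) * (\<i> * of_real (\<xi> \<bullet> h))"
    proof -
      have "?f' h \<xi> = (\<Sum>b\<in>Basis. (?F \<xi> * cis (\<xi> \<bullet> x) * \<i>) * of_real ((\<xi> \<bullet> b) * (h \<bullet> b)))"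
        by (intro sum.cong refl) (simp add: fourier_H_D[OF _ f] scaleR_conv_of_real mult_ac)
      also have "\<dots> = (?F \<xi> * cis (\<xi> \<bullet> x) * \<i>) * of_real (\<xi> \<bullet> h)"
        unfolding euclidean_inner[of \<xi> h] by (simp only: sum_distrib_left of_real_sum)
      finally show ?thesis by (simp only: mult.assoc)
    qed
    have "?F \<xi> * cis (\<xi> \<bullet> (x + h)) - ?F \<xi> * cis (\<xi> \<bullet> x) - ?f' h \<xi>
       = ?F \<xi> * cis (\<xi> \<bullet> x) * (cis (\<xi> \<bullet> h) - (1 + \<i> * of_real (\<xi> \<bullet> h)))"
      unfolding f' by (simp add: inner_add_right cis_mult[symmetric] algebra_simps)
    also have "norm \<dots> = norm (?F \<xi>) * norm (cis (\<xi> \<bullet> h) - (1 + \<i> * of_real (\<xi> \<bullet> h)))"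
      by (simp add: norm_mult)
    also have "\<dots> \<le> norm (?F \<xi>) * ((norm h)\<^sup>2 * (1 + norm \<xi>)\<^sup>2)"
    proof (intro mult_left_mono)
      have "norm (cis (\<xi> \<bullet> h) - (1 + \<i> * of_real (\<xi> \<bullet> h))) \<le> \<bar>\<xi> \<bullet> h\<bar>\<^sup>2 / 2"
        using iexp_approx1[of "\<xi> \<bullet> h" 1] by (simp add: cis_conv_exp numeral_2_eq_2)
      also have "\<dots> \<le> \<bar>\<xi> \<bullet> h\<bar>\<^sup>2" by simp
      also have "\<dots> \<le> ((1 + norm \<xi>) * norm h)\<^sup>2"
        using Cauchy_Schwarz_ineq2[of \<xi> h] by (intro power_mono) (auto simp: distrib_right intro: add_increasing)
      finally show "norm (cis (\<xi> \<bullet> h) - (1 + \<i> * of_real (\<xi> \<bullet> h))) \<le> (norm h)\<^sup>2 * (1 + norm \<xi>)\<^sup>2"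
        by (simp only: power_mult_distrib mult.commute)
    qed simp
    finally show "norm (?F \<xi> * cis (\<xi> \<bullet> (x + h)) - ?F \<xi> * cis (\<xi> \<bullet> x) - ?f' h \<xi>) \<le> (norm h)\<^sup>2 * ((1 + norm \<xi>) ^ 2 * norm (?F \<xi>))"
      by (simp only: mult_ac)
  qed
  from has_derivative_mult_right[OF this, of "inverse (of_real ((2 * pi) ^ DIM('a)))"]
  have "(repr f has_derivative (\<lambda>h. inverse (of_real ((2 * pi) ^ DIM('a))) * (LINT \<xi>|lborel. ?f' h \<xi>))) (at x)"
    by (simp only: repr_def[abs_def])
  moreover have "inverse (of_real ((2 * pi) ^ DIM('a))) * (LINT \<xi>|lborel. ?f' h \<xi>) = (\<Sum>b\<in>Basis. (h \<bullet> b) *\<^sub>R repr (D b f) x)" for h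
  proof -
    have "(LINT \<xi>|lborel. ?f' h \<xi>) = (\<Sum>b\<in>Basis. LINT \<xi>|lborel. (h \<bullet> b) *\<^sub>R ?g b \<xi>)"
      by (intro Bochner_Integration.integral_sum integrable_scaleR_right i)
    then show ?thesis by (simp add: repr_def sum_distrib_left del: of_real_power of_real_mult)
  qed
  ultimately show ?thesis by (simp only:)
qed

lemma pd_repr:
  assumes "f \<in> schwartz" "b \<in> Basis"
  shows "pd b (repr f) = repr (D b f)"
  using pd_eqI[OF repr_has_derivative[OF assms(1)], of b] assms(2)
  by (simp add: inner_Basis if_distrib if_distribR sum.delta cong: if_cong)

lemma repr_continuous: "f \<in> schwartz \<Longrightarrow> continuous_on UNIV (repr f)"
  by (intro continuous_at_imp_continuous_on ballI has_derivative_continuous[OF repr_has_derivative])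

text \<open>Almost everywhere this is inherited from \<open>H_M\<close>; continuity of both sides
  extends it to every point, which pointwise decay estimates require.\<close>

lemma repr_M:
  assumes f: "f \<in> schwartz" and b: "b \<in> Basis"
  shows "repr (M b f) = (\<lambda>x. of_real (x \<bullet> b) * repr f x)"
proof (rule continuous_AE_eq)
  have Mf: "M b f \<in> schwartz" by (rule schwartz_cont_op_in[OF M_cont[OF b] f])
  show "continuous_on UNIV (repr (M b f))" by (rule repr_continuous[OF Mf])
  show "continuous_on UNIV (\<lambda>x. of_real (x \<bullet> b) * repr f x)"
    by (intro continuous_intros repr_continuous f)
  show "AE x in lborel. repr (M b f) x = of_real (x \<bullet> b) * repr f x"
    using H_eq_repr[OF Mf] H_eq_repr[OF f] H_M[OF b f] by eventually_elim simp
qed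

lemma repr_M_pow:
  assumes b: "b \<in> Basis" and f: "f \<in> schwartz"
  shows "repr (((M b) ^^ n) f) x = of_real ((x \<bullet> b) ^ n) * repr f x"
proof (induction n)
  case (Suc n)
  have "((M b) ^^ n) f \<in> schwartz" by (rule schwartz_cont_op_in[OF M_pow_cont[OF b] f])
  from repr_M[OF this b] Suc show ?case by simp
qed simp

lemma repr_decay:
  "\<exists>K C. C \<ge> 0 \<and> (\<forall>f\<in>schwartz. \<forall>x. (1 + norm x) ^ N * norm (repr f x) \<le> C * schwartz_norm K f)"
proof -
  obtain N0 C0 where C0: "C0 \<ge> 0" "\<And>f x. f \<in> schwartz \<Longrightarrow> norm (repr f x) \<le> C0 * schwartz_norm N0 f"
    using repr_bound by blast
  obtain K E where E: "E \<ge> 0"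
    "\<And>f. f \<in> schwartz \<Longrightarrow> schwartz_norm N0 f + (\<Sum>b\<in>Basis. schwartz_norm N0 (((M b) ^^ N) f)) \<le> E * schwartz_norm K f"
    using schwartz_norm_add_sum_le[OF finite_Basis, where T="\<lambda>b. (M b) ^^ N" and N=N0, OF M_pow_cont] by blast
  let ?c = "(1 + real DIM('a)) ^ N"
  define B where "B = ?c * (C0 * E)"
  have B0: "B \<ge> 0" unfolding B_def using C0(1) E(1) by (intro mult_nonneg_nonneg) auto
  have "(1 + norm x) ^ N * norm (repr f x) \<le> B * schwartz_norm K f" if f: "f \<in> schwartz" for f x
  proof -
    have "(1 + norm x) ^ N * norm (repr f x) \<le> (?c * (1 + (\<Sum>b\<in>Basis. \<bar>x \<bullet> b\<bar> ^ N))) * norm (repr f x)"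
      by (intro mult_right_mono one_plus_norm_power_le) auto
    also have "\<dots> = ?c * (norm (repr f x) + (\<Sum>b\<in>Basis. norm (repr (((M b) ^^ N) f) x)))"
      by (simp add: repr_M_pow[OF _ f] norm_mult norm_power sum_distrib_left sum_distrib_right distrib_left distrib_right mult_ac power_abs)
    also have "\<dots> \<le> ?c * (C0 * schwartz_norm N0 f + (\<Sum>b\<in>Basis. C0 * schwartz_norm N0 (((M b) ^^ N) f)))"
    proof (intro mult_left_mono add_mono sum_mono)
      show "norm (repr f x) \<le> C0 * schwartz_norm N0 f" by (rule C0(2)[OF f])
      show "norm (repr (((M b) ^^ N) f) x) \<le> C0 * schwartz_norm N0 (((M b) ^^ N) f)" if "b \<in> Basis" for b
        by (rule C0(2)[OF schwartz_cont_op_in[OF M_pow_cont[OF that] f]])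
    qed auto
    also have "\<dots> = ?c * (C0 * (schwartz_norm N0 f + (\<Sum>b\<in>Basis. schwartz_norm N0 (((M b) ^^ N) f))))"
      by (simp only: distrib_left sum_distrib_left)
    also have "\<dots> \<le> ?c * (C0 * (E * schwartz_norm K f))"
      by (intro mult_left_mono E f C0(1)) auto
    also have "\<dots> = B * schwartz_norm K f"
      by (simp only: B_def mult.assoc)
    finally show ?thesis .
  qed
  then show ?thesis using B0 by blast
qed

text \<open>Since \<open>pd b (repr f)\<close> is \<open>repr (D b f)\<close>, the image of the
  Schwartz space under \<open>repr\<close> is itself a closed family.\<close>

lemma repr_schwartz:
  assumes "f \<in> schwartz"
  shows "repr f \<in> schwartz"
proof -
  have "repr f \<in> {repr f | f. f \<in> schwartz}" using assms by blast
  then show ?thesis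
  proof (induction rule: schwartz_coinduct)
    case (differentiable f x)
    then show ?case using repr_has_derivative unfolding differentiable_def by blast
  next
    case (pd f b)
    then show ?case using pd_repr schwartz_cont_op_in[OF D_cont] by blast
  next
    case (decay f k)
    then show ?case using repr_decay[of k] by blast
  qed
qed

lemma D_list_cont: "set bs \<subseteq> Basis \<Longrightarrow> schwartz_cont_op (foldr D bs)"
proof (induction bs)
  case Nil
  show ?case using schwartz_cont_op_id by (simp add: id_def)
next
  case (Cons b bs)
  then show ?case using schwartz_cont_op_comp[OF D_cont[of b], of "foldr D bs"] by (simp add: o_def)
qed

lemma iter_pd_repr:
  assumes f: "f \<in> schwartz" and "set bs \<subseteq> Basis"
  shows "iter_pd bs (repr f) = repr (foldr D bs f)"
  using assms(2)
proof (induction bs)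
  case (Cons b bs)
  then show ?case
    using pd_repr[OF schwartz_cont_op_in[OF D_list_cont f], of bs b] by (simp add: pd_def)
qed simp

lemma repr_cont: "schwartz_cont_op repr"
proof (rule schwartz_cont_opI)
  fix bs :: "'a list" and N assume bs: "set bs \<subseteq> Basis"
  obtain K C where C: "C \<ge> 0" "\<And>f x. f \<in> schwartz \<Longrightarrow> (1 + norm x) ^ N * norm (repr f x) \<le> C * schwartz_norm K f"
    using repr_decay[of N] by blast
  obtain L E where E: "E \<ge> 0" "\<And>f. f \<in> schwartz \<Longrightarrow> schwartz_norm K (foldr D bs f) \<le> E * schwartz_norm L f"
    using schwartz_cont_op_bound[OF D_list_cont[OF bs], where N=K] by metis
  have "(1 + norm x) ^ N * norm (iter_pd bs (repr f) x) \<le> (C * E) * schwartz_norm L f" if f: "f \<in> schwartz" for f x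
    unfolding iter_pd_repr[OF f bs]
    using C(2)[OF schwartz_cont_op_in[OF D_list_cont[OF bs] f], of x] mult_left_mono[OF E(2)[OF f] C(1)]
    by (simp add: mult.assoc)
  then show "\<exists>K C. \<forall>f\<in>schwartz. \<forall>x. (1 + norm x) ^ N * norm (iter_pd bs (repr f) x) \<le> C * schwartz_norm K f"
    by blast
qed (rule repr_schwartz)

end

subsection \<open>Metaplectic operators\<close>

lemma AE_translate:
  fixes f g :: "'a::euclidean_space \<Rightarrow> complex"
  assumes "AE x in lborel. f x = g x" "f \<in> borel_measurable borel" "g \<in> borel_measurable borel"
  shows "AE x in lborel. f (x - y) = g (x - y)"
proof -
  note assms(2,3)[measurable]
  have "AE x in distr lborel borel ((+) (- y)). f x = g x"
    using assms(1) by (subst lborel_distr_plus)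
  then have "AE x in lborel. f (- y + x) = g (- y + x)"
    by (subst (asm) AE_distr_iff) auto
  then show ?thesis by simp
qed

lemma L2_rho: "f \<in> L2 \<Longrightarrow> rho w \<tau> f \<in> L2"
proof -
  assume f: "f \<in> L2"
  have [measurable]: "f \<in> borel_measurable borel" by (rule L2_measurable[OF f])
  show ?thesis
  proof (rule L2_I)
    show "rho w \<tau> f \<in> borel_measurable borel"
      unfolding rho_def modulate_def translate_def by measurable
    have "(norm (rho w \<tau> f x))\<^sup>2 = (\<lambda>x. (norm (f x))\<^sup>2) (x + - upper w)" for x
      by (simp add: rho_def modulate_def translate_def norm_mult)
    then show "integrable lborel (\<lambda>x. (norm (rho w \<tau> f x))\<^sup>2)"
      using L2_integrable[OF f] lborel_integrable_translate[of "\<lambda>x. (norm (f x))\<^sup>2" "- upper w"] by simp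
  qed
qed

lemma rho_AE_cong:
  assumes "AE x in lborel. f x = g x" "f \<in> L2" "g \<in> L2"
  shows "AE x in lborel. rho w \<tau> f x = rho w \<tau> g x"
  using AE_translate[OF assms(1) L2_measurable[OF assms(2)] L2_measurable[OF assms(3)], of "upper w"]
  unfolding rho_def modulate_def translate_def by eventually_elim simp

lemma schwartz_rho:
  assumes "f \<in> schwartz"
  shows "rho w \<tau> f \<in> schwartz"
proof -
  have "rho w \<tau> f = (\<lambda>x. (cis (2 * pi * \<tau>) * cis (- pi * (lower w \<bullet> upper w))) * (cis (((2 * pi) *\<^sub>R lower w) \<bullet> x) * f (x - upper w)))"
    by (simp add: rho_def modulate_def translate_def fun_eq_iff mult.assoc)
  moreover have "\<dots> \<in> schwartz"
    by (intro schwartz_cmult schwartz_cis_mult schwartz_translate assms)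
  ultimately show ?thesis by simp
qed

text \<open>The infinitesimal generator of \<open>s \<mapsto> rho (s w) 0\<close>.\<close>

definition rho_gen :: "real^('n::finite + 'n) \<Rightarrow> (real^'n \<Rightarrow> complex) \<Rightarrow> real^'n \<Rightarrow> complex" where
  "rho_gen w f = (\<lambda>x. 2 * pi * \<i> * (of_real (x \<bullet> lower w) * f x) + (\<Sum>b\<in>Basis. of_real (- (upper w \<bullet> b)) * pd b f x))"

lemma schwartz_cont_op_rho_gen: "schwartz_cont_op (rho_gen w)"
  unfolding rho_gen_def[abs_def]
  by (intro schwartz_cont_op_add schwartz_cont_op_sum finite_Basis
      schwartz_cont_op_comp[OF schwartz_cont_op_cmult schwartz_cont_op_coord_mult]
      schwartz_cont_op_comp[OF schwartz_cont_op_cmult schwartz_cont_op_pd])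

text \<open>The phase built into \<open>rho\<close> makes s -> rho (s w) a one-parameter group: with
  u and l the halves of w, the total phase \<theta> has derivative 2 pi l \<bullet> (x - s u), a
  function of the translated point. So the derivative is the same operator applied to
  \<open>rho_gen w f\<close>.\<close>

lemma rho_scale_has_vector_derivative:
  fixes f :: "real^'n::finite \<Rightarrow> complex"
  assumes f: "f \<in> schwartz"
  shows "((\<lambda>s. rho (s *\<^sub>R w) 0 f x) has_vector_derivative
    cis (- pi * ((s *\<^sub>R lower w) \<bullet> (s *\<^sub>R upper w))) * cis (2 * pi * ((s *\<^sub>R lower w) \<bullet> x)) * rho_gen w f (x - s *\<^sub>R upper w)) (at s)"
proof -
  define l u where "l = lower w" and "u = upper w"
  have lu: "lower (s *\<^sub>R w) = s *\<^sub>R l" "upper (s *\<^sub>R w) = s *\<^sub>R u" for s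
    by (simp_all add: l_def u_def lower_def upper_def vec_eq_iff)
  define \<theta> where "\<theta> s = - pi * (s\<^sup>2 * (l \<bullet> u)) + 2 * pi * (s * (l \<bullet> x))" for s
  have rho: "rho (s *\<^sub>R w) 0 f x = cis (\<theta> s) * f (x - s *\<^sub>R u)" for s
    by (simp add: rho_def modulate_def translate_def lu cis_mult \<theta>_def power2_eq_square mult_ac)
  have c: "((\<lambda>s. cis (\<theta> s)) has_vector_derivative cis (\<theta> s) * (\<i> * of_real (2 * pi * (l \<bullet> (x - s *\<^sub>R u))))) (at s)"
  proof -
    have "(\<theta> has_real_derivative 2 * pi * (l \<bullet> (x - s *\<^sub>R u))) (at s)"
      unfolding \<theta>_def by (auto intro!: derivative_eq_intros simp: inner_diff_right algebra_simps)
    then have "((\<lambda>s. \<i> * of_real (\<theta> s)) has_vector_derivative \<i> * of_real (2 * pi * (l \<bullet> (x - s *\<^sub>R u)))) (at s)"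
      by (intro has_vector_derivative_mult_right has_vector_derivative_of_real) (simp add: has_real_derivative_iff_has_vector_derivative)
    from field_vector_diff_chain_at[OF this DERIV_exp] show ?thesis
      by (simp add: o_def cis_conv_exp mult_ac)
  qed
  have d: "((\<lambda>s. f (x - s *\<^sub>R u)) has_vector_derivative (\<Sum>b\<in>Basis. of_real (- (u \<bullet> b)) * pd b f (x - s *\<^sub>R u))) (at s)"
  proof -
    have "((\<lambda>s. x - s *\<^sub>R u) has_derivative (\<lambda>h. - (h *\<^sub>R u))) (at s)" by (auto intro!: derivative_eq_intros)
    from has_derivative_compose[OF this schwartz_has_derivative[OF f]]
    have "((\<lambda>s. f (x - s *\<^sub>R u)) has_derivative (\<lambda>h. \<Sum>b\<in>Basis. (- (h *\<^sub>R u) \<bullet> b) *\<^sub>R pd b f (x - s *\<^sub>R u))) (at s)" .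
    moreover have "(- (h *\<^sub>R u) \<bullet> b) *\<^sub>R z = h *\<^sub>R (of_real (- (u \<bullet> b)) * z)" for h b and z :: complex
      by (simp add: scaleR_conv_of_real[where 'a=complex])
    ultimately show ?thesis
      unfolding has_vector_derivative_def scaleR_sum_right by (simp only:)
  qed
  have "((\<lambda>s. cis (\<theta> s) * f (x - s *\<^sub>R u)) has_vector_derivative
      cis (\<theta> s) * rho_gen w f (x - s *\<^sub>R u)) (at s)"
    using has_vector_derivative_mult[OF c d]
    by (rule has_vector_derivative_eq_rhs)
      (simp add: rho_gen_def l_def[symmetric] u_def[symmetric] inner_commute algebra_simps)
  moreover have "cis (\<theta> s) = cis (- pi * ((s *\<^sub>R l) \<bullet> (s *\<^sub>R u))) * cis (2 * pi * ((s *\<^sub>R l) \<bullet> x))"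
    by (simp add: cis_mult \<theta>_def power2_eq_square mult_ac)
  ultimately show ?thesis unfolding rho[abs_def] l_def u_def by (simp only:)
qed

text \<open>Dominated convergence: the quotients converge to the generator pointwise, and the mean
  value inequality bounds them by values of \<open>rho_gen w f\<close> at points shifted by at most
  the length of \<open>upper w\<close>.\<close>

lemma rho_difference_quotient:
  fixes f :: "real^'n::finite \<Rightarrow> complex" and w
  assumes f: "f \<in> schwartz"
  defines "Q \<equiv> \<lambda>n x. of_real (real (Suc n)) * (rho ((1 / real (Suc n)) *\<^sub>R w) 0 f x - f x) - rho_gen w f x"
  shows "(\<lambda>n. L2_norm (Q n)) \<longlonglongrightarrow> 0"
proof -
  let ?s = "\<lambda>n. 1 / real (Suc n)"
  have s0: "?s \<longlonglongrightarrow> 0" by (rule LIMSEQ_Suc[OF lim_1_over_n])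
  define u where "u = upper w"
  have G: "rho_gen w f \<in> schwartz" by (rule schwartz_cont_op_in[OF schwartz_cont_op_rho_gen f])
  let ?k = "DIM(real^'n)"
  obtain K where K: "K > 0" "\<And>p. (1 + norm p) ^ (0 + ?k) * norm (rho_gen w f p) \<le> K"
    using schwartz_decay[OF G] by (metis add_0)
  \<comment> \<open>A shift by at most |u| costs a factor (1 + |u|)^k in the weight. The exponent k
    is the dimension, so that the majorant is square integrable.\<close>
  define C where "C = K * (1 + norm u) ^ ?k"
  have bound: "norm (rho_gen w f (x - t *\<^sub>R u)) \<le> C * inverse ((1 + norm x) ^ ?k)" if "0 \<le> t" "t \<le> 1" for x t
  proof -
    let ?p = "x - t *\<^sub>R u"
    have "norm x \<le> norm ?p + norm (t *\<^sub>R u)" by (metis diff_add_cancel norm_triangle_ineq)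
    also have "\<dots> \<le> norm ?p + norm u" using that by (simp add: mult_left_le_one_le)
    finally have "1 + norm x \<le> (1 + norm ?p) + norm u" by simp
    also have "\<dots> \<le> (1 + norm ?p) * (1 + norm u)"
      using mult_nonneg_nonneg[OF norm_ge_zero[of ?p] norm_ge_zero[of u]]
      unfolding distrib_left distrib_right mult_1_left mult_1_right by linarith
    finally have "(1 + norm x) ^ ?k \<le> ((1 + norm ?p) * (1 + norm u)) ^ ?k" by (intro power_mono) auto
    then have "(1 + norm x) ^ (0 + ?k) * norm (rho_gen w f ?p) \<le> ((1 + norm ?p) * (1 + norm u)) ^ ?k * norm (rho_gen w f ?p)"
      by (simp add: mult_right_mono)
    also have "\<dots> = (1 + norm u) ^ ?k * ((1 + norm ?p) ^ (0 + ?k) * norm (rho_gen w f ?p))"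
      by (simp add: power_mult_distrib)
    also have "\<dots> \<le> (1 + norm u) ^ ?k * K" by (intro mult_left_mono K) auto
    also have "\<dots> = C" by (simp add: C_def)
    finally show ?thesis using norm_le_of_weighted[of x 0 ?k] by simp
  qed
  have lim: "(\<lambda>n. Q n x) \<longlonglongrightarrow> 0" for x
  proof -
    have r0: "rho (0 *\<^sub>R w) 0 f x = f x"
      by (simp add: rho_def modulate_def translate_def upper_def lower_def zero_vec_def[symmetric])
    have "((\<lambda>s. rho (s *\<^sub>R w) 0 f x) has_vector_derivative rho_gen w f x) (at 0)"
      using rho_scale_has_vector_derivative[OF f, of w x 0] by simp
    then have "((\<lambda>s. norm (rho (s *\<^sub>R w) 0 f x - f x - (s - 0) *\<^sub>R rho_gen w f x) / norm (s - 0)) \<longlongrightarrow> 0) (at 0)"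
      unfolding has_vector_derivative_def has_derivative_iff_norm r0 by blast
    moreover have "filterlim ?s (at 0) sequentially"
      using s0 by (simp add: filterlim_at)
    ultimately have "(\<lambda>n. norm (rho (?s n *\<^sub>R w) 0 f x - f x - (?s n - 0) *\<^sub>R rho_gen w f x) / norm (?s n - 0)) \<longlonglongrightarrow> 0"
      by (rule filterlim_compose)
    moreover have "norm (rho (?s n *\<^sub>R w) 0 f x - f x - (?s n - 0) *\<^sub>R rho_gen w f x) / norm (?s n - 0) = norm (Q n x)" for n
    proof -
      have "Q n x = of_real (real (Suc n)) * (rho (?s n *\<^sub>R w) 0 f x - f x - (?s n - 0) *\<^sub>R rho_gen w f x)"
        by (simp add: Q_def scaleR_conv_of_real right_diff_distrib mult.assoc[symmetric] del: of_nat_Suc)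
      then show ?thesis by (simp add: norm_mult mult.commute del: of_nat_Suc)
    qed
    ultimately show ?thesis by (simp add: tendsto_norm_zero_iff)
  qed
  have Qb: "norm (Q n x) \<le> 2 * C * inverse ((1 + norm x) ^ ?k)" for n x
  proof -
    have "norm (rho (?s n *\<^sub>R w) 0 f x - rho (0 *\<^sub>R w) 0 f x) \<le> (C * inverse ((1 + norm x) ^ ?k)) * norm (?s n - 0)"
    proof (rule differentiable_bound[where S="{0..1}"])
      fix t :: real assume t: "t \<in> {0..1}"
      let ?d = "cis (- pi * ((t *\<^sub>R lower w) \<bullet> (t *\<^sub>R upper w))) * cis (2 * pi * ((t *\<^sub>R lower w) \<bullet> x)) * rho_gen w f (x - t *\<^sub>R upper w)"
      show "((\<lambda>s. rho (s *\<^sub>R w) 0 f x) has_derivative (\<lambda>h. h *\<^sub>R ?d)) (at t within {0..1})"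
        using rho_scale_has_vector_derivative[OF f, of w x t]
        unfolding has_vector_derivative_def by (rule has_derivative_at_withinI)
      show "onorm (\<lambda>h. h *\<^sub>R ?d) \<le> C * inverse ((1 + norm x) ^ ?k)"
      proof (rule onorm_bound)
        have b: "norm ?d \<le> C * inverse ((1 + norm x) ^ ?k)"
          using bound[of t x] t by (simp add: norm_mult u_def)
        then show "0 \<le> C * inverse ((1 + norm x) ^ ?k)" by (rule order_trans[OF norm_ge_zero])
        show "norm (h *\<^sub>R ?d) \<le> C * inverse ((1 + norm x) ^ ?k) * norm h" for h :: real
          using mult_left_mono[OF b, of "norm h"] by (simp add: mult.commute)
      qed
    qed auto
    then have "real (Suc n) * norm (rho (?s n *\<^sub>R w) 0 f x - f x) \<le> real (Suc n) * ((C * inverse ((1 + norm x) ^ ?k)) * ?s n)"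
      by (intro mult_left_mono) (simp_all add: rho_def modulate_def translate_def upper_def lower_def zero_vec_def[symmetric])
    then have 1: "norm (of_real (real (Suc n)) * (rho (?s n *\<^sub>R w) 0 f x - f x)) \<le> C * inverse ((1 + norm x) ^ ?k)"
      unfolding norm_mult norm_of_real by (simp del: of_nat_Suc)
    have 2: "norm (rho_gen w f x) \<le> C * inverse ((1 + norm x) ^ ?k)"
      using bound[of 0 x] by simp
    show ?thesis
      unfolding Q_def by (rule order_trans[OF norm_triangle_ineq4]) (use add_mono[OF 1 2] in \<open>simp only: mult_2 distrib_right\<close>)
  qed
  have Qm [measurable]: "Q n \<in> borel_measurable borel" for n
    unfolding Q_def using schwartz_measurable[OF f] schwartz_measurable[OF G] schwartz_measurable[OF schwartz_rho[OF f]]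
    by measurable
  have "(\<lambda>n. LINT x|lborel. (norm (Q n x))\<^sup>2) \<longlonglongrightarrow> (LINT x::(real^'n)|lborel. (0::real))"
  proof (rule integral_dominated_convergence)
    show "integrable lborel (\<lambda>x::real^'n. (2 * C)\<^sup>2 * inverse ((1 + norm x) ^ (2 * ?k)))"
      by (intro integrable_mult_right integrable_inverse_one_plus_norm_power) simp
    have "(\<lambda>n. (norm (Q n x))\<^sup>2) \<longlonglongrightarrow> (norm (0::complex))\<^sup>2" for x
      by (intro tendsto_power tendsto_norm lim)
    then show "AE x in lborel. (\<lambda>n. (norm (Q n x))\<^sup>2) \<longlonglongrightarrow> 0"
      by simp
    have "(norm (Q n x))\<^sup>2 \<le> (2 * C)\<^sup>2 * inverse ((1 + norm x) ^ (2 * ?k))" for n x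
    proof -
      have "(norm (Q n x))\<^sup>2 \<le> (2 * C * inverse ((1 + norm x) ^ ?k))\<^sup>2"
        by (intro power_mono Qb) auto
      then show ?thesis by (simp only: power_mult_distrib power_inverse power_mult[symmetric] mult.commute)
    qed
    then show "AE x in lborel. norm ((norm (Q n x))\<^sup>2) \<le> (2 * C)\<^sup>2 * inverse ((1 + norm x) ^ (2 * ?k))" for n
      by simp
  qed measurable
  then have "(\<lambda>n. sqrt (LINT x|lborel. (norm (Q n x))\<^sup>2)) \<longlonglongrightarrow> sqrt 0"
    by (intro tendsto_real_sqrt) simp
  then show ?thesis by (simp add: L2_norm_def)
qed

section \<open>Unitary operators and limits of difference quotients\<close>

lemma unitary_L2_norm:
  assumes "unitary_L2 U" "f \<in> L2"
  shows "L2_norm (U f) = L2_norm f"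
proof -
  have "L2_inner (U f) (U f) = L2_inner f f" using assms by (simp add: unitary_L2_def)
  then have "(L2_norm (U f))\<^sup>2 = (L2_norm f)\<^sup>2" unfolding L2_inner_self of_real_eq_iff .
  then show ?thesis by (simp add: L2_norm_nonneg)
qed

lemma unitary_L2_add:
  assumes "unitary_L2 U" "f \<in> L2" "g \<in> L2"
  shows "AE x in lborel. U (\<lambda>x. f x + g x) x = U f x + U g x"
  using assms by (simp add: unitary_L2_def)

lemma unitary_L2_cmult:
  assumes "unitary_L2 U" "f \<in> L2"
  shows "AE x in lborel. U (\<lambda>x. c * f x) x = c * U f x"
  using assms by (simp add: unitary_L2_def)

lemma unitary_L2_diff:
  assumes U: "unitary_L2 U" and f: "f \<in> L2" and g: "g \<in> L2"
  shows "AE x in lborel. U (\<lambda>x. f x - g x) x = U f x - U g x"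
proof -
  have g': "(\<lambda>x. -1 * g x) \<in> L2" by (rule L2_cmult[OF g])
  have "AE x in lborel. U (\<lambda>x. f x + -1 * g x) x = U f x + U (\<lambda>x. -1 * g x) x"
    by (rule unitary_L2_add[OF U f g'])
  moreover have "AE x in lborel. U (\<lambda>x. -1 * g x) x = -1 * U g x"
    by (rule unitary_L2_cmult[OF U g])
  ultimately show ?thesis by eventually_elim simp
qed

lemma unitary_L2_in: "unitary_L2 U \<Longrightarrow> f \<in> L2 \<Longrightarrow> U f \<in> L2"
  by (simp add: unitary_L2_def)

lemma AE_zero_if_L2_norm_zero:
  assumes "f \<in> L2" "L2_norm f = 0"
  shows "AE x in lborel. f x = 0"
proof -
  have "(LINT x|lborel. (norm (f x))\<^sup>2) = 0" using assms(2) by (simp add: L2_norm_def)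
  then have "AE x in lborel. (norm (f x))\<^sup>2 = 0"
    using integral_nonneg_eq_0_iff_AE[OF L2_integrable[OF assms(1)]] by simp
  then show ?thesis by eventually_elim simp
qed

text \<open>Fatou's lemma for the functions |q n|^2; it compares an L2 limit with a pointwise one
  without passing to subsequences.\<close>

lemma AE_zero_if_limit_and_L2_null:
  fixes q :: "nat \<Rightarrow> 'a::euclidean_space \<Rightarrow> complex"
  assumes q: "\<And>n. q n \<in> L2" and null: "(\<lambda>n. L2_norm (q n)) \<longlonglongrightarrow> 0"
    and lim: "AE x in lborel. (\<lambda>n. q n x) \<longlonglongrightarrow> l x" and l: "l \<in> borel_measurable borel"
  shows "AE x in lborel. l x = 0"
proof -
  note l[measurable] L2_measurable[OF q, measurable]
  have "(\<integral>\<^sup>+x. ennreal ((norm (l x))\<^sup>2) \<partial>lborel) = (\<integral>\<^sup>+x. liminf (\<lambda>n. ennreal ((norm (q n x))\<^sup>2)) \<partial>lborel)"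
  proof (rule nn_integral_cong_AE)
    show "AE x in lborel. ennreal ((norm (l x))\<^sup>2) = liminf (\<lambda>n. ennreal ((norm (q n x))\<^sup>2))"
      using lim
    proof eventually_elim
      case (elim x)
      then have "(\<lambda>n. ennreal ((norm (q n x))\<^sup>2)) \<longlonglongrightarrow> ennreal ((norm (l x))\<^sup>2)"
        by (intro tendsto_ennrealI tendsto_power tendsto_norm)
      then show ?case by (intro lim_imp_Liminf[symmetric]) auto
    qed
  qed
  also have "\<dots> \<le> liminf (\<lambda>n. \<integral>\<^sup>+x. ennreal ((norm (q n x))\<^sup>2) \<partial>lborel)"
    by (rule nn_integral_liminf) measurable
  also have "(\<lambda>n. \<integral>\<^sup>+x. ennreal ((norm (q n x))\<^sup>2) \<partial>lborel) = (\<lambda>n. ennreal ((L2_norm (q n))\<^sup>2))"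
    using L2_integrable[OF q] by (simp add: L2_norm_def nn_integral_eq_integral)
  also have "liminf \<dots> = 0"
  proof -
    have "(\<lambda>n. ennreal ((L2_norm (q n))\<^sup>2)) \<longlonglongrightarrow> ennreal (0\<^sup>2)"
      by (intro tendsto_ennrealI tendsto_power null)
    then show ?thesis by (intro lim_imp_Liminf) auto
  qed
  finally have "(\<integral>\<^sup>+x. ennreal ((norm (l x))\<^sup>2) \<partial>lborel) = 0" by simp
  then have "AE x in lborel. ennreal ((norm (l x))\<^sup>2) = 0"
    by (subst (asm) nn_integral_0_iff_AE) auto
  then show ?thesis by eventually_elim simp
qed

lemma cis_difference_quotient:
  "(\<lambda>n. of_real (real (Suc n)) * (cis (a * (1 / real (Suc n))) - 1)) \<longlonglongrightarrow> \<i> * of_real a"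
proof -
  have "(exp has_field_derivative 1) (at (0::complex))" using DERIV_exp[of "0::complex"] by simp
  then have d: "((\<lambda>h. (exp h - 1) / h) \<longlongrightarrow> 1) (at (0::complex))" by (simp add: DERIV_def)
  show ?thesis
  \<comment> \<open>The limit that defines the derivative of \<open>exp\<close> runs over nonzero
    increments, so the case where all of them vanish stands apart.\<close>
  proof (cases "a = 0")
    case False
    let ?h = "\<lambda>n. \<i> * of_real (a * (1 / real (Suc n)))"
    have "(\<lambda>n. a * (1 / real (Suc n))) \<longlonglongrightarrow> a * 0"
      by (intro tendsto_mult tendsto_const LIMSEQ_Suc[OF lim_1_over_n])
    then have "?h \<longlonglongrightarrow> \<i> * of_real 0" by (intro tendsto_mult tendsto_const tendsto_of_real) simp
    then have "filterlim ?h (at 0) sequentially" using False by (simp add: filterlim_at del: of_nat_Suc)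
    from filterlim_compose[OF d this]
    have "(\<lambda>n. (exp (?h n) - 1) / ?h n) \<longlonglongrightarrow> 1" .
    from tendsto_mult_left[OF this, of "\<i> * of_real a"]
    have "(\<lambda>n. \<i> * of_real a * ((exp (?h n) - 1) / ?h n)) \<longlonglongrightarrow> \<i> * of_real a" by simp
    moreover have "\<i> * of_real a * ((exp (?h n) - 1) / ?h n) = of_real (real (Suc n)) * (cis (a * (1 / real (Suc n))) - 1)" for n
      using False by (simp add: cis_conv_exp field_simps del: of_nat_Suc)
    ultimately show ?thesis by simp
  qed simp
qed

definition vec_join :: "real^'n::finite \<Rightarrow> real^'n \<Rightarrow> real^('n + 'n)" where
  "vec_join a b = (\<chi> i. case i of Inl j \<Rightarrow> a $ j | Inr j \<Rightarrow> b $ j)"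

lemma upper_vec_join [simp]: "upper (vec_join a b) = a"
  by (simp add: upper_def vec_join_def vec_eq_iff)

lemma lower_vec_join [simp]: "lower (vec_join a b) = b"
  by (simp add: lower_def vec_join_def vec_eq_iff)

lemma upper_scaleR: "upper (s *\<^sub>R w) = s *\<^sub>R upper w"
  by (simp add: upper_def vec_eq_iff)

lemma lower_scaleR: "lower (s *\<^sub>R w) = s *\<^sub>R lower w"
  by (simp add: lower_def vec_eq_iff)

lemma metaplectic_rho:
  assumes "metaplectic A U" "f \<in> L2"
  shows "AE t in lborel. U (rho w \<tau> f) t = rho (A *v w) \<tau> (U f) t"
  using assms by (simp add: metaplectic_def)

text \<open>An isometry preserves the L2 convergence of the quotients of \<open>f\<close>, and
  intertwining rewrites their images as quotients of \<open>U f\<close> along \<open>A *v w\<close>.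
  This is how the smoothness of \<open>f\<close> reaches \<open>U f\<close>, whose own smoothness is
  still unknown.\<close>

lemma metaplectic_difference_quotient:
  fixes U :: "(real^'n::finite \<Rightarrow> complex) \<Rightarrow> real^'n \<Rightarrow> complex" and w
  assumes U: "metaplectic A U" and f: "f \<in> schwartz"
  defines "Q \<equiv> \<lambda>n x. of_real (real (Suc n)) * (rho ((1 / real (Suc n)) *\<^sub>R w) 0 f x - f x) - rho_gen w f x"
  shows "Q n \<in> L2" "U (Q n) \<in> L2" "(\<lambda>n. L2_norm (U (Q n))) \<longlonglongrightarrow> 0"
    and "AE x in lborel. U (Q n) x = of_real (real (Suc n)) * (rho ((1 / real (Suc n)) *\<^sub>R (A *v w)) 0 (U f) x - U f x) - U (rho_gen w f) x"
proof -
  have u: "unitary_L2 U" using U by (simp add: metaplectic_def)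
  have f2: "f \<in> L2" by (rule schwartz_L2[OF f])
  have g2: "rho_gen w f \<in> L2" by (rule schwartz_L2[OF schwartz_cont_op_in[OF schwartz_cont_op_rho_gen f]])
  let ?r = "\<lambda>n. rho ((1 / real (Suc n)) *\<^sub>R w) 0 f"
  have r2: "?r n \<in> L2" for n by (rule L2_rho[OF f2])
  have d2: "(\<lambda>x. ?r n x - f x) \<in> L2" for n by (rule L2_diff[OF r2 f2])
  show Q2: "Q n \<in> L2" for n unfolding Q_def by (intro L2_diff L2_cmult r2 f2 g2)
  then show "U (Q n) \<in> L2" by (rule unitary_L2_in[OF u])
  show "(\<lambda>n. L2_norm (U (Q n))) \<longlonglongrightarrow> 0"
    unfolding unitary_L2_norm[OF u Q2] unfolding Q_def by (rule rho_difference_quotient[OF f])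
  have "AE x in lborel. U (Q n) x = U (\<lambda>x. of_real (real (Suc n)) * (?r n x - f x)) x - U (rho_gen w f) x"
    unfolding Q_def by (rule unitary_L2_diff[OF u L2_cmult[OF d2] g2])
  moreover have "AE x in lborel. U (\<lambda>x. of_real (real (Suc n)) * (?r n x - f x)) x = of_real (real (Suc n)) * U (\<lambda>x. ?r n x - f x) x"
    by (rule unitary_L2_cmult[OF u d2])
  moreover have "AE x in lborel. U (\<lambda>x. ?r n x - f x) x = U (?r n) x - U f x"
    by (rule unitary_L2_diff[OF u r2 f2])
  moreover have "AE x in lborel. U (?r n) x = rho ((1 / real (Suc n)) *\<^sub>R (A *v w)) 0 (U f) x"
    using metaplectic_rho[OF U f2, of "(1 / real (Suc n)) *\<^sub>R w" 0] by (simp add: matrix_vector_mult_scaleR)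
  ultimately show "AE x in lborel. U (Q n) x = of_real (real (Suc n)) * (rho ((1 / real (Suc n)) *\<^sub>R (A *v w)) 0 (U f) x - U f x) - U (rho_gen w f) x"
    by eventually_elim simp
qed

text \<open>Without a translation part, \<open>rho\<close> along \<open>A *v w\<close> only
  multiplies \<open>U f\<close> by a phase, so its quotients converge at every point. Their
  difference to \<open>U (rho_gen w f)\<close> tends to 0 in L2, and Fatou identifies the two limits
  almost everywhere.\<close>

lemma metaplectic_rho_gen_modulation:
  fixes U :: "(real^'n::finite \<Rightarrow> complex) \<Rightarrow> real^'n \<Rightarrow> complex"
  assumes U: "metaplectic A U" and f: "f \<in> schwartz" and w: "A *v w = vec_join 0 b"
  shows "AE x in lborel. U (rho_gen w f) x = 2 * pi * \<i> * (of_real (x \<bullet> b) * U f x)"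
proof -
  note Q = metaplectic_difference_quotient[OF U f, where w=w]
  let ?Q = "\<lambda>n x. of_real (real (Suc n)) * (rho ((1 / real (Suc n)) *\<^sub>R w) 0 f x - f x) - rho_gen w f x"
  have u: "unitary_L2 U" using U by (simp add: metaplectic_def)
  have m: "U f \<in> borel_measurable borel" "U (rho_gen w f) \<in> borel_measurable borel"
    by (intro L2_measurable unitary_L2_in[OF u] schwartz_L2 schwartz_cont_op_in[OF schwartz_cont_op_rho_gen] f)+
  note m[measurable]
  have "AE x in lborel. \<forall>n. U (?Q n) x = of_real (real (Suc n)) * (rho ((1 / real (Suc n)) *\<^sub>R (A *v w)) 0 (U f) x - U f x) - U (rho_gen w f) x"
    unfolding AE_all_countable using Q(4) by blast
  then have "AE x in lborel. (\<lambda>n. U (?Q n) x) \<longlonglongrightarrow> \<i> * of_real (2 * pi * (b \<bullet> x)) * U f x - U (rho_gen w f) x"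
  proof eventually_elim
    case (elim x)
    have "rho ((1 / real (Suc n)) *\<^sub>R (A *v w)) 0 (U f) x = cis ((2 * pi * (b \<bullet> x)) * (1 / real (Suc n))) * U f x" for n
      by (simp add: w rho_def modulate_def translate_def upper_scaleR lower_scaleR del: of_nat_Suc)
    then have "U (?Q n) x = (of_real (real (Suc n)) * (cis ((2 * pi * (b \<bullet> x)) * (1 / real (Suc n))) - 1)) * U f x - U (rho_gen w f) x" for n
      using elim by (simp add: algebra_simps del: of_nat_Suc)
    then show ?case
      using tendsto_diff[OF tendsto_mult_right[OF cis_difference_quotient[of "2 * pi * (b \<bullet> x)"], of "U f x"] tendsto_const[of "U (rho_gen w f) x"]]
      by (simp only:)
  qed
  from AE_zero_if_limit_and_L2_null[OF Q(2) Q(3) this]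
  have "AE x in lborel. \<i> * of_real (2 * pi * (b \<bullet> x)) * U f x - U (rho_gen w f) x = 0" by measurable
  then show ?thesis by eventually_elim (simp add: inner_commute mult_ac)
qed

lemma L2_inner_rho_translation:
  "L2_inner (rho (vec_join (- v) 0) 0 F) g = L2_inner F (rho (vec_join v 0) 0 g)"
  using lborel_integral_translate[of "\<lambda>x. F x * cnj (g (x - v))" v]
  by (simp add: L2_inner_def rho_def modulate_def translate_def)

text \<open>\<open>U f\<close> is not known to be differentiable, so the translation is moved across
  the inner product onto \<open>g\<close>, whose quotients converge in L2. The sign in
  \<open>vec_join (- b) 0\<close> is due to translation by -b having the derivative along +b as its
  generator.\<close>

lemma metaplectic_rho_gen_translation:
  fixes U :: "(real^'n::finite \<Rightarrow> complex) \<Rightarrow> real^'n \<Rightarrow> complex"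
  assumes U: "metaplectic A U" and f: "f \<in> schwartz" and g: "g \<in> schwartz" and w: "A *v w = vec_join (- b) 0" and b: "b \<in> Basis"
  shows "L2_inner (U (rho_gen w f)) g = - L2_inner (U f) (pd b g)"
proof -
  note Q = metaplectic_difference_quotient[OF U f, where w=w]
  let ?s = "\<lambda>n. 1 / real (Suc n)"
  let ?Q = "\<lambda>n x. of_real (real (Suc n)) * (rho (?s n *\<^sub>R w) 0 f x - f x) - rho_gen w f x"
  let ?v = "vec_join b 0"
  let ?P = "\<lambda>n x. of_real (real (Suc n)) * (rho (?s n *\<^sub>R ?v) 0 g x - g x) - rho_gen ?v g x"
  have u: "unitary_L2 U" using U by (simp add: metaplectic_def)
  have Uf: "U f \<in> L2" by (intro unitary_L2_in[OF u] schwartz_L2 f)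
  have UG: "U (rho_gen w f) \<in> L2"
    by (intro unitary_L2_in[OF u] schwartz_L2 schwartz_cont_op_in[OF schwartz_cont_op_rho_gen] f)
  have g2: "g \<in> L2" by (rule schwartz_L2[OF g])
  have Gg: "rho_gen ?v g \<in> L2" by (intro schwartz_L2 schwartz_cont_op_in[OF schwartz_cont_op_rho_gen] g)
  have P2: "?P n \<in> L2" for n by (intro L2_diff L2_cmult L2_rho g2 Gg)
  have vec_join: "?s n *\<^sub>R (A *v w) = vec_join (- (?s n *\<^sub>R b)) 0" "?s n *\<^sub>R ?v = vec_join (?s n *\<^sub>R b) 0" for n
    unfolding w vec_join_def by (auto simp: vec_eq_iff split: sum.split)
  have "L2_inner (U (?Q n)) g = L2_inner (U f) (?P n) + L2_inner (U f) (rho_gen ?v g) - L2_inner (U (rho_gen w f)) g" for n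
  proof -
    let ?c = "complex_of_real (real (Suc n))"
    have "L2_inner (U (?Q n)) g = L2_inner (\<lambda>x. ?c * (rho (?s n *\<^sub>R (A *v w)) 0 (U f) x - U f x) - U (rho_gen w f) x) g"
      using Q(4)[of n] Uf UG g2 Q(2)[of n]
      by (intro L2_inner_cong_AE) (auto intro!: L2_measurable L2_diff L2_cmult L2_rho)
    also have "\<dots> = ?c * (L2_inner (rho (?s n *\<^sub>R (A *v w)) 0 (U f)) g - L2_inner (U f) g) - L2_inner (U (rho_gen w f)) g"
      by (simp only: L2_inner_diff_left L2_inner_cmult_left L2_diff L2_cmult L2_rho Uf UG g2)
    also have "L2_inner (rho (?s n *\<^sub>R (A *v w)) 0 (U f)) g = L2_inner (U f) (rho (?s n *\<^sub>R ?v) 0 g)"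
      unfolding vec_join by (rule L2_inner_rho_translation)
    also have "?c * (L2_inner (U f) (rho (?s n *\<^sub>R ?v) 0 g) - L2_inner (U f) g) = L2_inner (U f) (?P n) + L2_inner (U f) (rho_gen ?v g)"
      by (simp only: L2_inner_diff_right L2_inner_cmult_right L2_diff L2_cmult L2_rho Uf Gg g2) simp
    finally show ?thesis .
  qed
  moreover have "(\<lambda>n. L2_inner (U (?Q n)) g) \<longlonglongrightarrow> 0"
  proof (rule Lim_null_comparison)
    show "\<forall>\<^sub>F n in sequentially. norm (L2_inner (U (?Q n)) g) \<le> L2_norm (U (?Q n)) * L2_norm g"
      by (intro always_eventually allI norm_L2_inner_le Q g2)
    show "(\<lambda>n. L2_norm (U (?Q n)) * L2_norm g) \<longlonglongrightarrow> 0"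
      by (rule tendsto_mult_left_zero[OF Q(3)])
  qed
  moreover have "(\<lambda>n. L2_inner (U f) (?P n) + L2_inner (U f) (rho_gen ?v g) - L2_inner (U (rho_gen w f)) g)
     \<longlonglongrightarrow> 0 + L2_inner (U f) (rho_gen ?v g) - L2_inner (U (rho_gen w f)) g"
  proof (intro tendsto_add tendsto_diff tendsto_const)
    show "(\<lambda>n. L2_inner (U f) (?P n)) \<longlonglongrightarrow> 0"
    proof (rule Lim_null_comparison)
      show "\<forall>\<^sub>F n in sequentially. norm (L2_inner (U f) (?P n)) \<le> L2_norm (U f) * L2_norm (?P n)"
        by (intro always_eventually allI norm_L2_inner_le Uf P2)
      show "(\<lambda>n. L2_norm (U f) * L2_norm (?P n)) \<longlonglongrightarrow> 0"
        by (rule tendsto_mult_right_zero[OF rho_difference_quotient[OF g]])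
    qed
  qed
  ultimately have "0 = 0 + L2_inner (U f) (rho_gen ?v g) - L2_inner (U (rho_gen w f)) g"
    using LIMSEQ_unique by (simp only:)
  moreover have "rho_gen ?v g = (\<lambda>x. -1 * pd b g x)"
    using b by (simp add: rho_gen_def fun_eq_iff inner_Basis if_distrib if_distribR sum.delta cong: if_cong)
  ultimately show ?thesis using L2_inner_cmult_right[of "U f" "-1" "pd b g"] by simp
qed

text \<open>\<open>A\<close> sends B (0, b) to a pure modulation and B (-b, 0) to a pure
  translation, so the generators at these vectors are the operators that
  \<open>schwartz_regular\<close> asks for. The factor 1 / (2 pi i) removes the constant of the
  modulation.\<close>

lemma metaplectic_schwartz_repr:
  fixes U :: "(real^'n::finite \<Rightarrow> complex) \<Rightarrow> real^'n \<Rightarrow> complex"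
  assumes U: "metaplectic A U" and B: "A ** B = mat 1"
  obtains R where "schwartz_cont_op R" "\<And>f. f \<in> schwartz \<Longrightarrow> AE x in lborel. U f x = R f x"
proof -
  let ?D = "\<lambda>b. rho_gen (B *v vec_join (- b) 0)"
  let ?M = "\<lambda>b f x. inverse (2 * pi * \<i>) * rho_gen (B *v vec_join 0 b) f x"
  have u: "unitary_L2 U" using U by (simp add: metaplectic_def)
  have AB: "A *v (B *v w) = w" for w by (simp add: matrix_vector_mul_assoc B)
  interpret schwartz_regular U ?D ?M
  proof
    show "U f \<in> L2" if "f \<in> schwartz" for f by (intro unitary_L2_in[OF u] schwartz_L2 that)
    show "\<exists>N C. C \<ge> 0 \<and> (\<forall>f\<in>schwartz. L2_norm (U f) \<le> C * schwartz_norm N f)"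
      using L2_norm_schwartz_le unitary_L2_norm[OF u schwartz_L2] by metis
    fix b :: "real^'n" assume b: "b \<in> Basis"
    show "schwartz_cont_op (?D b)" by (rule schwartz_cont_op_rho_gen)
    show "schwartz_cont_op (?M b)"
      by (rule schwartz_cont_op_comp[OF schwartz_cont_op_cmult schwartz_cont_op_rho_gen])
    fix f :: "real^'n \<Rightarrow> complex" assume f: "f \<in> schwartz"
    have "AE x in lborel. U (?M b f) x = inverse (2 * pi * \<i>) * U (rho_gen (B *v vec_join 0 b) f) x"
      by (intro unitary_L2_cmult[OF u] schwartz_L2 schwartz_cont_op_in[OF schwartz_cont_op_rho_gen] f)
    moreover have "AE x in lborel. U (rho_gen (B *v vec_join 0 b) f) x = 2 * pi * \<i> * (of_real (x \<bullet> b) * U f x)"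
      by (rule metaplectic_rho_gen_modulation[OF U f AB])
    ultimately show "AE x in lborel. U (?M b f) x = of_real (x \<bullet> b) * U f x"
      by eventually_elim (simp add: field_simps)
    show "L2_inner (U (?D b f)) g = - L2_inner (U f) (pd b g)" if "g \<in> schwartz" for g
      by (rule metaplectic_rho_gen_translation[OF U f that AB b])
  qed
  show ?thesis using that[OF repr_cont H_eq_repr] .
qed

section \<open>Restriction to Schwartz functions and the inverse operator\<close>

lemma met_schwartz_eqI:
  assumes "g \<in> schwartz" "AE x in lborel. U f x = g x"
  shows "met_schwartz U f = g"
  unfolding met_schwartz_def
proof (rule the_equality)
  fix h assume h: "h \<in> schwartz \<and> (AE x in lborel. U f x = h x)"
  then have "AE x in lborel. h x = g x" using assms(2) by (auto elim: eventually_elim2)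
  then show "h = g"
    using h assms(1) by (intro continuous_AE_eq schwartz_continuous) auto
qed (use assms in simp)

lemma
  fixes U :: "(real^'n::finite \<Rightarrow> complex) \<Rightarrow> real^'n \<Rightarrow> complex"
  assumes U: "metaplectic A U" and B: "A ** B = mat 1"
  shows schwartz_cont_op_met_schwartz: "schwartz_cont_op (met_schwartz U)"
    and AE_met_schwartz: "\<And>f. f \<in> schwartz \<Longrightarrow> AE x in lborel. U f x = met_schwartz U f x"
proof -
  obtain R where R: "schwartz_cont_op R" "\<And>f. f \<in> schwartz \<Longrightarrow> AE x in lborel. U f x = R f x"
    using metaplectic_schwartz_repr[OF U B] by metis
  have eq: "met_schwartz U f = R f" if "f \<in> schwartz" for f
    by (rule met_schwartz_eqI) (fact schwartz_cont_op_in[OF R(1) that], fact R(2)[OF that])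
  show "schwartz_cont_op (met_schwartz U)" using R(1) eq by (simp add: schwartz_cont_op_def)
  show "AE x in lborel. U f x = met_schwartz U f x" if "f \<in> schwartz" for f using R(2) eq that by simp
qed

lemma unitary_L2_AE_inject:
  assumes U: "unitary_L2 U" and f: "f \<in> L2" and g: "g \<in> L2" and eq: "AE x in lborel. U f x = U g x"
  shows "AE x in lborel. f x = g x"
proof -
  have d: "(\<lambda>x. f x - g x) \<in> L2" by (rule L2_diff[OF f g])
  have m: "U (\<lambda>x. f x - g x) \<in> borel_measurable borel" by (rule L2_measurable[OF unitary_L2_in[OF U d]])
  have "AE x in lborel. U (\<lambda>x. f x - g x) x = 0"
    using unitary_L2_diff[OF U f g] eq by eventually_elim simp
  then have "AE x in lborel. (norm (U (\<lambda>x. f x - g x) x))\<^sup>2 = 0" by eventually_elim simp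
  then have "(LINT x|lborel. (norm (U (\<lambda>x. f x - g x) x))\<^sup>2) = 0" by (rule integral_eq_zero_AE)
  then have "L2_norm (U (\<lambda>x. f x - g x)) = 0" by (simp add: L2_norm_def)
  then have "L2_norm (\<lambda>x. f x - g x) = 0" using unitary_L2_norm[OF U d] by simp
  from AE_zero_if_L2_norm_zero[OF d this] show ?thesis by eventually_elim simp
qed

lemma unitary_L2_AE_cong:
  assumes "unitary_L2 U" "f \<in> L2" "g \<in> L2" "AE x in lborel. f x = g x"
  shows "AE x in lborel. U f x = U g x"
  using assms by (simp add: unitary_L2_def)

text \<open>\<open>V\<close> chooses some L2 preimage, which surjectivity provides. As
  \<open>U\<close> is injective up to null sets, each identity for \<open>V\<close> is checked after
  applying \<open>U\<close>, and the intertwining relation is inverted along with the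
  matrix.\<close>

lemma metaplectic_inverse:
  fixes U :: "(real^'n::finite \<Rightarrow> complex) \<Rightarrow> real^'n \<Rightarrow> complex"
  assumes U: "metaplectic A U" and AB: "A ** B = mat 1"
  obtains V where "metaplectic B V"
    "\<And>f. f \<in> L2 \<Longrightarrow> AE x in lborel. U (V f) x = f x" "\<And>f. f \<in> L2 \<Longrightarrow> AE x in lborel. V (U f) x = f x"
proof -
  have u: "unitary_L2 U" using U by (simp add: metaplectic_def)
  define V where "V g = (SOME f. f \<in> L2 \<and> (AE x in lborel. U f x = g x))" for g
  have V: "V g \<in> L2" "AE x in lborel. U (V g) x = g x" if "g \<in> L2" for g
  proof -
    have "\<exists>f. f \<in> L2 \<and> (AE x in lborel. U f x = g x)" using u that by (auto simp: unitary_L2_def)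
    from someI_ex[OF this] show "V g \<in> L2" "AE x in lborel. U (V g) x = g x" unfolding V_def by auto
  qed
  have V_eqI: "AE x in lborel. V g x = f x" if "g \<in> L2" "f \<in> L2" "AE x in lborel. U f x = g x" for f g
  proof (rule unitary_L2_AE_inject[OF u V(1)[OF that(1)] that(2)])
    show "AE x in lborel. U (V g) x = U f x" using V(2)[OF that(1)] that(3) by eventually_elim simp
  qed
  have VU: "AE x in lborel. V (U f) x = f x" if "f \<in> L2" for f
    by (rule V_eqI[OF unitary_L2_in[OF u that] that]) simp
  have "unitary_L2 V"
    unfolding unitary_L2_def
  proof (intro conjI ballI allI impI)
    fix f g :: "real^'n \<Rightarrow> complex" assume f: "f \<in> L2" and g: "g \<in> L2"
    show "AE x in lborel. V f x = V g x" if "AE x in lborel. f x = g x"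
    proof (rule V_eqI[OF f V(1)[OF g]])
      show "AE x in lborel. U (V g) x = f x" using V(2)[OF g] that by eventually_elim simp
    qed
    show "AE x in lborel. V (\<lambda>y. f y + g y) x = V f x + V g x"
    proof (rule V_eqI[OF L2_add[OF f g] L2_add[OF V(1)[OF f] V(1)[OF g]]])
      show "AE x in lborel. U (\<lambda>x. V f x + V g x) x = f x + g x"
        using unitary_L2_add[OF u V(1)[OF f] V(1)[OF g]] V(2)[OF f] V(2)[OF g] by eventually_elim simp
    qed
    have "L2_inner (V f) (V g) = L2_inner (U (V f)) (U (V g))"
      using u V(1)[OF f] V(1)[OF g] by (simp add: unitary_L2_def)
    also have "\<dots> = L2_inner f g"
      by (rule L2_inner_cong_AE[OF V(2)[OF f] V(2)[OF g]]) (intro L2_measurable unitary_L2_in[OF u] V f g)+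
    finally show "L2_inner (V f) (V g) = L2_inner f g" .
  next
    fix f :: "real^'n \<Rightarrow> complex" and c assume f: "f \<in> L2"
    show "AE x in lborel. V (\<lambda>y. c * f y) x = c * V f x"
    proof (rule V_eqI[OF L2_cmult[OF f] L2_cmult[OF V(1)[OF f]]])
      show "AE x in lborel. U (\<lambda>x. c * V f x) x = c * f x"
        using unitary_L2_cmult[OF u V(1)[OF f], of c] V(2)[OF f] by eventually_elim simp
    qed
  next
    fix g :: "real^'n \<Rightarrow> complex" assume g: "g \<in> L2"
    show "\<exists>f\<in>L2. AE x in lborel. V f x = g x"
      using VU[OF g] unitary_L2_in[OF u g] by blast
  qed (rule V(1))
  moreover have "AE t in lborel. V (rho w \<tau> f) t = rho (B *v w) \<tau> (V f) t" if f: "f \<in> L2" for w \<tau> f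
  proof (rule V_eqI[OF L2_rho[OF f] L2_rho[OF V(1)[OF f]]])
    have "AE x in lborel. U (rho (B *v w) \<tau> (V f)) x = rho w \<tau> (U (V f)) x"
      using metaplectic_rho[OF U V(1)[OF f], of "B *v w" \<tau>] by (simp add: matrix_vector_mul_assoc AB)
    moreover have "AE x in lborel. rho w \<tau> (U (V f)) x = rho w \<tau> f x"
      by (rule rho_AE_cong[OF V(2)[OF f] unitary_L2_in[OF u V(1)[OF f]] f])
    ultimately show "AE x in lborel. U (rho (B *v w) \<tau> (V f)) x = rho w \<tau> f x" by eventually_elim simp
  qed
  ultimately have "metaplectic B V" by (simp add: metaplectic_def)
  then show ?thesis using that V(2) VU by blast
qed

lemma symp_J_mult_vec:
  "(symp_J *v x) $ Inl a = x $ Inr a" "(symp_J *v x) $ Inr a = - x $ Inl a"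
  by (simp_all add: matrix_vector_mult_def symp_J_def UNIV_Plus_UNIV[symmetric] sum.Plus if_distribR sum.delta
      if_distrib[of "\<lambda>c. c * _"] sum_negf del: UNIV_Plus_UNIV cong: if_cong)

text \<open>If A x = 0, the symplectic identity gives J x = A^T J (A x) = 0; since J swaps the two
  halves up to sign, x = 0.\<close>

lemma Sp_invertible:
  assumes "A \<in> Sp"
  obtains B where "A ** B = mat 1" "B ** A = mat 1"
proof -
  have "x = 0" if "A *v x = 0" for x
  proof -
    have "symp_J *v x = transpose A *v (symp_J *v (A *v x))"
      using assms by (simp add: Sp_def matrix_vector_mul_assoc matrix_mul_assoc)
    then have J: "symp_J *v x = 0" using that by (simp add: matrix_vector_mult_0_right)
    have "x $ i = 0" for i
      using symp_J_mult_vec[of x] unfolding J by (cases i) (metis neg_equal_0_iff_equal zero_index)+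
    then show ?thesis by (simp add: vec_eq_iff)
  qed
  then obtain B where "B ** A = mat 1" using matrix_left_invertible_ker by blast
  then show ?thesis using that matrix_left_right_inverse by blast
qed

section \<open>Adjoints acting on tempered distributions\<close>

lemma schwartz_norm_cnj:
  assumes "f \<in> schwartz"
  shows "schwartz_norm N (\<lambda>x. cnj (f x)) = schwartz_norm N f"
  unfolding schwartz_norm_def by (intro sum.cong refl) (simp add: iter_pd_cnj[OF assms])

text \<open>The adjoint of \<open>T\<close> for the sesquilinear bracket: pairing it with a Schwartz
  \<psi> is pairing \<open>u\<close> with \<open>T \<psi>\<close>. One notion thus covers
  \<open>met_dist U\<close>, the adjoint of the inverse of \<open>met_schwartz U\<close>, and the
  inverse of \<open>met_dist U\<close>.\<close>

definition schwartz_dual :: "(('a::euclidean_space \<Rightarrow> complex) \<Rightarrow> 'a \<Rightarrow> complex)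
    \<Rightarrow> (('a \<Rightarrow> complex) \<Rightarrow> complex) \<Rightarrow> ('a \<Rightarrow> complex) \<Rightarrow> complex" where
  "schwartz_dual T u = (\<lambda>\<psi>\<in>schwartz. bracket u (T (\<lambda>x. cnj (\<psi> x))))"

lemma schwartz_dual_tempered:
  fixes T :: "('a::euclidean_space \<Rightarrow> complex) \<Rightarrow> 'a \<Rightarrow> complex"
  assumes T: "schwartz_cont_op T"
    and add: "\<And>f g. f \<in> schwartz \<Longrightarrow> g \<in> schwartz \<Longrightarrow> T (\<lambda>x. f x + g x) = (\<lambda>x. T f x + T g x)"
    and cmult: "\<And>c f. f \<in> schwartz \<Longrightarrow> T (\<lambda>x. c * f x) = (\<lambda>x. c * T f x)"
    and u: "u \<in> tempered"
  shows "schwartz_dual T u \<in> tempered"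
proof -
  \<comment> \<open>Conjugation before and after \<open>T\<close>: a scalar is conjugated twice, so
    \<open>?S\<close> is complex linear, as \<open>tempered\<close> requires of the
    composition.\<close>
  let ?S = "\<lambda>f x. cnj (T (\<lambda>x. cnj (f x)) x)"
  have S: "?S f \<in> schwartz" if "f \<in> schwartz" for f
    by (intro schwartz_cnj schwartz_cont_op_in[OF T] that)
  have eq: "schwartz_dual T u f = u (?S f)" if "f \<in> schwartz" for f
    using that by (simp add: schwartz_dual_def bracket_def)
  obtain N C where C: "C \<ge> 0" "\<And>f. f \<in> schwartz \<Longrightarrow> norm (u f) \<le> C * schwartz_norm N f"
    using tempered_bound[OF u] by metis
  obtain M E where E: "E \<ge> 0" "\<And>f. f \<in> schwartz \<Longrightarrow> schwartz_norm N (T f) \<le> E * schwartz_norm M f"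
    using schwartz_cont_op_bound[OF T] by metis
  have "norm (u (?S f)) \<le> (C * E) * schwartz_norm M f" if f: "f \<in> schwartz" for f
  proof -
    have "schwartz_norm N (?S f) = schwartz_norm N (T (\<lambda>x. cnj (f x)))"
      by (intro schwartz_norm_cnj schwartz_cont_op_in[OF T] schwartz_cnj f)
    also have "\<dots> \<le> E * schwartz_norm M f"
      using E(2)[OF schwartz_cnj[OF f]] by (simp add: schwartz_norm_cnj[OF f])
    finally have "norm (u (?S f)) \<le> C * (E * schwartz_norm M f)"
      by (intro order_trans[OF C(2)[OF S[OF f]] mult_left_mono] C(1))
    then show ?thesis by (simp only: mult.assoc)
  qed
  moreover have "schwartz_dual T u (\<lambda>x. f x + g x) = schwartz_dual T u f + schwartz_dual T u g"
    if f: "f \<in> schwartz" and g: "g \<in> schwartz" for f g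
    using tempered_add[OF u S[OF f] S[OF g]] add[OF schwartz_cnj[OF f] schwartz_cnj[OF g]]
    by (simp add: eq f g schwartz_add)
  moreover have "schwartz_dual T u (\<lambda>x. c * f x) = c * schwartz_dual T u f" if f: "f \<in> schwartz" for f c
    using tempered_cmult[OF u S[OF f], of c] cmult[OF schwartz_cnj[OF f], of "cnj c"]
    by (simp add: eq f schwartz_cmult)
  moreover have "schwartz_dual T u \<in> extensional schwartz" by (simp add: schwartz_dual_def)
  ultimately show ?thesis unfolding tempered_def using eq by auto
qed

text \<open>Adjoints compose in the reverse order, which is why the hypothesis is about
  \<open>S (T f)\<close>. Off \<open>schwartz\<close> the two sides agree by extensionality.\<close>

lemma schwartz_dual_inverse:
  assumes "u \<in> extensional schwartz"
    and "\<And>f. f \<in> schwartz \<Longrightarrow> T f \<in> schwartz" "\<And>f. f \<in> schwartz \<Longrightarrow> S (T f) = f"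
  shows "schwartz_dual T (schwartz_dual S u) = u"
proof
  fix f
  show "schwartz_dual T (schwartz_dual S u) f = u f"
    using assms by (cases "f \<in> schwartz") (simp_all add: schwartz_dual_def bracket_def schwartz_cnj extensional_def)
qed

lemma met_schwartz_add:
  assumes U: "metaplectic A U" and B: "A ** B = mat 1" and f: "f \<in> schwartz" and g: "g \<in> schwartz"
  shows "met_schwartz U (\<lambda>x. f x + g x) = (\<lambda>x. met_schwartz U f x + met_schwartz U g x)"
proof (rule met_schwartz_eqI)
  note S = schwartz_cont_op_in[OF schwartz_cont_op_met_schwartz[OF U B]]
  show "(\<lambda>x. met_schwartz U f x + met_schwartz U g x) \<in> schwartz" by (intro schwartz_add S f g)
  have "unitary_L2 U" using U by (simp add: metaplectic_def)
  from unitary_L2_add[OF this schwartz_L2[OF f] schwartz_L2[OF g]] AE_met_schwartz[OF U B f] AE_met_schwartz[OF U B g]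
  show "AE x in lborel. U (\<lambda>x. f x + g x) x = met_schwartz U f x + met_schwartz U g x" by eventually_elim simp
qed

lemma met_schwartz_cmult:
  assumes U: "metaplectic A U" and B: "A ** B = mat 1" and f: "f \<in> schwartz"
  shows "met_schwartz U (\<lambda>x. c * f x) = (\<lambda>x. c * met_schwartz U f x)"
proof (rule met_schwartz_eqI)
  note S = schwartz_cont_op_in[OF schwartz_cont_op_met_schwartz[OF U B]]
  show "(\<lambda>x. c * met_schwartz U f x) \<in> schwartz" by (intro schwartz_cmult S f)
  have "unitary_L2 U" using U by (simp add: metaplectic_def)
  from unitary_L2_cmult[OF this schwartz_L2[OF f], of c] AE_met_schwartz[OF U B f]
  show "AE x in lborel. U (\<lambda>x. c * f x) x = c * met_schwartz U f x" by eventually_elim simp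
qed

lemma met_schwartz_inverse:
  assumes U: "metaplectic A U" "A ** B = mat 1" and V: "metaplectic B V" "B ** A = mat 1"
    and UV: "\<And>f. f \<in> L2 \<Longrightarrow> AE x in lborel. U (V f) x = f x" and f: "f \<in> schwartz"
  shows "met_schwartz U (met_schwartz V f) = f"
proof (rule met_schwartz_eqI[OF f])
  have Vf: "met_schwartz V f \<in> schwartz"
    by (rule schwartz_cont_op_in[OF schwartz_cont_op_met_schwartz[OF V] f])
  have u: "unitary_L2 U" "unitary_L2 V" using U V by (simp_all add: metaplectic_def)
  \<comment> \<open>The Schwartz representative and the chosen value \<open>V f\<close> may differ
    on a null set; \<open>U\<close> respects classes, so one may replace the other under it.\<close>
  have "AE x in lborel. met_schwartz V f x = V f x"
    using AE_met_schwartz[OF V f] by eventually_elim simp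
  then have "AE x in lborel. U (met_schwartz V f) x = U (V f) x"
    by (rule unitary_L2_AE_cong[OF u(1) schwartz_L2[OF Vf] unitary_L2_in[OF u(2) schwartz_L2[OF f]]])
  with UV[OF schwartz_L2[OF f]] show "AE x in lborel. U (met_schwartz V f) x = f x" by eventually_elim simp
qed

theorem proposition3p10:
  fixes A :: "real^(('d::finite + 'd) + ('d + 'd))^(('d + 'd) + ('d + 'd))"
    and U :: "(real^('d + 'd) \<Rightarrow> complex) \<Rightarrow> real^('d + 'd) \<Rightarrow> complex"
    and \<phi>1 \<phi>2 :: "real^'d \<Rightarrow> complex"
    and a k :: "(real^('d + 'd) \<Rightarrow> complex) \<Rightarrow> complex"
  assumes "A \<in> Sp"
    and "metaplectic A U"
    and "\<phi>1 \<in> schwartz" and "\<phi>2 \<in> schwartz"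
    and "a \<in> tempered"
  shows "is_schwartz_kernel (loc_op U a \<phi>1 \<phi>2) k \<longleftrightarrow>
         k = met_dist_inv U (conv a (wigner U \<phi>2 \<phi>1))"
proof -
  note U = assms(2)
  obtain B where AB: "A ** B = mat 1" and BA: "B ** A = mat 1" using Sp_invertible[OF assms(1)] .
  obtain V where V: "metaplectic B V" and UV: "\<And>f. f \<in> L2 \<Longrightarrow> AE x in lborel. U (V f) x = f x"
    and VU: "\<And>f. f \<in> L2 \<Longrightarrow> AE x in lborel. V (U f) x = f x"
    using metaplectic_inverse[OF U AB] by blast
  let ?m = "met_schwartz U" and ?m' = "met_schwartz V"
  let ?\<sigma> = "conv a (wigner U \<phi>2 \<phi>1)"
  have m: "schwartz_cont_op ?m" and m': "schwartz_cont_op ?m'"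
    using schwartz_cont_op_met_schwartz[OF U AB] schwartz_cont_op_met_schwartz[OF V BA] .
  note m_in = schwartz_cont_op_in[OF m] and m'_in = schwartz_cont_op_in[OF m']
  have mm': "?m (?m' f) = f" if "f \<in> schwartz" for f
    using met_schwartz_inverse[OF U AB V BA UV that] .
  have m'm: "?m' (?m f) = f" if "f \<in> schwartz" for f
    using met_schwartz_inverse[OF V BA U AB VU that] .
  have inv: "inv_into schwartz ?m f = ?m' f" if "f \<in> schwartz" for f
    using m'm m'_in[OF that] mm'[OF that] by (intro inv_into_f_eq) (auto intro: inj_on_inverseI)
  \<comment> \<open>\<open>met_dist\<close> is built from \<open>inv_into\<close>; once that inverse
    is recognised as \<open>?m'\<close>, the extension of \<open>U\<close> to distributions is the
    adjoint of \<open>?m'\<close>.\<close>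
  have dist: "met_dist U u = schwartz_dual ?m' u" for u
    unfolding met_dist_def schwartz_dual_def by (rule restrict_ext) (simp add: inv schwartz_cnj)
  have w: "wigner U \<phi>2 \<phi>1 \<in> schwartz"
    unfolding wigner_def by (intro m_in schwartz_tensor schwartz_cnj assms)
  have \<sigma>: "?\<sigma> \<in> tempered" by (rule conv_tempered[OF assms(5) w])
  have dual_m: "schwartz_dual ?m u \<in> tempered" if "u \<in> tempered" for u
    by (rule schwartz_dual_tempered[OF m met_schwartz_add[OF U AB] met_schwartz_cmult[OF U AB] that])
  have ext: "u \<in> extensional schwartz" if "u \<in> tempered" for u :: "(real^('d + 'd) \<Rightarrow> complex) \<Rightarrow> complex"
    using that by (simp add: tempered_def)
  \<comment> \<open>The adjoint of \<open>?m\<close> inverts the adjoint of \<open>?m'\<close> from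
    both sides. One side shows injectivity, so that \<open>inv_into\<close> has only one preimage to
    choose; the other shows that this preimage is the claimed one.\<close>
  have k0: "met_dist_inv U ?\<sigma> = schwartz_dual ?m ?\<sigma>"
    unfolding met_dist_inv_def
  proof (rule inv_into_f_eq)
    show "inj_on (met_dist U) tempered"
      by (rule inj_on_inverseI[of _ "schwartz_dual ?m"])
        (simp add: dist schwartz_dual_inverse ext m_in m'm)
    show "met_dist U (schwartz_dual ?m ?\<sigma>) = ?\<sigma>"
      by (simp add: dist schwartz_dual_inverse ext[OF \<sigma>] m'_in mm')
  qed (rule dual_m[OF \<sigma>])
  have kernel: "is_schwartz_kernel (loc_op U a \<phi>1 \<phi>2) k \<longleftrightarrow> k \<in> tempered \<and>
      (\<forall>f\<in>schwartz. \<forall>g\<in>schwartz. bracket (schwartz_dual ?m ?\<sigma>) (tensor g (\<lambda>y. cnj (f y))) = bracket k (tensor g (\<lambda>y. cnj (f y))))"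
  proof -
    have "bracket (loc_op U a \<phi>1 \<phi>2 f) g = bracket (schwartz_dual ?m ?\<sigma>) (tensor g (\<lambda>y. cnj (f y)))"
      if f: "f \<in> schwartz" and g: "g \<in> schwartz" for f g
    proof -
      have T: "(\<lambda>x. cnj (tensor g (\<lambda>y. cnj (f y)) x)) \<in> schwartz"
        by (intro schwartz_cnj schwartz_tensor f g)
      have "bracket (loc_op U a \<phi>1 \<phi>2 f) g = bracket ?\<sigma> (?m (tensor g (\<lambda>y. cnj (f y))))"
        unfolding loc_op_def bracket_Op[OF g] wigner_def ..
      also have "\<dots> = bracket (schwartz_dual ?m ?\<sigma>) (tensor g (\<lambda>y. cnj (f y)))"
        using T by (simp add: schwartz_dual_def bracket_def)
      finally show ?thesis .
    qed
    then show ?thesis by (simp add: is_schwartz_kernel_def)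
  qed
  show ?thesis
  proof
    assume "is_schwartz_kernel (loc_op U a \<phi>1 \<phi>2) k"
    then have k: "k \<in> tempered"
      and eq: "\<And>f g. f \<in> schwartz \<Longrightarrow> g \<in> schwartz \<Longrightarrow>
        bracket (schwartz_dual ?m ?\<sigma>) (tensor g (\<lambda>y. cnj (f y))) = bracket k (tensor g (\<lambda>y. cnj (f y)))"
      unfolding kernel by auto
    \<comment> \<open>The bracket conjugates its argument, so the kernel identity taken for
      \<open>g\<close> and the conjugate of \<open>f\<close> speaks about \<open>tensor f g\<close>
      itself.\<close>
    have "k (tensor f g) = schwartz_dual ?m ?\<sigma> (tensor f g)" if "f \<in> schwartz" "g \<in> schwartz" for f g
      using eq[OF that(2) schwartz_cnj[OF that(1)]] by (simp add: bracket_def tensor_def)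
    from tempered_eq_if_eq_on_tensor[OF k dual_m[OF \<sigma>] this]
    show "k = met_dist_inv U ?\<sigma>" unfolding k0 .
  next
    assume "k = met_dist_inv U ?\<sigma>"
    then show "is_schwartz_kernel (loc_op U a \<phi>1 \<phi>2) k"
      unfolding kernel k0 using dual_m[OF \<sigma>] by simp
  qed
qed

end
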